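(* Let $*\in\{\emptyset,\vee\}$ be fixed, let $\mathcal W,\mathcal W'$ be level-zero fundamental modules of a quantum affine algebra $\mathbf U$, attached to $r,r'\in I_0$, and suppose given quantum $K$-matrices $K_{\mathcal W}(x):\mathcal W(x)\to\mathcal W^*(x^{-1})$, $K_{\mathcal W'}(y):\mathcal W'(y)\to\mathcal W'^*(y^{-1})$ satisfying the reflection equation for fundamental modules (written in the context). For $s\ge1$ let $$K_{\mathcal W_s}(x)=K^{(s)}(x)\cdots K^{(2)}(x)K^{(1)}(x),$$ $$K^{(j)}(x)=K_1(q_r^{-s+2j-1}x)\,R^*_{1,2}(q_r^{s-2j+3}x^{-1},q_r^{-s+2j-1}x)\,R^*_{2,3}(q_r^{s-2j+5}x^{-1},q_r^{-s+2j-1}x)\cdots R^*_{j-1,j}(q_r^{s-1}x^{-1},q_r^{-s+2j-1}x),$$ where $K_1$ is $K_{\mathcal W}$ acting on the first tensor component and $R^*_{i,i+1}$ is $R_{\mathcal W^*,\mathcal W}$ acting on the $i$-th and $(i+1)$-th components; this is a map from $\mathcal W(q_r^{1-s}x)\otimes\cdots\otimes\mathcal W(q_r^{s-1}x)$ to $\mathcal W^*(q_r^{1-s}x^{-1})\otimes\cdots\otimes\mathcal W^*(q_r^{s-1}x^{-1})$. Then: (i) $K_{\mathcal W_s}(x)$ maps the Kirillov-Reshetikhin module $\mathcal W_s(x)$ into $\mathcal W_s^*(x^{-1})$. (ii) For all $s,s'\ge1$ these quantum $K$-matrices satisfy the reflection equation $$R_{\mathcal W'^*_{s'},\mathcal W^*_s}(y^{-1},x^{-1})K_{\mathcal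 W'_{s'}}(y)R_{\mathcal W_s^*,\mathcal W'_{s'}}(x^{-1},y)K_{\mathcal W_s}(x)=K_{\mathcal W_s}(x)R_{\mathcal W'^*_{s'},\mathcal W_s}(y^{-1},x)K_{\mathcal W'_{s'}}(y)R_{\mathcal W_s,\mathcal W'_{s'}}(x,y)$$ as maps $\mathcal W_s(x)\otimes\mathcal W'_{s'}(y)\to\mathcal W_s^*(x^{-1})\otimes\mathcal W'^*_{s'}(y^{-1})$, where every $K$ acts on the leftmost tensor factor.
   Context: $\mathbf U$ is the quantum group over $\mathbb C(q)$ (generators $E_i,F_i,K_i^{\pm1}$, $i\in I$) of an affine Cartan matrix $A$ with affine node $0$; $I_0=I\setminus\{0\}$; $D=\mathrm{diag}(d_i)$ symmetrizes $A$, $q_i=q^{d_i}$. Coproduct: $\Delta(E_i)=E_i\otimes1+K_i\otimes E_i$, $\Delta(F_i)=F_i\otimes K_i^{-1}+1\otimes F_i$, $\Delta(K_i)=K_i\otimes K_i$. For $r\in I_0$, $\varpi_r=\Lambda_r-\langle c,\Lambda_r\rangle\Lambda_0$ and $W(\varpi_r)$ is Kashiwara's finite-dimensional level-zero fundamental $\mathbf U$-module. If $\mathcal W=W(\varpi_r)$, then $\mathcal W^\vee=W(\varpi_{r^\vee})$, where $-w_0\varpi_r=\varpi_{r^\vee}$ and $w_0$ is the longest element of the finite Weyl group generated by $s_i$, $i\in I_0$; $\mathcal W^\emptyset=\mathcal W$. The case $*=\emptyset$ is called untwisted, $*=\vee$ twisted. For a finite-dimensional module $U$, $U(x)$ is $U$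 with $E_0,F_0$ acting as $xE_0,x^{-1}F_0$. Quantum $R$-matrices: for the fundamental modules involved we are given $\mathbf U$-linear maps $R_{U,V}(x,y):U(x)\otimes V(y)\to V(y)\otimes U(x)$, depending rationally on $x/y$, satisfying the Yang-Baxter equation $R_{V,W}(y,z)R_{U,W}(x,z)R_{U,V}(x,y)=R_{U,V}(x,y)R_{U,W}(x,z)R_{V,W}(y,z)$. All parameters are such that the maps occurring are defined ($x,y$ may be taken generic). Quantum $K$-matrices for fundamental modules are linear maps, rational in the spectral parameter, $K_{\mathcal W}(x):\mathcal W(x)\to\mathcal W^*(x^{-1})$, such that for all pairs of the fundamental modules $\mathcal W,\mathcal W'$ considered (including equal ones) the reflection equation $$R_{\mathcal W'^*,\mathcal W^*}(y^{-1},x^{-1})K_{\mathcal W'}(y)R_{\mathcal W^*,\mathcal W'}(x^{-1},y)K_{\mathcal W}(x)=K_{\mathcal W}(x)R_{\mathcal W'^*,\mathcal W}(y^{-1},x)K_{\mathcal W'}(y)R_{\mathcal W,\mathcal W'}(x,y)$$ holds as maps $\mathcal W(x)\otimes\mathcal W'(y)\to\mathcal W^*(x^{-1})\otimes\mathcal W'^*(y^{-1})$, each $K$ acting on the leftmost factor. KR modules: for a fundamental module $\mathcal W$ attached to $r$ and $R(x,y)=R_{\mathcal W,\mathcal W}(x,y)$, define for $w\in\mathfrak S_s$ maps $R_w(x_1,\dots,x_s):\mathcal W(x_1)\otimes\cdots\otimes\mathcal W(x_s)\to\mathcal W(x_{w(1)})\otimes\cdots\otimes\mathcal W(x_{w(s)})$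 by $R_1=\mathrm{id}$, $R_{\sigma_i}=R(x_i,x_{i+1})$ on components $i,i+1$ for $\sigma_i=(i\ i+1)$, and $R_{ww'}(x_1,\dots,x_s)=R_{w'}(x_{w(1)},\dots,x_{w(s)})R_w(x_1,\dots,x_s)$ when $\ell(ww')=\ell(w)+\ell(w')$. With $\sigma_0$ the longest element and $x_i=q_r^{s-2i+1}$ put $R_s=R_{\sigma_0}(x_1,\dots,x_s)$ and $\mathcal W_s=\operatorname{Im}R_s\subset\mathcal W(q_r^{1-s})\otimes\cdots\otimes\mathcal W(q_r^{s-1})$. $\mathcal W_s^\vee$ is constructed in the same way from $\mathcal W^\vee$, and $\mathcal W_s^\emptyset=\mathcal W_s$. Fused $R$-matrix: for KR modules $\mathcal W_s\subset\mathcal W(q_r^{1-s})\otimes\cdots\otimes\mathcal W(q_r^{s-1})$ and $\mathcal W'_{s'}\subset\mathcal W'(q_{r'}^{1-s'})\otimes\cdots\otimes\mathcal W'(q_{r'}^{s'-1})$, $R_{\mathcal W_s,\mathcal W'_{s'}}(x,y):\mathcal W_s(x)\otimes\mathcal W'_{s'}(y)\to\mathcal W'_{s'}(y)\otimes\mathcal W_s(x)$ is the restriction of $M_1M_2\cdots M_s$, where $M_k=R_{k+s'-1,k+s'}\cdots R_{k+1,k+2}R_{k,k+1}$ and $R_{i,i+1}$ is the quantum $R$-matrix on the current $i$-th and $(i+1)$-th components; it is known to take values in $\mathcal W'_{s'}(y)\otimes\mathcal W_s(x)$. The same definition is used with $\mathcal W_s^*$, $\mathcal W'^*_{s'}$ in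 place of $\mathcal W_s,\mathcal W'_{s'}$. *)

theory Defs
  imports
    "HOL-Library.Poly_Mapping"
    "HOL-Combinatorics.Transposition"
    "HOL-Computational_Algebra.Fraction_Field"
    "Jordan_Normal_Form.VS_Connect"
begin

section \<open>The ground field and rational functions over it\<close>

type_synonym Cq = "complex poly fract"

definition qvar :: Cq where
  "qvar = Fract [:0, 1:] 1"

definition qpar :: "('i \<Rightarrow> nat) \<Rightarrow> 'i \<Rightarrow> Cq" where
  "qpar d i = qvar ^ d i"

text \<open>A rational function is defined at a point iff it has some representation whose denominator
  does not vanish there, i.e. iff the point is not a pole.\<close>

definition ratfun_defined :: "'a::field poly fract \<Rightarrow> 'a \<Rightarrow> bool" where
  "ratfun_defined f z \<longleftrightarrow> (\<exists>p t. f = Fract p t \<and> poly t z \<noteq> 0)"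

definition ratfun_eval :: "'a::field poly fract \<Rightarrow> 'a \<Rightarrow> 'a" where
  "ratfun_eval f z = (THE c. \<exists>p t. f = Fract p t \<and> poly t z \<noteq> 0 \<and> c = poly p z / poly t z)"

definition mat_defined :: "'a::field poly fract mat \<Rightarrow> 'a \<Rightarrow> bool" where
  "mat_defined T z \<longleftrightarrow> (\<forall>i < dim_row T. \<forall>j < dim_col T. ratfun_defined (T $$ (i, j)) z)"

definition mat_eval :: "'a::field poly fract mat \<Rightarrow> 'a \<Rightarrow> 'a mat" where
  "mat_eval T z = map_mat (\<lambda>f. ratfun_eval f z) T"


section \<open>Tensor products in coordinates\<close>

text \<open>A space of dimension m tensored with one of dimension n is the coordinate space of dimension
  mn, the basis vector with indices (i, k) having number i * n + k. This makes the
  tensor product strictly associative.\<close>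

definition kron :: "'a::semiring_1 mat \<Rightarrow> 'a mat \<Rightarrow> 'a mat" where
  "kron S T = mat (dim_row S * dim_row T) (dim_col S * dim_col T)
     (\<lambda>(i, j). S $$ (i div dim_row T, j div dim_col T) * T $$ (i mod dim_row T, j mod dim_col T))"

definition kron_vec :: "'a::semiring_1 vec \<Rightarrow> 'a vec \<Rightarrow> 'a vec" where
  "kron_vec u v = vec (dim_vec u * dim_vec v)
     (\<lambda>i. u $ (i div dim_vec v) * v $ (i mod dim_vec v))"

definition at_pos :: "nat \<Rightarrow> 'a::semiring_1 mat \<Rightarrow> nat \<Rightarrow> 'a mat" where
  "at_pos l T r = kron (1\<^sub>m l) (kron T (1\<^sub>m r))"

definition tensor_space :: "nat \<Rightarrow> nat \<Rightarrow> Cq vec set \<Rightarrow> Cq vec set \<Rightarrow> Cq vec set" where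
  "tensor_space m n X Y =
     LinearCombinations.module.span class_ring (module_vec TYPE(Cq) (m * n))
       {kron_vec u v | u v. u \<in> X \<and> v \<in> Y}"

definition image_space :: "'a::semiring_1 mat \<Rightarrow> 'a vec set" where
  "image_space T = (\<lambda>v. T *\<^sub>v v) ` carrier_vec (dim_col T)"


section \<open>Affine Cartan matrices and the Weyl group\<close>

text \<open>The entry A i j is the pairing of the simple coroot of i with the simple root of j.\<close>

definition affine_cartan :: "('i::finite \<Rightarrow> 'i \<Rightarrow> int) \<Rightarrow> bool" where
  "affine_cartan A \<longleftrightarrow>
     (\<forall>i. A i i = 2) \<and>
     (\<forall>i j. i \<noteq> j \<longrightarrow> A i j \<le> 0) \<and>
     (\<forall>i j. A i j = 0 \<longrightarrow> A j i = 0) \<and>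
     (\<forall>J. J \<noteq> {} \<and> J \<noteq> UNIV \<longrightarrow> (\<exists>i\<in>J. \<exists>j\<in>-J. A i j \<noteq> 0)) \<and>
     (\<exists>a. (\<forall>i. a i > 0) \<and> (\<forall>i. (\<Sum>j\<in>UNIV. A i j * a j) = 0))"

definition symmetrizer :: "('i \<Rightarrow> 'i \<Rightarrow> int) \<Rightarrow> ('i \<Rightarrow> nat) \<Rightarrow> bool" where
  "symmetrizer A d \<longleftrightarrow>
     (\<forall>i. d i > 0) \<and> (\<forall>i j. int (d i) * A i j = int (d j) * A j i)"

text \<open>The coefficients of the null root in the simple roots and of the canonical central element
  c in the simple coroots.\<close>

definition marks :: "('i::finite \<Rightarrow> 'i \<Rightarrow> int) \<Rightarrow> 'i \<Rightarrow> int" where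
  "marks A = (THE a. (\<forall>i. a i > 0) \<and> (\<forall>i. (\<Sum>j\<in>UNIV. A i j * a j) = 0) \<and> Gcd (range a) = 1)"

definition comarks :: "('i::finite \<Rightarrow> 'i \<Rightarrow> int) \<Rightarrow> 'i \<Rightarrow> int" where
  "comarks A = marks (\<lambda>i j. A j i)"

text \<open>The usual choice of the node 0: both labels are 1, except in type \<open>A\<^sub>2\<^sub>n\<^sup>(\<^sup>2\<^sup>)\<close>, the only
  type without such a node, where the label of the central element is 1. Up to diagram
  automorphisms this is the node 0 of Kac's tables.\<close>

definition affine_node :: "('i::finite \<Rightarrow> 'i \<Rightarrow> int) \<Rightarrow> 'i \<Rightarrow> bool" where
  "affine_node A i0 \<longleftrightarrow>
     comarks A i0 = 1 \<and> (marks A i0 = 1 \<or> \<not> (\<exists>i. marks A i = 1 \<and> comarks A i = 1))"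

text \<open>A weight is given by its pairings \<open>\<lambda>\<close> with the simple coroots and a displacement
  \<open>\<beta>\<close> in the root lattice, and stands for \<open>\<lambda> + (\<Sum>j. \<beta> j \<alpha>\<^sub>j)\<close>; keeping the displacement separate
  retains multiples of the null root, which all simple coroots kill. A list of nodes stands for
  the product of the corresponding simple reflections, the head acting last.\<close>

definition coroot_pairing ::
    "('i::finite \<Rightarrow> 'i \<Rightarrow> int) \<Rightarrow> ('i \<Rightarrow> int) \<Rightarrow> ('i \<Rightarrow> int) \<Rightarrow> 'i \<Rightarrow> int" where
  "coroot_pairing A lam bet i = lam i + (\<Sum>j\<in>UNIV. A i j * bet j)"

fun weyl_shift :: "('i::finite \<Rightarrow> 'i \<Rightarrow> int) \<Rightarrow> ('i \<Rightarrow> int) \<Rightarrow> 'i list \<Rightarrow> 'i \<Rightarrow> int" where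
  "weyl_shift A lam [] = (\<lambda>_. 0)"
| "weyl_shift A lam (i # w) =
     (let bet = weyl_shift A lam w in bet(i := bet i - coroot_pairing A lam bet i))"

definition weyl_weight :: "('i::finite \<Rightarrow> 'i \<Rightarrow> int) \<Rightarrow> ('i \<Rightarrow> int) \<Rightarrow> 'i list \<Rightarrow> 'i \<Rightarrow> int" where
  "weyl_weight A lam w = coroot_pairing A lam (weyl_shift A lam w)"

definition weyl_eq :: "('i::finite \<Rightarrow> 'i \<Rightarrow> int) \<Rightarrow> 'i list \<Rightarrow> 'i list \<Rightarrow> bool" where
  "weyl_eq A w w' \<longleftrightarrow> (\<forall>lam. weyl_shift A lam w = weyl_shift A lam w')"

definition weyl_length :: "('i::finite \<Rightarrow> 'i \<Rightarrow> int) \<Rightarrow> 'i set \<Rightarrow> 'i list \<Rightarrow> nat" where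
  "weyl_length A J w = (LEAST n. \<exists>w'. set w' \<subseteq> J \<and> weyl_eq A w' w \<and> length w' = n)"

definition longest_element :: "('i::finite \<Rightarrow> 'i \<Rightarrow> int) \<Rightarrow> 'i set \<Rightarrow> 'i list \<Rightarrow> bool" where
  "longest_element A J w \<longleftrightarrow>
     set w \<subseteq> J \<and> (\<forall>w'. set w' \<subseteq> J \<longrightarrow> weyl_length A J w' \<le> weyl_length A J w)"

definition level_zero_weight :: "('i::finite \<Rightarrow> 'i \<Rightarrow> int) \<Rightarrow> 'i \<Rightarrow> 'i \<Rightarrow> 'i \<Rightarrow> int" where
  "level_zero_weight A i0 r i =
     (if i = r then 1 else 0) - comarks A r * (if i = i0 then 1 else 0)"


section \<open>The quantum group by generators and relations\<close>

datatype 'i gen = GE 'i | GF 'i | GK 'i | GKi 'i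

datatype 'i gword = GWord (letters: "'i gen list")

instantiation gword :: (type) monoid_add
begin

definition zero_gword :: "'a gword" where
  "zero_gword = GWord []"

definition plus_gword :: "'a gword \<Rightarrow> 'a gword \<Rightarrow> 'a gword" where
  "plus_gword v w = GWord (letters v @ letters w)"

instance
  by standard (simp_all add: zero_gword_def plus_gword_def)

end

text \<open>The monoid algebra of the free monoid, i.e. the free associative algebra.\<close>

type_synonym 'i falg = "'i gword \<Rightarrow>\<^sub>0 Cq"

definition scal :: "Cq \<Rightarrow> 'i falg" where
  "scal c = Poly_Mapping.single 0 c"

definition gen :: "'i gen \<Rightarrow> 'i falg" where
  "gen g = Poly_Mapping.single (GWord [g]) 1"

abbreviation "xE i \<equiv> gen (GE i)"
abbreviation "xF i \<equiv> gen (GF i)"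
abbreviation "xK i \<equiv> gen (GK i)"
abbreviation "xKi i \<equiv> gen (GKi i)"

definition qint :: "Cq \<Rightarrow> nat \<Rightarrow> Cq" where
  "qint t n = (t ^ n - inverse t ^ n) / (t - inverse t)"

definition qfact :: "Cq \<Rightarrow> nat \<Rightarrow> Cq" where
  "qfact t n = (\<Prod>k=1..n. qint t k)"

definition divpow :: "Cq \<Rightarrow> 'i falg \<Rightarrow> nat \<Rightarrow> 'i falg" where
  "divpow t X n = scal (inverse (qfact t n)) * X ^ n"

definition serre :: "('i \<Rightarrow> 'i \<Rightarrow> int) \<Rightarrow> ('i \<Rightarrow> nat) \<Rightarrow> ('i \<Rightarrow> 'i falg) \<Rightarrow> 'i \<Rightarrow> 'i \<Rightarrow> 'i falg" where
  "serre A d X i j =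
     (let m = nat (1 - A i j) in
      \<Sum>k\<le>m. (-1) ^ k * divpow (qpar d i) (X i) (m - k) * X j * divpow (qpar d i) (X i) k)"

inductive_set U_relations :: "('i \<Rightarrow> 'i \<Rightarrow> int) \<Rightarrow> ('i \<Rightarrow> nat) \<Rightarrow> 'i falg set" for A d where
  "xK i * xKi i - 1 \<in> U_relations A d"
| "xKi i * xK i - 1 \<in> U_relations A d"
| "xK i * xK j - xK j * xK i \<in> U_relations A d"
| "xK i * xE j * xKi i - scal (qpar d i powi A i j) * xE j \<in> U_relations A d"
| "xK i * xF j * xKi i - scal (qpar d i powi (- A i j)) * xF j \<in> U_relations A d"
| "xE i * xF i - xF i * xE i
     - scal (inverse (qpar d i - inverse (qpar d i))) * (xK i - xKi i) \<in> U_relations A d"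
| "i \<noteq> j \<Longrightarrow> xE i * xF j - xF j * xE i \<in> U_relations A d"
| "i \<noteq> j \<Longrightarrow> serre A d xE i j \<in> U_relations A d"
| "i \<noteq> j \<Longrightarrow> serre A d xF i j \<in> U_relations A d"

text \<open>The preimage in the free algebra of the left ideal of the quantum group generated by L.\<close>

inductive_set U_left_ideal ::
    "('i \<Rightarrow> 'i \<Rightarrow> int) \<Rightarrow> ('i \<Rightarrow> nat) \<Rightarrow> 'i falg set \<Rightarrow> 'i falg set" for A d L where
  "0 \<in> U_left_ideal A d L"
| "f \<in> U_left_ideal A d L \<Longrightarrow> g \<in> U_left_ideal A d L \<Longrightarrow> f + g \<in> U_left_ideal A d L"
| "u \<in> U_relations A d \<Longrightarrow> a * u * b \<in> U_left_ideal A d L"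
| "l \<in> L \<Longrightarrow> a * l \<in> U_left_ideal A d L"


section \<open>Finite-dimensional modules\<close>

record 'i umodule =
  mdim :: nat
  opE :: "'i \<Rightarrow> Cq mat"
  opF :: "'i \<Rightarrow> Cq mat"
  opK :: "'i \<Rightarrow> Cq mat"
  opKi :: "'i \<Rightarrow> Cq mat"

fun gen_mat :: "'i umodule \<Rightarrow> 'i gen \<Rightarrow> Cq mat" where
  "gen_mat M (GE i) = opE M i"
| "gen_mat M (GF i) = opF M i"
| "gen_mat M (GK i) = opK M i"
| "gen_mat M (GKi i) = opKi M i"

definition word_mat :: "'i umodule \<Rightarrow> 'i gword \<Rightarrow> Cq mat" where
  "word_mat M w = foldr (\<lambda>g T. gen_mat M g * T) (letters w) (1\<^sub>m (mdim M))"

definition act :: "'i umodule \<Rightarrow> 'i falg \<Rightarrow> Cq mat" where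
  "act M f = mat (mdim M) (mdim M)
     (\<lambda>ij. \<Sum>w\<in>Poly_Mapping.keys f. Poly_Mapping.lookup f w * word_mat M w $$ ij)"

definition is_module :: "('i \<Rightarrow> 'i \<Rightarrow> int) \<Rightarrow> ('i \<Rightarrow> nat) \<Rightarrow> 'i umodule \<Rightarrow> bool" where
  "is_module A d M \<longleftrightarrow>
     (\<forall>g. gen_mat M g \<in> carrier_mat (mdim M) (mdim M)) \<and>
     (\<forall>u\<in>U_relations A d. act M u = 0\<^sub>m (mdim M) (mdim M))"

text \<open>M is isomorphic to the quotient of the quantum group by the left ideal generated by L.\<close>

definition presented_by ::
    "('i \<Rightarrow> 'i \<Rightarrow> int) \<Rightarrow> ('i \<Rightarrow> nat) \<Rightarrow> 'i falg set \<Rightarrow> 'i umodule \<Rightarrow> bool" where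
  "presented_by A d L M \<longleftrightarrow>
     is_module A d M \<and>
     (\<exists>v\<in>carrier_vec (mdim M).
        (\<forall>u\<in>carrier_vec (mdim M). \<exists>f. act M f *\<^sub>v v = u) \<and>
        (\<forall>f. act M f *\<^sub>v v = 0\<^sub>v (mdim M) \<longleftrightarrow> f \<in> U_left_ideal A d L))"

definition spectral_shift :: "'i \<Rightarrow> Cq \<Rightarrow> 'i umodule \<Rightarrow> 'i umodule" where
  "spectral_shift i0 x M =
     M\<lparr>opE := (opE M)(i0 := x \<cdot>\<^sub>m opE M i0), opF := (opF M)(i0 := inverse x \<cdot>\<^sub>m opF M i0)\<rparr>"

definition tensor_module :: "'i umodule \<Rightarrow> 'i umodule \<Rightarrow> 'i umodule" where
  "tensor_module M N =
     \<lparr> mdim = mdim M * mdim N,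
       opE = (\<lambda>i. kron (opE M i) (1\<^sub>m (mdim N)) + kron (opK M i) (opE N i)),
       opF = (\<lambda>i. kron (opF M i) (opKi N i) + kron (1\<^sub>m (mdim M)) (opF N i)),
       opK = (\<lambda>i. kron (opK M i) (opK N i)),
       opKi = (\<lambda>i. kron (opKi M i) (opKi N i)) \<rparr>"

definition U_linear :: "'i umodule \<Rightarrow> 'i umodule \<Rightarrow> Cq mat \<Rightarrow> bool" where
  "U_linear M N T \<longleftrightarrow>
     T \<in> carrier_mat (mdim N) (mdim M) \<and> (\<forall>g. T * gen_mat M g = gen_mat N g * T)"


section \<open>Level-zero fundamental modules\<close>

text \<open>If u is a weight vector of weight \<open>\<lambda>\<close> then, for u to be extremal, applying this element to u
  has to give the vector \<open>u\<^sub>w\<close> of weight \<open>w\<lambda>\<close>.\<close>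

fun extremal_elem ::
    "('i::finite \<Rightarrow> 'i \<Rightarrow> int) \<Rightarrow> ('i \<Rightarrow> nat) \<Rightarrow> ('i \<Rightarrow> int) \<Rightarrow> 'i list \<Rightarrow> 'i falg" where
  "extremal_elem A d lam [] = 1"
| "extremal_elem A d lam (i # w) =
     (let m = weyl_weight A lam w i in
      (if m \<ge> 0 then divpow (qpar d i) (xF i) (nat m) else divpow (qpar d i) (xE i) (nat (- m)))
      * extremal_elem A d lam w)"

text \<open>The defining relations of Kashiwara's extremal weight module \<open>V(\<lambda>)\<close>, read for the quantum
  group without degree operator: the generator is an extremal vector of weight \<open>\<lambda>\<close>.\<close>

inductive_set extremal_relations ::
    "('i::finite \<Rightarrow> 'i \<Rightarrow> int) \<Rightarrow> ('i \<Rightarrow> nat) \<Rightarrow> ('i \<Rightarrow> int) \<Rightarrow> 'i falg set" for A d lam where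
  "xK i - scal (qpar d i powi lam i) \<in> extremal_relations A d lam"
| "weyl_weight A lam w i \<ge> 0 \<Longrightarrow>
     xE i * extremal_elem A d lam w \<in> extremal_relations A d lam"
| "weyl_weight A lam w i \<le> 0 \<Longrightarrow>
     xF i * extremal_elem A d lam w \<in> extremal_relations A d lam"
| "weyl_eq A w w' \<Longrightarrow>
     extremal_elem A d lam w - extremal_elem A d lam w' \<in> extremal_relations A d lam"

text \<open>The least positive k such that \<open>\<varpi>\<^sub>r + k\<delta>\<close> is in the Weyl group orbit of \<open>\<varpi>\<^sub>r\<close>.\<close>

definition level_zero_period :: "('i::finite \<Rightarrow> 'i \<Rightarrow> int) \<Rightarrow> 'i \<Rightarrow> 'i \<Rightarrow> nat" where
  "level_zero_period A i0 r =
     (LEAST k. k > 0 \<and>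
        (\<exists>w. \<forall>i. weyl_shift A (level_zero_weight A i0 r) w i = int k * marks A i))"

text \<open>\<open>W(\<varpi>\<^sub>r) = V(\<varpi>\<^sub>r) / (z\<^sub>r - 1) V(\<varpi>\<^sub>r)\<close>, where \<open>z\<^sub>r\<close> is the automorphism of \<open>V(\<varpi>\<^sub>r)\<close> commuting
  with the quantum group without degree operator and sending the generator u to the extremal vector
  of weight \<open>\<varpi>\<^sub>r + d\<^sub>r\<delta>\<close>, \<open>d\<^sub>r\<close> being the above period. As \<open>z\<^sub>r\<close> is linear over the quantum group,
  the submodule divided out is generated by \<open>z\<^sub>r u - u\<close>.\<close>

definition fundamental_relations ::
    "('i::finite \<Rightarrow> 'i \<Rightarrow> int) \<Rightarrow> ('i \<Rightarrow> nat) \<Rightarrow> 'i \<Rightarrow> 'i \<Rightarrow> 'i falg set" where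
  "fundamental_relations A d i0 r =
     (let lam = level_zero_weight A i0 r in
      extremal_relations A d lam \<union>
      {extremal_elem A d lam w - 1 | w.
         \<forall>i. weyl_shift A lam w i = int (level_zero_period A i0 r) * marks A i})"

definition fundamental_module ::
    "('i::finite \<Rightarrow> 'i \<Rightarrow> int) \<Rightarrow> ('i \<Rightarrow> nat) \<Rightarrow> 'i \<Rightarrow> 'i \<Rightarrow> 'i umodule \<Rightarrow> bool" where
  "fundamental_module A d i0 r M \<longleftrightarrow> presented_by A d (fundamental_relations A d i0 r) M"


section \<open>R-matrices and K-matrices of fundamental modules\<close>

text \<open>Throughout, M a is the fundamental module of the node a, the entries of Rm a b are rational
  functions of the quotient x / y of the spectral parameters, and those of Km a
  are rational functions of the spectral parameter.\<close>

type_synonym ratmat = "Cq poly fract mat"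

definition Rdef :: "('i \<Rightarrow> 'i \<Rightarrow> ratmat) \<Rightarrow> 'i \<Rightarrow> 'i \<Rightarrow> Cq \<Rightarrow> Cq \<Rightarrow> bool" where
  "Rdef Rm a b x y \<longleftrightarrow> mat_defined (Rm a b) (x / y)"

definition Rval :: "('i \<Rightarrow> 'i \<Rightarrow> ratmat) \<Rightarrow> 'i \<Rightarrow> 'i \<Rightarrow> Cq \<Rightarrow> Cq \<Rightarrow> Cq mat" where
  "Rval Rm a b x y = mat_eval (Rm a b) (x / y)"

definition Kdef :: "('i \<Rightarrow> ratmat) \<Rightarrow> 'i \<Rightarrow> Cq \<Rightarrow> bool" where
  "Kdef Km a x \<longleftrightarrow> mat_defined (Km a) x"

definition Kval :: "('i \<Rightarrow> ratmat) \<Rightarrow> 'i \<Rightarrow> Cq \<Rightarrow> Cq mat" where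
  "Kval Km a x = mat_eval (Km a) x"

definition quantum_R_matrices ::
    "'i \<Rightarrow> 'i set \<Rightarrow> ('i \<Rightarrow> 'i umodule) \<Rightarrow> ('i \<Rightarrow> 'i \<Rightarrow> ratmat) \<Rightarrow> bool" where
  "quantum_R_matrices i0 J M Rm \<longleftrightarrow>
     (\<forall>a\<in>J. \<forall>b\<in>J.
        Rm a b \<in> carrier_mat (mdim (M b) * mdim (M a)) (mdim (M a) * mdim (M b)) \<and>
        (\<forall>x y. x \<noteq> 0 \<and> y \<noteq> 0 \<and> Rdef Rm a b x y \<longrightarrow>
           U_linear
             (tensor_module (spectral_shift i0 x (M a)) (spectral_shift i0 y (M b)))
             (tensor_module (spectral_shift i0 y (M b)) (spectral_shift i0 x (M a)))
             (Rval Rm a b x y))) \<and>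
     (\<forall>a\<in>J. \<forall>b\<in>J. \<forall>c\<in>J. \<forall>x y z.
        x \<noteq> 0 \<and> y \<noteq> 0 \<and> z \<noteq> 0 \<and> Rdef Rm a b x y \<and> Rdef Rm a c x z \<and> Rdef Rm b c y z \<longrightarrow>
          kron (Rval Rm b c y z) (1\<^sub>m (mdim (M a)))
          * kron (1\<^sub>m (mdim (M b))) (Rval Rm a c x z)
          * kron (Rval Rm a b x y) (1\<^sub>m (mdim (M c)))
        = kron (1\<^sub>m (mdim (M c))) (Rval Rm a b x y)
          * kron (Rval Rm a c x z) (1\<^sub>m (mdim (M b)))
          * kron (1\<^sub>m (mdim (M a))) (Rval Rm b c y z))"

definition quantum_K_matrices ::
    "('i \<Rightarrow> 'i) \<Rightarrow> 'i set \<Rightarrow> ('i \<Rightarrow> 'i umodule) \<Rightarrow> ('i \<Rightarrow> 'i \<Rightarrow> ratmat) \<Rightarrow> ('i \<Rightarrow> ratmat) \<Rightarrow> bool" where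
  "quantum_K_matrices star J M Rm Km \<longleftrightarrow>
     (\<forall>a\<in>J. Km a \<in> carrier_mat (mdim (M (star a))) (mdim (M a))) \<and>
     (\<forall>a\<in>J. \<forall>b\<in>J. \<forall>x y.
        x \<noteq> 0 \<and> y \<noteq> 0 \<and> Kdef Km a x \<and> Kdef Km b y \<and>
        Rdef Rm a b x y \<and> Rdef Rm (star b) a (inverse y) x \<and>
        Rdef Rm (star a) b (inverse x) y \<and> Rdef Rm (star b) (star a) (inverse y) (inverse x) \<longrightarrow>
          Rval Rm (star b) (star a) (inverse y) (inverse x)
          * kron (Kval Km b y) (1\<^sub>m (mdim (M (star a))))
          * Rval Rm (star a) b (inverse x) y
          * kron (Kval Km a x) (1\<^sub>m (mdim (M b)))
        = kron (Kval Km a x) (1\<^sub>m (mdim (M (star b))))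
          * Rval Rm (star b) a (inverse y) x
          * kron (Kval Km b y) (1\<^sub>m (mdim (M a)))
          * Rval Rm a b x y)"


section \<open>Kirillov-Reshetikhin modules\<close>

definition perm_length :: "nat \<Rightarrow> (nat \<Rightarrow> nat) \<Rightarrow> nat" where
  "perm_length s w = card {(i, j). 1 \<le> i \<and> i < j \<and> j \<le> s \<and> w j < w i}"

definition longest_perm :: "nat \<Rightarrow> nat \<Rightarrow> nat" where
  "longest_perm s i = (if 1 \<le> i \<and> i \<le> s then s + 1 - i else i)"

text \<open>\<open>R_perm M Rm a s w x T\<close> says that T is \<open>R\<^sub>w(x\<^sub>1, \<dots>, x\<^sub>s)\<close> for the s-fold tensor power.\<close>

inductive R_perm ::
    "('i \<Rightarrow> 'i umodule) \<Rightarrow> ('i \<Rightarrow> 'i \<Rightarrow> ratmat) \<Rightarrow> 'i \<Rightarrow> nat \<Rightarrow>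
     (nat \<Rightarrow> nat) \<Rightarrow> (nat \<Rightarrow> Cq) \<Rightarrow> Cq mat \<Rightarrow> bool" for M Rm a s where
  "R_perm M Rm a s id x (1\<^sub>m (mdim (M a) ^ s))"
| "1 \<le> i \<Longrightarrow> i < s \<Longrightarrow>
     R_perm M Rm a s (Transposition.transpose i (i + 1)) x
       (at_pos (mdim (M a) ^ (i - 1)) (Rval Rm a a (x i) (x (i + 1))) (mdim (M a) ^ (s - i - 1)))"
| "R_perm M Rm a s w x T \<Longrightarrow> R_perm M Rm a s w' (x \<circ> w) T' \<Longrightarrow>
     perm_length s (w \<circ> w') = perm_length s w + perm_length s w' \<Longrightarrow>
     R_perm M Rm a s (w \<circ> w') x (T' * T)"

definition KR_source_param :: "('i \<Rightarrow> nat) \<Rightarrow> 'i \<Rightarrow> nat \<Rightarrow> nat \<Rightarrow> Cq" where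
  "KR_source_param d a s i = qpar d a powi (int s - 2 * int i + 1)"

definition KR_R :: "('i \<Rightarrow> nat) \<Rightarrow> ('i \<Rightarrow> 'i umodule) \<Rightarrow> ('i \<Rightarrow> 'i \<Rightarrow> ratmat) \<Rightarrow> 'i \<Rightarrow> nat \<Rightarrow> Cq mat" where
  "KR_R d M Rm a s = (THE T. R_perm M Rm a s (longest_perm s) (KR_source_param d a s) T)"

definition KR_defined :: "('i \<Rightarrow> nat) \<Rightarrow> ('i \<Rightarrow> 'i \<Rightarrow> ratmat) \<Rightarrow> 'i \<Rightarrow> nat \<Rightarrow> bool" where
  "KR_defined d Rm a s \<longleftrightarrow>
     (\<forall>i j. 1 \<le> i \<and> i < j \<and> j \<le> s \<longrightarrow>
        Rdef Rm a a (KR_source_param d a s i) (KR_source_param d a s j))"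

text \<open>The shifted module \<open>\<W>\<^sub>s(x)\<close> has the same underlying space for all x.\<close>

definition KR_module ::
    "('i \<Rightarrow> nat) \<Rightarrow> ('i \<Rightarrow> 'i umodule) \<Rightarrow> ('i \<Rightarrow> 'i \<Rightarrow> ratmat) \<Rightarrow> 'i \<Rightarrow> nat \<Rightarrow> Cq vec set" where
  "KR_module d M Rm a s = image_space (KR_R d M Rm a s)"

definition KR_dim :: "('i \<Rightarrow> 'i umodule) \<Rightarrow> 'i \<Rightarrow> nat \<Rightarrow> nat" where
  "KR_dim M a s = mdim (M a) ^ s"

text \<open>The spectral parameter of the i-th tensor factor of the space containing \<open>\<W>\<^sub>s(x)\<close>.\<close>

definition KR_param :: "('i \<Rightarrow> nat) \<Rightarrow> 'i \<Rightarrow> nat \<Rightarrow> Cq \<Rightarrow> nat \<Rightarrow> Cq" where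
  "KR_param d a s x i = qpar d a powi (- int s + 2 * int i - 1) * x"


section \<open>Fused R-matrices\<close>

text \<open>The factor \<open>R\<^bsub>k+j-1,k+j\<^esub>\<close> of \<open>M\<^sub>k\<close>. When it is applied, the spectral parameters of the
  components are \<open>x\<^sub>1, \<dots>, x\<^bsub>k-1\<^esub>, y\<^sub>1, \<dots>, y\<^bsub>j-1\<^esub>, x\<^sub>k, y\<^sub>j, \<dots>, y\<^sub>t, x\<^bsub>k+1\<^esub>, \<dots>, x\<^sub>s\<close>.\<close>

definition fused_factor ::
    "('i \<Rightarrow> nat) \<Rightarrow> ('i \<Rightarrow> 'i umodule) \<Rightarrow> ('i \<Rightarrow> 'i \<Rightarrow> ratmat) \<Rightarrow>
     'i \<Rightarrow> nat \<Rightarrow> 'i \<Rightarrow> nat \<Rightarrow> Cq \<Rightarrow> Cq \<Rightarrow> nat \<Rightarrow> nat \<Rightarrow> Cq mat" where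
  "fused_factor d M Rm a s b t x y k j =
     at_pos (mdim (M a) ^ (k - 1) * mdim (M b) ^ (j - 1))
       (Rval Rm a b (KR_param d a s x k) (KR_param d b t y j))
       (mdim (M b) ^ (t - j) * mdim (M a) ^ (s - k))"

definition fused_M ::
    "('i \<Rightarrow> nat) \<Rightarrow> ('i \<Rightarrow> 'i umodule) \<Rightarrow> ('i \<Rightarrow> 'i \<Rightarrow> ratmat) \<Rightarrow>
     'i \<Rightarrow> nat \<Rightarrow> 'i \<Rightarrow> nat \<Rightarrow> Cq \<Rightarrow> Cq \<Rightarrow> nat \<Rightarrow> Cq mat" where
  "fused_M d M Rm a s b t x y k =
     fold (\<lambda>j T. fused_factor d M Rm a s b t x y k j * T) [1..<t+1]
       (1\<^sub>m (KR_dim M a s * KR_dim M b t))"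

definition fused_R ::
    "('i \<Rightarrow> nat) \<Rightarrow> ('i \<Rightarrow> 'i umodule) \<Rightarrow> ('i \<Rightarrow> 'i \<Rightarrow> ratmat) \<Rightarrow>
     'i \<Rightarrow> nat \<Rightarrow> 'i \<Rightarrow> nat \<Rightarrow> Cq \<Rightarrow> Cq \<Rightarrow> Cq mat" where
  "fused_R d M Rm a s b t x y =
     foldr (\<lambda>k T. fused_M d M Rm a s b t x y k * T) [1..<s+1]
       (1\<^sub>m (KR_dim M a s * KR_dim M b t))"

definition fused_R_defined ::
    "('i \<Rightarrow> nat) \<Rightarrow> ('i \<Rightarrow> 'i \<Rightarrow> ratmat) \<Rightarrow>
     'i \<Rightarrow> nat \<Rightarrow> 'i \<Rightarrow> nat \<Rightarrow> Cq \<Rightarrow> Cq \<Rightarrow> bool" where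
  "fused_R_defined d Rm a s b t x y \<longleftrightarrow>
     (\<forall>k\<in>{1..s}. \<forall>j\<in>{1..t}. Rdef Rm a b (KR_param d a s x k) (KR_param d b t y j))"


section \<open>Fused K-matrices\<close>

text \<open>The first spectral parameter of the factor \<open>R\<^sup>*\<^bsub>i,i+1\<^esub>\<close> of \<open>K\<^sup>(\<^sup>j\<^sup>)(x)\<close>; the second one is
  \<open>KR_param d r s x j\<close>.\<close>

definition K_param :: "('i \<Rightarrow> nat) \<Rightarrow> 'i \<Rightarrow> nat \<Rightarrow> Cq \<Rightarrow> nat \<Rightarrow> nat \<Rightarrow> Cq" where
  "K_param d r s x j i = qpar d r powi (int s - 2 * int j + 2 * int i + 1) * inverse x"

text \<open>At the beginning of stage j the first j - 1 of the s components belong to the module of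
  the node star r and the others to that of r; the module of r moves from position j to 1.\<close>

definition K_factor ::
    "('i \<Rightarrow> 'i) \<Rightarrow> ('i \<Rightarrow> nat) \<Rightarrow> ('i \<Rightarrow> 'i umodule) \<Rightarrow> ('i \<Rightarrow> 'i \<Rightarrow> ratmat) \<Rightarrow>
     'i \<Rightarrow> nat \<Rightarrow> Cq \<Rightarrow> nat \<Rightarrow> nat \<Rightarrow> Cq mat" where
  "K_factor star d M Rm r s x j i =
     at_pos (mdim (M (star r)) ^ (i - 1))
       (Rval Rm (star r) r (K_param d r s x j i) (KR_param d r s x j))
       (mdim (M (star r)) ^ (j - 1 - i) * mdim (M r) ^ (s - j))"

definition K_stage ::
    "('i \<Rightarrow> 'i) \<Rightarrow> ('i \<Rightarrow> nat) \<Rightarrow> ('i \<Rightarrow> 'i umodule) \<Rightarrow> ('i \<Rightarrow> 'i \<Rightarrow> ratmat) \<Rightarrow> ('i \<Rightarrow> ratmat) \<Rightarrow>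
     'i \<Rightarrow> nat \<Rightarrow> Cq \<Rightarrow> nat \<Rightarrow> Cq mat" where
  "K_stage star d M Rm Km r s x j =
     kron (Kval Km r (KR_param d r s x j))
       (1\<^sub>m (mdim (M (star r)) ^ (j - 1) * mdim (M r) ^ (s - j)))
     * foldr (\<lambda>i T. K_factor star d M Rm r s x j i * T) [1..<j]
         (1\<^sub>m (mdim (M (star r)) ^ (j - 1) * mdim (M r) ^ (s - j + 1)))"

definition KR_K ::
    "('i \<Rightarrow> 'i) \<Rightarrow> ('i \<Rightarrow> nat) \<Rightarrow> ('i \<Rightarrow> 'i umodule) \<Rightarrow> ('i \<Rightarrow> 'i \<Rightarrow> ratmat) \<Rightarrow> ('i \<Rightarrow> ratmat) \<Rightarrow>
     'i \<Rightarrow> nat \<Rightarrow> Cq \<Rightarrow> Cq mat" where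
  "KR_K star d M Rm Km r s x =
     fold (\<lambda>j T. K_stage star d M Rm Km r s x j * T) [1..<s+1] (1\<^sub>m (KR_dim M r s))"

definition KR_K_defined ::
    "('i \<Rightarrow> 'i) \<Rightarrow> ('i \<Rightarrow> nat) \<Rightarrow> ('i \<Rightarrow> 'i \<Rightarrow> ratmat) \<Rightarrow> ('i \<Rightarrow> ratmat) \<Rightarrow>
     'i \<Rightarrow> nat \<Rightarrow> Cq \<Rightarrow> bool" where
  "KR_K_defined star d Rm Km r s x \<longleftrightarrow>
     (\<forall>j\<in>{1..s}. Kdef Km r (KR_param d r s x j) \<and>
        (\<forall>i\<in>{1..<j}. Rdef Rm (star r) r (K_param d r s x j i) (KR_param d r s x j)))"

end

theory Submission
  imports Defs "HOL-Combinatorics.Permutations"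
begin

text \<open>Number the tensor factors of the source by positive integers and let \<open>-i\<close> stand for the factor
  \<open>i\<close> after a K-matrix has acted on it. Every map in the theorem is a product of two kinds of
  elementary operators on words in these labels: an R-matrix exchanges two adjacent letters \<open>u < v\<close>,
  and a K-matrix changes the sign of a positive first letter. A word thus records a signed permutation,
  an elementary operator is multiplication by a simple reflection that increases the length, and the
  Yang-Baxter equation, the reflection equation and the interchange law for operators on different
  tensor factors are the braid relations of the Coxeter group of type B. Hence, as in Matsumoto's
  theorem, the product along a reduced word depends only on the first and the last word
  (\<open>path_unique\<close>).

  It remains to recognise the maps as products along reduced words. The operator \<open>R\<^sub>s\<close>, whose image
  is the Kirillov-Reshetikhin module, reverses \<open>1, \<dots>, s\<close> (\<open>path_KR_R\<close>); the fused R-matrix exchanges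
  two blocks (\<open>path_fused_R\<close>); the fused K-matrix reverses a block and changes all its signs
  (\<open>path_KR_K\<close>). With both blocks in increasing order, \<open>1, \<dots>, s\<close> and \<open>s+1, \<dots>, s+s'\<close>, the two sides
  of the reflection equation, each preceded by \<open>R\<^sub>s \<otimes> R\<^sub>s\<^sub>'\<close>, are products along reduced words
  that end with \<open>-1, \<dots>, -s, -(s+1), \<dots>, -(s+s')\<close>, so they agree. Another reduced word with the same
  ends finishes with the operators \<open>R\<^sub>s \<otimes> R\<^sub>s\<^sub>'\<close> of the target modules, so the common value lies in
  the tensor product of these modules. The first part of the theorem is the same comparison for a
  single block. As the letters exchanged always satisfy \<open>u < v\<close>, all R-matrices on the way are
  evaluated at points where they are assumed to be defined (\<open>Rdef_labels\<close>).

  Two facts prepare this. The operator \<open>R\<^sub>w\<close> is given by any factorization of \<open>w\<close> with additive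
  lengths; additivity says that no two factors are exchanged twice (\<open>perm_length_comp\<close>), so such a
  factorization is again a reduced word, and \<open>path_unique\<close> shows that \<open>R\<^sub>w\<close> is well defined. And the
  spectral parameters of the modules of \<open>r\<close> and of its dual node are powers of the same \<open>q\<^sub>r\<close>,
  because \<open>-w\<^sub>0\<close> is an isometry that permutes the fundamental weights (\<open>dual_symmetrizer\<close>).\<close>

section \<open>Kronecker products in coordinates\<close>

lemma kron_carrier [simp]:
  "S \<in> carrier_mat m n \<Longrightarrow> T \<in> carrier_mat p k \<Longrightarrow> kron S T \<in> carrier_mat (m * p) (n * k)"
  by (auto simp: kron_def)

lemma dim_kron [simp]:
  "dim_row (kron S T) = dim_row S * dim_row T" "dim_col (kron S T) = dim_col S * dim_col T"
  by (auto simp: kron_def)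

lemma div_less_mult: "i < m * n \<Longrightarrow> i div n < m" for i m n :: nat
  by (simp add: less_mult_imp_div_less)

lemma mod_less_mult: "i < m * n \<Longrightarrow> i mod n < n" for i m n :: nat
  by (cases "n = 0") auto

lemma index_kron:
  "i < dim_row S * dim_row T \<Longrightarrow> j < dim_col S * dim_col T \<Longrightarrow>
   kron S T $$ (i, j) =
     S $$ (i div dim_row T, j div dim_col T) * T $$ (i mod dim_row T, j mod dim_col T)"
  by (simp add: kron_def)

text \<open>The row-by-column rule for Kronecker products is this change of summation index.\<close>

lemma sum_div_mod:
  fixes f :: "nat \<Rightarrow> nat \<Rightarrow> 'a::comm_monoid_add"
  shows "(\<Sum>l<n * k. f (l div k) (l mod k)) = (\<Sum>i<n. \<Sum>j<k. f i j)"
proof -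
  have "(\<Sum>l<n * k. f (l div k) (l mod k))
      = (\<Sum>i<n. \<Sum>l\<in>{i * k..<i * k + k}. f (l div k) (l mod k))"
    by (rule sum.nat_group [symmetric])
  also have "\<dots> = (\<Sum>i<n. \<Sum>j<k. f i j)"
  proof (rule sum.cong [OF refl])
    fix i
    have "(\<Sum>l\<in>{0 + i * k..<k + i * k}. f (l div k) (l mod k))
        = (\<Sum>j\<in>{0..<k}. f ((j + i * k) div k) ((j + i * k) mod k))"
      by (rule sum.shift_bounds_nat_ivl)
    then show "(\<Sum>l\<in>{i * k..<i * k + k}. f (l div k) (l mod k)) = (\<Sum>j<k. f i j)"
      by (simp add: add.commute atLeast0LessThan)
  qed
  finally show ?thesis .
qed

lemma kron_mult:
  fixes S :: "'a::comm_ring_1 mat"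
  assumes "S \<in> carrier_mat m n" "S' \<in> carrier_mat n k" "T \<in> carrier_mat p l" "T' \<in> carrier_mat l t"
  shows "kron S T * kron S' T' = kron (S * S') (T * T')"
proof (rule eq_matI)
  fix i j assume "i < dim_row (kron (S * S') (T * T'))" "j < dim_col (kron (S * S') (T * T'))"
  then have i: "i < m * p" and j: "j < k * t" using assms by auto
  note ij = div_less_mult [OF i] mod_less_mult [OF i] div_less_mult [OF j] mod_less_mult [OF j]
  have "(kron S T * kron S' T') $$ (i, j) =
      (\<Sum>h<n * l. kron S T $$ (i, h) * kron S' T' $$ (h, j))"
    using assms i j by (simp add: scalar_prod_def atLeast0LessThan)
  also have "\<dots> = (\<Sum>h<n * l. (S $$ (i div p, h div l) * T $$ (i mod p, h mod l))
                        * (S' $$ (h div l, j div t) * T' $$ (h mod l, j mod t)))"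
    using assms i j by (intro sum.cong) (auto simp: index_kron)
  also have "\<dots> = (\<Sum>a<n. \<Sum>b<l. (S $$ (i div p, a) * T $$ (i mod p, b))
                        * (S' $$ (a, j div t) * T' $$ (b, j mod t)))"
    by (rule sum_div_mod)
  also have "\<dots> = (\<Sum>a<n. S $$ (i div p, a) * S' $$ (a, j div t))
                  * (\<Sum>b<l. T $$ (i mod p, b) * T' $$ (b, j mod t))"
    by (simp add: sum_product mult.assoc mult.left_commute)
  also have "\<dots> = kron (S * S') (T * T') $$ (i, j)"
    using assms i j ij by (simp add: index_kron scalar_prod_def atLeast0LessThan)
  finally show "(kron S T * kron S' T') $$ (i, j) = kron (S * S') (T * T') $$ (i, j)" .
qed (use assms in auto)

lemma kron_one: "kron (1\<^sub>m m) (1\<^sub>m n) = (1\<^sub>m (m * n) :: 'a::comm_ring_1 mat)"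
proof (rule eq_matI)
  fix i j assume "i < dim_row (1\<^sub>m (m * n) :: 'a mat)" "j < dim_col (1\<^sub>m (m * n) :: 'a mat)"
  then have i: "i < m * n" and j: "j < m * n" by auto
  have "i = j \<longleftrightarrow> i div n = j div n \<and> i mod n = j mod n"
    by (metis div_mult_mod_eq)
  then show "kron (1\<^sub>m m) (1\<^sub>m n) $$ (i, j) = (1\<^sub>m (m * n) :: 'a mat) $$ (i, j)"
    using i j div_less_mult [OF i] mod_less_mult [OF i] div_less_mult [OF j] mod_less_mult [OF j]
    by (auto simp: index_kron)
qed auto

lemma div_mod_mult:
  "i mod (b * c) div c = i div c mod b" "i mod (b * c) mod c = i mod c" for i b c :: nat
  by (cases "c = 0"; simp add: mult.commute [of b c] mod_mult2_eq)+

lemma kron_assoc: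
  fixes S :: "'a::comm_ring_1 mat"
  shows "kron (kron S T) U = kron S (kron T U)"
proof (rule eq_matI)
  fix i j assume "i < dim_row (kron S (kron T U))" "j < dim_col (kron S (kron T U))"
  then have i: "i < dim_row S * dim_row T * dim_row U" and j: "j < dim_col S * dim_col T * dim_col U"
    by (auto simp: mult.assoc)
  have i': "i < dim_row S * (dim_row T * dim_row U)" and j': "j < dim_col S * (dim_col T * dim_col U)"
    using i j by (auto simp: mult.assoc)
  show "kron (kron S T) U $$ (i, j) = kron S (kron T U) $$ (i, j)"
    using i j i' j' div_less_mult [OF i] div_less_mult [OF j] mod_less_mult [OF i'] mod_less_mult [OF j']
    by (simp add: index_kron div_mod_mult mult.assoc div_mult2_eq [symmetric]
        mult.commute [of "dim_row U"] mult.commute [of "dim_col U"])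
qed (auto simp: mult.assoc)

lemma kron_one_left [simp]: "kron (1\<^sub>m (Suc 0)) S = (S :: 'a::comm_ring_1 mat)"
  by (rule eq_matI) (auto simp: index_kron)

lemma kron_one_right [simp]: "kron S (1\<^sub>m (Suc 0)) = (S :: 'a::comm_ring_1 mat)"
  by (rule eq_matI) (auto simp: index_kron)

text \<open>Interchange law: operators on different tensor factors commute. The operators may change dimensions,
  so the identity on the idle factor is not the same on the two sides.\<close>

lemma kron_commute:
  fixes S :: "'a::comm_ring_1 mat"
  assumes "S \<in> carrier_mat m n" "T \<in> carrier_mat p k"
  shows "kron S (1\<^sub>m p) * kron (1\<^sub>m n) T = kron (1\<^sub>m m) T * kron S (1\<^sub>m k)"
proof -
  have "kron S (1\<^sub>m p) * kron (1\<^sub>m n) T = kron S T"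
    using kron_mult [of S m n "1\<^sub>m n" n "1\<^sub>m p" p p T k] assms by simp
  also have "kron S T = kron (1\<^sub>m m) T * kron S (1\<^sub>m k)"
    using kron_mult [of "1\<^sub>m m" m m S n T p k "1\<^sub>m k" k] assms by simp
  finally show ?thesis .
qed

lemma at_pos_carrier [simp]:
  "T \<in> carrier_mat p k \<Longrightarrow> at_pos l T r \<in> carrier_mat (l * (p * r)) (l * (k * r))"
  by (simp add: at_pos_def)

lemma at_pos_mult:
  fixes S :: "'a::comm_ring_1 mat"
  assumes "S \<in> carrier_mat m n" "T \<in> carrier_mat n k"
  shows "at_pos l S r * at_pos l T r = at_pos l (S * T) r"
proof -
  have "kron S (1\<^sub>m r) * kron T (1\<^sub>m r) = kron (S * T) (1\<^sub>m r)"
    using kron_mult [of S m n T k "1\<^sub>m r" r r "1\<^sub>m r" r] assms by simp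
  then show ?thesis
    unfolding at_pos_def
    using kron_mult [of "1\<^sub>m l" l l "1\<^sub>m l" l "kron S (1\<^sub>m r)" "m * r" "n * r" "kron T (1\<^sub>m r)" "k * r"] assms
    by simp
qed

lemma at_pos_one: "at_pos l (1\<^sub>m m) r = (1\<^sub>m (l * (m * r)) :: 'a::comm_ring_1 mat)"
  by (simp add: at_pos_def kron_one)

lemma at_pos_at_pos:
  fixes T :: "'a::comm_ring_1 mat"
  shows "at_pos l (at_pos l' T r') r = at_pos (l * l') T (r' * r)"
proof -
  have "at_pos l (at_pos l' T r') r
      = kron (kron (1\<^sub>m l) (1\<^sub>m l')) (kron T (kron (1\<^sub>m r') (1\<^sub>m r)))"
    unfolding at_pos_def by (simp only: kron_assoc)
  then show ?thesis by (simp add: at_pos_def kron_one)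
qed

lemma at_pos_no_left: "at_pos (Suc 0) T r = kron (T :: 'a::comm_ring_1 mat) (1\<^sub>m r)"
  by (simp add: at_pos_def)

lemma at_pos_no_right: "at_pos l T (Suc 0) = kron (1\<^sub>m l) (T :: 'a::comm_ring_1 mat)"
  by (simp add: at_pos_def)

lemma index_kron_vec:
  "i < dim_vec u * dim_vec v \<Longrightarrow> kron_vec u v $ i = u $ (i div dim_vec v) * v $ (i mod dim_vec v)"
  by (simp add: kron_vec_def)

lemma dim_kron_vec [simp]: "dim_vec (kron_vec u v) = dim_vec u * dim_vec v"
  by (simp add: kron_vec_def)

lemma kron_mult_kron_vec:
  fixes S :: "'a::comm_ring_1 mat"
  assumes "S \<in> carrier_mat m n" "T \<in> carrier_mat p k" "u \<in> carrier_vec n" "v \<in> carrier_vec k"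
  shows "kron S T *\<^sub>v kron_vec u v = kron_vec (S *\<^sub>v u) (T *\<^sub>v v)"
proof (rule eq_vecI)
  fix i assume "i < dim_vec (kron_vec (S *\<^sub>v u) (T *\<^sub>v v))"
  then have i: "i < m * p" using assms by simp
  have "(kron S T *\<^sub>v kron_vec u v) $ i
      = (\<Sum>h<n * k. (S $$ (i div p, h div k) * T $$ (i mod p, h mod k)) * (u $ (h div k) * v $ (h mod k)))"
    using assms i by (auto simp: scalar_prod_def atLeast0LessThan index_kron index_kron_vec intro!: sum.cong)
  also have "\<dots> = (\<Sum>a<n. \<Sum>b<k. (S $$ (i div p, a) * T $$ (i mod p, b)) * (u $ a * v $ b))"
    by (rule sum_div_mod)
  also have "\<dots> = (\<Sum>a<n. S $$ (i div p, a) * u $ a) * (\<Sum>b<k. T $$ (i mod p, b) * v $ b)"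
    by (simp add: sum_product mult.assoc mult.left_commute)
  also have "\<dots> = kron_vec (S *\<^sub>v u) (T *\<^sub>v v) $ i"
    using assms i div_less_mult [OF i] mod_less_mult [OF i]
    by (simp add: index_kron_vec scalar_prod_def atLeast0LessThan)
  finally show "(kron S T *\<^sub>v kron_vec u v) $ i = kron_vec (S *\<^sub>v u) (T *\<^sub>v v) $ i" .
qed (use assms in auto)

lemma kron_vec_unit:
  assumes "i < m * n"
  shows "(unit_vec (m * n) i :: 'a::comm_ring_1 vec) = kron_vec (unit_vec m (i div n)) (unit_vec n (i mod n))"
proof (rule eq_vecI)
  fix j assume "j < dim_vec (kron_vec (unit_vec m (i div n)) (unit_vec n (i mod n)) :: 'a vec)"
  then have j: "j < m * n" by simp
  have "i = j \<longleftrightarrow> i div n = j div n \<and> i mod n = j mod n" by (metis div_mult_mod_eq)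
  then show "(unit_vec (m * n) i :: 'a vec) $ j = kron_vec (unit_vec m (i div n)) (unit_vec n (i mod n)) $ j"
    using assms j div_less_mult [OF j] mod_less_mult [OF j] div_less_mult [OF assms] mod_less_mult [OF assms]
    by (auto simp: index_kron_vec)
qed simp

lemma mult_mat_unit_vec:
  fixes S :: "'a::comm_ring_1 mat"
  assumes "S \<in> carrier_mat m n" "i < n"
  shows "S *\<^sub>v unit_vec n i = col S i"
  using assms by (intro eq_vecI) auto

text \<open>A linear image of a coordinate space is spanned by the columns of the matrix, and the columns of a
  Kronecker product are the Kronecker products of the columns.\<close>

lemma tensor_space_image:
  assumes S: "S \<in> carrier_mat m n" and T: "T \<in> carrier_mat p k"
  shows "tensor_space m p (image_space S) (image_space T) = image_space (kron S T)"
proof -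
  interpret V: vec_space "TYPE(Cq)" "m * p" .
  let ?G = "{kron_vec u v | u v. u \<in> image_space S \<and> v \<in> image_space T}"
  have ST: "kron S T \<in> carrier_mat (m * p) (n * k)" using S T by simp
  have image: "image_space (kron S T) = V.span (set (cols (kron S T)))"
    using V.col_space_eq [OF ST] mult_mat_vec_carrier [OF ST] carrier_matD [OF ST]
    unfolding V.col_space_def image_space_def by (auto simp del: dim_kron)
  have cols: "set (cols (kron S T)) \<subseteq> carrier_vec (m * p)"
    using cols_dim [of "kron S T"] unfolding carrier_matD(1) [OF ST] .
  have "?G \<subseteq> image_space (kron S T)"
  proof
    fix x assume "x \<in> ?G"
    then obtain u v where uv: "u \<in> carrier_vec n" "v \<in> carrier_vec k" "x = kron_vec (S *\<^sub>v u) (T *\<^sub>v v)"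
      using S T by (auto simp: image_space_def)
    then have "x = kron S T *\<^sub>v kron_vec u v" using kron_mult_kron_vec [OF S T] by simp
    moreover have "kron_vec u v \<in> carrier_vec (n * k)" using uv by (auto simp: kron_vec_def)
    ultimately show "x \<in> image_space (kron S T)" using S T by (auto simp: image_space_def)
  qed
  then have 1: "V.span ?G \<subseteq> image_space (kron S T)"
    unfolding image using cols by (intro V.span_is_subset V.span_is_submodule) auto
  have "col (kron S T) i \<in> ?G" if i: "i < n * k" for i
  proof -
    have "col (kron S T) i = kron_vec (S *\<^sub>v unit_vec n (i div k)) (T *\<^sub>v unit_vec k (i mod k))"
      unfolding mult_mat_unit_vec [OF ST i, symmetric] kron_vec_unit [OF i]
      by (rule kron_mult_kron_vec [OF S T]) auto
    moreover have "S *\<^sub>v unit_vec n (i div k) \<in> image_space S" "T *\<^sub>v unit_vec k (i mod k) \<in> image_space T"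
      using S T by (auto simp: image_space_def)
    ultimately show ?thesis by blast
  qed
  then have "set (cols (kron S T)) \<subseteq> ?G"
    using S T by (auto simp: cols_def)
  then have 2: "image_space (kron S T) \<subseteq> V.span ?G"
    unfolding image by (rule V.span_is_monotone)
  show ?thesis using 1 2 by (simp add: tensor_space_def)
qed

section \<open>Inversions of words in signed labels\<close>

fun precedence :: "'a list \<Rightarrow> ('a \<times> 'a) set" where
  "precedence [] = {}"
| "precedence (x # xs) = {x} \<times> set xs \<union> precedence xs"

lemma precedence_append [simp]: "precedence (xs @ ys) = precedence xs \<union> precedence ys \<union> set xs \<times> set ys"
  by (induction xs) auto

lemma precedence_subset: "precedence xs \<subseteq> set xs \<times> set xs"
  by (induction xs) auto

lemma precedence_mem: "(a, b) \<in> precedence xs \<Longrightarrow> a \<in> set xs \<and> b \<in> set xs"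
  using precedence_subset by fast

lemma precedence_antisym: "distinct xs \<Longrightarrow> (a, b) \<in> precedence xs \<Longrightarrow> (b, a) \<notin> precedence xs"
  by (induction xs) (auto dest: precedence_mem)

lemma precedence_trans: "distinct xs \<Longrightarrow> (a, b) \<in> precedence xs \<Longrightarrow> (b, c) \<in> precedence xs \<Longrightarrow> (a, c) \<in> precedence xs"
  by (induction xs) (auto dest: precedence_mem)

lemma precedence_map_rev: "(a, b) \<in> precedence (map f (rev xs)) \<longleftrightarrow> (\<exists>x y. (x, y) \<in> precedence xs \<and> a = f y \<and> b = f x)"
  by (induction xs) auto

text \<open>A signed permutation is a permutation of the nonzero integers from \<open>-n\<close> to \<open>n\<close> that commutes with
  negation. In the doubled word a change of sign of the first letter is the exchange of the two middle
  letters, so inversions of signed permutations become ordinary inversions.\<close>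

definition dbl :: "int list \<Rightarrow> int list" where
  "dbl L = map uminus (rev L) @ L"

lemma precedence_dbl: "(a, b) \<in> precedence (dbl L) \<longleftrightarrow>
    (- b, - a) \<in> precedence L \<or> (a, b) \<in> precedence L \<or> (- a \<in> set L \<and> b \<in> set L)"
proof -
  have "(a, b) \<in> precedence (map uminus (rev L)) \<longleftrightarrow> (- b, - a) \<in> precedence L"
    unfolding precedence_map_rev by (metis minus_equation_iff)
  moreover have "a \<in> uminus ` set L \<longleftrightarrow> - a \<in> set L"
    by force
  ultimately show ?thesis by (auto simp: dbl_def)
qed

lemma precedence_dbl_uminus: "(a, b) \<in> precedence (dbl L) \<Longrightarrow> (- b, - a) \<in> precedence (dbl L)"
  by (auto simp: precedence_dbl)

definition Inv :: "int list \<Rightarrow> (int \<times> int) set" where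
  "Inv L = {(a, b). b < a \<and> (a, b) \<in> precedence (dbl L)}"

lemma finite_Inv: "finite (Inv L)"
  by (rule finite_subset [of _ "set (dbl L) \<times> set (dbl L)"]) (auto simp: Inv_def dest: precedence_mem)

lemma distinct_dbl: "distinct (map abs L) \<Longrightarrow> 0 \<notin> set L \<Longrightarrow> distinct (dbl L)"
proof -
  assume d: "distinct (map abs L)" and z: "0 \<notin> set L"
  have "x \<noteq> - y" if "x \<in> set L" "y \<in> set L" for x y
    using that d z by (metis abs_minus_cancel distinct_map inj_onD neg_equal_zero)
  then show ?thesis
    using d by (auto simp: dbl_def distinct_map inj_on_def)
qed

text \<open>An exchange of two adjacent letters adds one pair to the precedence relation and hence two pairs,
  related by negation, to that of the doubled word.\<close>

lemma precedence_dbl_cover: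
  assumes "(a, b) \<in> precedence (dbl L)" "precedence L \<subseteq> insert (c, e) (precedence L1 \<union> precedence L2)"
    "set L = set L1"
  shows "(a, b) = (c, e) \<or> (a, b) = (- e, - c) \<or> (a, b) \<in> precedence (dbl L1) \<or> (a, b) \<in> precedence (dbl L2)"
proof -
  consider "(- b, - a) \<in> precedence L" | "(a, b) \<in> precedence L" | "- a \<in> set L" "b \<in> set L"
    using assms(1) unfolding precedence_dbl by blast
  then show ?thesis
  proof cases
    case 1
    then have "(- b, - a) = (c, e) \<or> (- b, - a) \<in> precedence L1 \<or> (- b, - a) \<in> precedence L2"
      using assms(2) by blast
    then show ?thesis unfolding precedence_dbl by auto
  next
    case 2
    then show ?thesis using assms(2) unfolding precedence_dbl by blast
  next
    case 3
    then show ?thesis using assms(3) unfolding precedence_dbl by blast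
  qed
qed

text \<open>The join of two overlapping exchanges in the weak order. The complete reversal of three letters has,
  up to negation, a single inversion that neither exchange provides on its own, namely \<open>(w, u)\<close>, and
  that one is forced by transitivity.\<close>

lemma Inv_braid:
  assumes d: "distinct (dbl L')" and "u < v" "v < w"
    and p: "Inv (A @ [v, u, w] @ B) \<subseteq> Inv L'" and q: "Inv (A @ [u, w, v] @ B) \<subseteq> Inv L'"
  shows "Inv (A @ [w, v, u] @ B) \<subseteq> Inv L'"
proof (intro subsetI, unfold split_paired_all)
  fix a b assume ab: "(a, b) \<in> Inv (A @ [w, v, u] @ B)"
  have "(v, u) \<in> Inv (A @ [v, u, w] @ B)" "(w, v) \<in> Inv (A @ [u, w, v] @ B)"
    using assms(2,3) by (simp_all add: Inv_def precedence_dbl)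
  then have "(v, u) \<in> Inv L'" "(w, v) \<in> Inv L'"
    using p q by blast+
  then have "(w, u) \<in> precedence (dbl L')"
    using precedence_trans [OF d] by (auto simp: Inv_def)
  then have wu: "(w, u) \<in> Inv L'" "(- u, - w) \<in> Inv L'"
    using precedence_dbl_uminus [of w u L'] assms(2,3) by (auto simp: Inv_def)
  have "precedence (A @ [w, v, u] @ B) \<subseteq> insert (w, u) (precedence (A @ [v, u, w] @ B) \<union> precedence (A @ [u, w, v] @ B))"
    by auto
  moreover have "(a, b) \<in> precedence (dbl (A @ [w, v, u] @ B))" "b < a"
    using ab by (simp_all add: Inv_def)
  ultimately have "(a, b) = (w, u) \<or> (a, b) = (- u, - w) \<or> (a, b) \<in> Inv (A @ [v, u, w] @ B)
      \<or> (a, b) \<in> Inv (A @ [u, w, v] @ B)"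
    using precedence_dbl_cover [of a b "A @ [w, v, u] @ B" w u "A @ [v, u, w] @ B" "A @ [u, w, v] @ B"]
    by (auto simp: Inv_def simp del: precedence_append)
  then show "(a, b) \<in> Inv L'"
    using wu p q by blast
qed

text \<open>The join of an exchange and a change of sign. That \<open>u\<close> precedes \<open>-u\<close> and \<open>v\<close> precedes \<open>u\<close> forces the
  order \<open>v, u, -u, -v\<close>.\<close>

lemma Inv_reflect:
  assumes d: "distinct (dbl L')" and "0 < u" "u < v"
    and p: "Inv ([- u, v] @ B) \<subseteq> Inv L'" and q: "Inv ([v, u] @ B) \<subseteq> Inv L'"
  shows "Inv ([- u, - v] @ B) \<subseteq> Inv L'"
proof (intro subsetI, unfold split_paired_all)
  fix a b assume ab: "(a, b) \<in> Inv ([- u, - v] @ B)"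
  have "(u, - u) \<in> Inv ([- u, v] @ B)" "(v, u) \<in> Inv ([v, u] @ B)"
    using assms(2,3) by (simp_all add: Inv_def precedence_dbl)
  then have "(u, - u) \<in> Inv L'" "(v, u) \<in> Inv L'"
    using p q by blast+
  then have 1: "(u, - u) \<in> precedence (dbl L')" "(v, u) \<in> precedence (dbl L')" "(- u, - v) \<in> precedence (dbl L')"
    using precedence_dbl_uminus [of v u L'] by (simp_all add: Inv_def)
  have 2: "(v, - u) \<in> precedence (dbl L')" "(u, - v) \<in> precedence (dbl L')" "(v, - v) \<in> precedence (dbl L')"
    using precedence_trans [OF d] 1 by blast+
  have I: "(x, y) \<in> precedence (dbl L')" if "(x, y) \<in> precedence ([- u, v] @ B) \<or> (- x \<in> set ([- u, v] @ B) \<and> y \<in> set ([- u, v] @ B))"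
      "y < x" for x y
    using that p unfolding Inv_def precedence_dbl by blast
  have J: "(x, y) \<in> precedence (dbl L')" if xy: "(x, y) \<in> precedence ([- u, - v] @ B)" "y < x" for x y
  proof -
    consider "x = - u" "y = - v" | "x = - u" "y \<in> set B" | "x = - v" "y \<in> set B" | "(x, y) \<in> precedence B"
      using xy(1) by auto
    then show ?thesis
    proof cases
      case 1
      then show ?thesis using \<open>(- u, - v) \<in> precedence (dbl L')\<close> by simp
    qed (use xy I in simp_all)
  qed
  have b: "b < a" using ab by (simp add: Inv_def)
  consider "(- b, - a) \<in> precedence ([- u, - v] @ B)" | "(a, b) \<in> precedence ([- u, - v] @ B)"
    | "- a \<in> set ([- u, - v] @ B)" "b \<in> set ([- u, - v] @ B)"
    using ab unfolding Inv_def precedence_dbl by blast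
  then have "(a, b) \<in> precedence (dbl L')"
  proof cases
    case 1
    then show ?thesis using J [of "- b" "- a"] b precedence_dbl_uminus [of "- b" "- a" L'] by simp
  next
    case 2
    then show ?thesis using J b by simp
  next
    case 3
    then consider "a \<in> {u, v}" "b \<in> {- u, - v}" | "a = u" "b \<in> set B" | "a = v" "b \<in> set B"
      | "- a \<in> set B" "b = - u" | "- a \<in> set B" "b = - v" | "- a \<in> set B" "b \<in> set B"
      by fastforce
    then show ?thesis
    proof cases
      case 1
      then show ?thesis using \<open>(u, - u) \<in> precedence (dbl L')\<close> 2 by auto
    next
      case 5
      then have "(v, - a) \<in> precedence (dbl L')" using I b by simp
      then show ?thesis using precedence_dbl_uminus [of v "- a" L'] 5 by simp
    qed (use b I in simp_all)
  qed
  then show "(a, b) \<in> Inv L'" using b by (simp add: Inv_def)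
qed

lemma precedence_swap: "precedence (A @ [v, u] @ D) \<subseteq> insert (v, u) (precedence (A @ [u, v] @ D))"
  by auto

lemma Inv_far:
  assumes p: "Inv (A @ [v, u] @ B @ [w, z] @ C) \<subseteq> X" and q: "Inv (A @ [u, v] @ B @ [z, w] @ C) \<subseteq> X"
  shows "Inv (A @ [v, u] @ B @ [z, w] @ C) \<subseteq> X"
proof (intro subsetI, unfold split_paired_all)
  let ?L1 = "A @ [v, u] @ B @ [w, z] @ C" and ?L2 = "A @ [u, v] @ B @ [z, w] @ C"
  fix a b assume ab: "(a, b) \<in> Inv (A @ [v, u] @ B @ [z, w] @ C)"
  have "precedence (A @ [v, u] @ B @ [z, w] @ C) \<subseteq> insert (v, u) (precedence ?L1 \<union> precedence ?L2)"
    using precedence_swap [of A v u "B @ [z, w] @ C"] by blast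
  moreover have "(v, u) \<in> precedence (dbl ?L1)" "(- u, - v) \<in> precedence (dbl ?L1)"
    by (simp_all add: precedence_dbl)
  ultimately have "(a, b) \<in> Inv ?L1 \<union> Inv ?L2"
    using ab precedence_dbl_cover [of a b "A @ [v, u] @ B @ [z, w] @ C" v u ?L1 ?L2]
    by (auto simp: Inv_def simp del: precedence_append)
  then show "(a, b) \<in> X" using p q by blast
qed

lemma Inv_far_neg:
  assumes p: "Inv ([- u] @ B @ [w, z] @ C) \<subseteq> X" and q: "Inv ([u] @ B @ [z, w] @ C) \<subseteq> X"
  shows "Inv ([- u] @ B @ [z, w] @ C) \<subseteq> X"
proof (intro subsetI, unfold split_paired_all)
  let ?L = "[- u] @ B @ [z, w] @ C"
  let ?L1 = "[- u] @ B @ [w, z] @ C" and ?L2 = "[u] @ B @ [z, w] @ C"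
  fix a b assume ab: "(a, b) \<in> Inv ?L"
  have "precedence ?L \<subseteq> insert (z, w) (precedence ?L1)" by auto
  moreover have "(z, w) \<in> precedence (dbl ?L2)" "(- w, - z) \<in> precedence (dbl ?L2)"
    by (simp_all add: precedence_dbl)
  ultimately have "(a, b) \<in> Inv ?L1 \<union> Inv ?L2"
    using ab precedence_dbl_cover [of a b ?L z w ?L1 ?L1]
    by (auto simp: Inv_def simp del: precedence_append)
  then show "(a, b) \<in> X" using p q by blast
qed

lemma Inv_swap_mono:
  assumes "u < v"
  shows "Inv (A @ [u, v] @ B) \<subseteq> Inv (A @ [v, u] @ B)"
proof (intro subsetI, unfold split_paired_all)
  fix a b assume "(a, b) \<in> Inv (A @ [u, v] @ B)"
  then have ab: "(a, b) \<in> precedence (dbl (A @ [u, v] @ B))" "b < a" by (simp_all add: Inv_def)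
  have "set (A @ [u, v] @ B) = set (A @ [v, u] @ B)" by auto
  then have "(a, b) = (u, v) \<or> (a, b) = (- v, - u) \<or> (a, b) \<in> precedence (dbl (A @ [v, u] @ B))"
    using precedence_dbl_cover [OF ab(1), of u v "A @ [v, u] @ B" "A @ [v, u] @ B"]
      precedence_swap [of A u v B] by blast
  then show "(a, b) \<in> Inv (A @ [v, u] @ B)"
    using ab(2) assms by (auto simp: Inv_def)
qed

lemma Inv_neg_mono:
  assumes "0 < u"
  shows "Inv ([u] @ B) \<subseteq> Inv ([- u] @ B)"
proof (intro subsetI, unfold split_paired_all)
  fix a b assume ab: "(a, b) \<in> Inv ([u] @ B)"
  have pos: "(x, y) \<in> precedence (dbl ([- u] @ B))" if "(x, y) \<in> precedence ([u] @ B)" for x y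
    using that by (auto simp: precedence_dbl)
  have b: "b < a" using ab by (simp add: Inv_def)
  consider "(- b, - a) \<in> precedence ([u] @ B)" | "(a, b) \<in> precedence ([u] @ B)"
    | "a = - u" "b = u" | "a = - u" "b \<in> set B" | "- a \<in> set B" "b = u" | "- a \<in> set B" "b \<in> set B"
    using ab unfolding Inv_def precedence_dbl by fastforce
  then have "(a, b) \<in> precedence (dbl ([- u] @ B))"
  proof cases
    case 1
    then show ?thesis using pos precedence_dbl_uminus by fastforce
  next
    case 3
    then show ?thesis using b assms by simp
  qed (use pos in \<open>simp_all add: precedence_dbl\<close>)
  then show "(a, b) \<in> Inv ([- u] @ B)" using b by (simp add: Inv_def)
qed

section \<open>Operators along reduced words\<close>

text \<open>The operators of a groupoid of type B: the letter \<open>u\<close> stands for a space of dimension \<open>dim u\<close>. The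
  relations are required for increasing letters only, as words are only ever made less sorted.\<close>

locale coloured_braid =
  fixes Lab :: "int set" and dim :: "int \<Rightarrow> nat"
    and R :: "int \<Rightarrow> int \<Rightarrow> 'a::comm_ring_1 mat" and K :: "int \<Rightarrow> 'a mat"
  assumes zero_Lab: "0 \<notin> Lab"
    and uminus_Lab: "u \<in> Lab \<Longrightarrow> - u \<in> Lab"
    and R_carrier: "u \<in> Lab \<Longrightarrow> v \<in> Lab \<Longrightarrow> R u v \<in> carrier_mat (dim v * dim u) (dim u * dim v)"
    and K_carrier: "u \<in> Lab \<Longrightarrow> 0 < u \<Longrightarrow> K u \<in> carrier_mat (dim (- u)) (dim u)"
    and yang_baxter:
      "\<lbrakk>u \<in> Lab; v \<in> Lab; w \<in> Lab; u < v; v < w; distinct [\<bar>u\<bar>, \<bar>v\<bar>, \<bar>w\<bar>]\<rbrakk> \<Longrightarrow>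
        kron (R v w) (1\<^sub>m (dim u)) * kron (1\<^sub>m (dim v)) (R u w) * kron (R u v) (1\<^sub>m (dim w))
      = kron (1\<^sub>m (dim w)) (R u v) * kron (R u w) (1\<^sub>m (dim v)) * kron (1\<^sub>m (dim u)) (R v w)"
    and reflection:
      "\<lbrakk>u \<in> Lab; v \<in> Lab; 0 < u; u < v\<rbrakk> \<Longrightarrow>
        R (- v) (- u) * kron (K v) (1\<^sub>m (dim (- u))) * R (- u) v * kron (K u) (1\<^sub>m (dim v))
      = kron (K u) (1\<^sub>m (dim (- v))) * R (- v) u * kron (K v) (1\<^sub>m (dim u)) * R u v"
begin

definition dimL :: "int list \<Rightarrow> nat" where
  "dimL L = prod_list (map dim L)"

lemma dimL_simps [simp]:
  "dimL [] = Suc 0" "dimL (u # L) = dim u * dimL L" "dimL (L @ L') = dimL L * dimL L'"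
  by (auto simp: dimL_def)

definition valid :: "int list \<Rightarrow> bool" where
  "valid L \<longleftrightarrow> set L \<subseteq> Lab \<and> distinct (map abs L)"

text \<open>Exactly the moves that increase the length, so a path is a reduced word. The flag says whether sign
  changes are allowed; without them a path can also be carried out in the middle of a longer word.\<close>

inductive step :: "bool \<Rightarrow> int list \<Rightarrow> int list \<Rightarrow> 'a mat \<Rightarrow> bool" for b where
  swap: "u < v \<Longrightarrow> step b (A @ [u, v] @ B) (A @ [v, u] @ B) (at_pos (dimL A) (R u v) (dimL B))"
| neg: "b \<Longrightarrow> 0 < u \<Longrightarrow> step b ([u] @ B) ([- u] @ B) (kron (K u) (1\<^sub>m (dimL B)))"

inductive path :: "bool \<Rightarrow> int list \<Rightarrow> int list \<Rightarrow> 'a mat \<Rightarrow> bool" for b where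
  refl: "path b L L (1\<^sub>m (dimL L))"
| cons: "step b L L1 S \<Longrightarrow> path b L1 L' T \<Longrightarrow> path b L L' (T * S)"

lemma valid_distinct_dbl: "valid L \<Longrightarrow> distinct (dbl L)"
  using zero_Lab by (intro distinct_dbl) (auto simp: valid_def)

lemma step_valid: "step b L L1 S \<Longrightarrow> valid L \<Longrightarrow> valid L1"
  by (induction rule: step.induct) (auto simp: valid_def uminus_Lab)

lemma step_carrier: "step b L L1 S \<Longrightarrow> valid L \<Longrightarrow> S \<in> carrier_mat (dimL L1) (dimL L)"
proof (induction rule: step.induct)
  case (swap u v A B)
  then have "R u v \<in> carrier_mat (dim v * dim u) (dim u * dim v)"
    by (auto simp: valid_def intro!: R_carrier)
  from at_pos_carrier [OF this, of "dimL A" "dimL B"] show ?case by (simp add: mult.assoc)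
next
  case (neg u B)
  then have "K u \<in> carrier_mat (dim (- u)) (dim u)"
    by (auto simp: valid_def intro!: K_carrier)
  then show ?case by simp
qed

lemma path_valid: "path b L L' T \<Longrightarrow> valid L \<Longrightarrow> valid L'"
  by (induction rule: path.induct) (auto dest: step_valid)

lemma path_carrier: "path b L L' T \<Longrightarrow> valid L \<Longrightarrow> T \<in> carrier_mat (dimL L') (dimL L)"
proof (induction rule: path.induct)
  case (cons L L1 S L' T)
  then show ?case using step_carrier step_valid by (meson mult_carrier_mat)
qed auto

lemma path_step: "step b L L1 S \<Longrightarrow> valid L \<Longrightarrow> path b L L1 S"
  using path.cons [OF _ path.refl] step_carrier by fastforce

lemma path_trans:
  "path b L L' T \<Longrightarrow> path b L' L'' T' \<Longrightarrow> valid L \<Longrightarrow> path b L L'' (T' * T)"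
proof (induction rule: path.induct)
  case (refl L)
  then show ?case using path_carrier by fastforce
next
  case (cons L L1 S L' T)
  then have v: "valid L1" by (blast intro: step_valid)
  have "T' * T * S = T' * (T * S)"
    using path_carrier [OF cons.prems(1) path_valid [OF cons.hyps(2) v]]
      path_carrier [OF cons.hyps(2) v] step_carrier [OF cons.hyps(1) cons.prems(2)]
    by (rule assoc_mult_mat)
  then show ?case
    using path.cons [OF cons.hyps(1) cons.IH [OF cons.prems(1) v]] by simp
qed

lemma path_swap_imp: "path False L L' T \<Longrightarrow> path b L L' T"
proof (induction rule: path.induct)
  case (cons L L1 S L' T)
  then show ?case by (auto intro!: path.cons elim!: step.cases intro: step.swap)
qed (rule path.refl)

text \<open>Moves add inversions. This makes paths finite and orders words by the weak order.\<close>

lemma step_Inv: "step b L L1 S \<Longrightarrow> valid L \<Longrightarrow> Inv L \<subset> Inv L1"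
proof -
  assume s: "step b L L1 S" and v: "valid L"
  have d: "distinct (dbl L)" using v by (rule valid_distinct_dbl)
  from s show ?thesis
  proof cases
    case (swap u v A B)
    have "(u, v) \<in> precedence (dbl L)" by (simp add: swap precedence_dbl)
    then have "(v, u) \<notin> Inv L" using precedence_antisym [OF d] by (auto simp: Inv_def)
    moreover have "(v, u) \<in> Inv L1" using swap by (simp add: Inv_def precedence_dbl)
    moreover have "Inv L \<subseteq> Inv L1" using swap Inv_swap_mono by simp
    ultimately show ?thesis by blast
  next
    case (neg u B)
    have "(- u, u) \<in> precedence (dbl L)" by (simp add: neg precedence_dbl)
    then have "(u, - u) \<notin> Inv L" using precedence_antisym [OF d] by (auto simp: Inv_def)
    moreover have "(u, - u) \<in> Inv L1" using neg by (simp add: Inv_def precedence_dbl)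
    moreover have "Inv L \<subseteq> Inv L1" using neg Inv_neg_mono by simp
    ultimately show ?thesis by blast
  qed
qed

lemma path_Inv: "path b L L' T \<Longrightarrow> valid L \<Longrightarrow> Inv L \<subseteq> Inv L'"
  by (induction rule: path.induct) (use step_Inv step_valid in blast)+

lemma path_loop:
  assumes "path b L L' T" "valid L" "Inv L' \<subseteq> Inv L"
  shows "L' = L \<and> T = 1\<^sub>m (dimL L)"
  using assms(1)
proof cases
  case (cons L1 S T')
  then show ?thesis using assms step_Inv path_Inv step_valid by blast
qed auto

lemma path_context:
  "path False L L' T \<Longrightarrow> valid L \<Longrightarrow>
    path False (C @ L @ D) (C @ L' @ D) (at_pos (dimL C) T (dimL D))"
proof (induction rule: path.induct)
  case (refl L)
  show ?case using path.refl [of False "C @ L @ D"] by (simp add: at_pos_one)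
next
  case (cons L L1 S L' T)
  then have v: "valid L1" by (blast intro: step_valid)
  have "step False (C @ L @ D) (C @ L1 @ D) (at_pos (dimL C) S (dimL D))"
    using cons(1)
  proof cases
    case (swap u v A B)
    then show ?thesis
      using step.swap [of u v False "C @ A" "B @ D"] by (simp add: at_pos_at_pos)
  qed simp
  moreover have "at_pos (dimL C) (T * S) (dimL D) = at_pos (dimL C) T (dimL D) * at_pos (dimL C) S (dimL D)"
    using cons v path_carrier step_carrier by (intro at_pos_mult [symmetric])
  ultimately show ?case using cons v path.cons by metis
qed

lemma path_append_right:
  "path b L L' T \<Longrightarrow> valid L \<Longrightarrow> path b (L @ D) (L' @ D) (kron T (1\<^sub>m (dimL D)))"
proof (induction rule: path.induct)
  case (refl L)
  show ?case using path.refl [of b "L @ D"] by (simp add: kron_one)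
next
  case (cons L L1 S L' T)
  then have v: "valid L1" by (blast intro: step_valid)
  have "step b (L @ D) (L1 @ D) (kron S (1\<^sub>m (dimL D)))"
    using cons(1)
  proof cases
    case (swap u v A B)
    then show ?thesis
      using step.swap [of u v b A "B @ D"] at_pos_at_pos [of 1 "dimL A" "R u v" "dimL B" "dimL D"]
      by (simp add: at_pos_no_left)
  next
    case (neg u B)
    then show ?thesis
      using step.neg [of b u "B @ D"] by (simp add: kron_assoc kron_one)
  qed
  moreover have "kron (T * S) (1\<^sub>m (dimL D)) = kron T (1\<^sub>m (dimL D)) * kron S (1\<^sub>m (dimL D))"
    using cons v at_pos_mult [OF path_carrier step_carrier, of b L1 L' T b L S 1 "dimL D"]
    by (simp add: at_pos_no_left)
  ultimately show ?case using cons v path.cons by metis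
qed

lemma path_append_left:
  "path False L L' T \<Longrightarrow> valid L \<Longrightarrow> path False (C @ L) (C @ L') (kron (1\<^sub>m (dimL C)) T)"
  using path_context [of L L' T C "[]"] by (simp add: at_pos_no_right)

text \<open>Two steps, to \<open>Lp\<close> by \<open>Sp\<close> and to \<open>Lq\<close> by \<open>Sq\<close>, can be continued to a common word, which is below
  \<open>L'\<close> in the weak order, in such a way that the operators agree.\<close>

definition joinable :: "bool \<Rightarrow> int list \<Rightarrow> int list \<Rightarrow> 'a mat \<Rightarrow> int list \<Rightarrow> 'a mat \<Rightarrow> bool" where
  "joinable b L' Lp Sp Lq Sq \<longleftrightarrow>
     (\<exists>Lz Tp Tq. path b Lp Lz Tp \<and> path b Lq Lz Tq \<and> Tp * Sp = Tq * Sq \<and> Inv Lz \<subseteq> Inv L')"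

lemma joinable_sym: "joinable b L' Lp Sp Lq Sq \<Longrightarrow> joinable b L' Lq Sq Lp Sp"
  unfolding joinable_def by metis

lemma joinable_same: "Inv L1 \<subseteq> Inv L' \<Longrightarrow> joinable b L' L1 S L1 S"
  unfolding joinable_def using path.refl by blast

text \<open>Exchanges at disjoint places: the interchange law.\<close>

lemma joinable_far:
  assumes v: "valid (A @ [u, v] @ B @ [w, z] @ C)" and "u < v" "w < z"
    and I: "Inv (A @ [v, u] @ B @ [w, z] @ C) \<subseteq> Inv L'" "Inv (A @ [u, v] @ B @ [z, w] @ C) \<subseteq> Inv L'"
  shows "joinable b L' (A @ [v, u] @ B @ [w, z] @ C) (at_pos (dimL A) (R u v) (dimL (B @ [w, z] @ C)))
           (A @ [u, v] @ B @ [z, w] @ C) (at_pos (dimL (A @ [u, v] @ B)) (R w z) (dimL C))"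
proof -
  \<comment> \<open>Cut after \<open>u, v\<close>: \<open>R u v\<close> acts on the left part and \<open>?Q\<close> on the right one.\<close>
  let ?Q = "at_pos (dimL B) (R w z) (dimL C)"
  let ?Tp = "at_pos (dimL (A @ [v, u] @ B)) (R w z) (dimL C)"
  let ?Tq = "at_pos (dimL A) (R u v) (dimL (B @ [z, w] @ C))"
  have Lab: "u \<in> Lab" "v \<in> Lab" "w \<in> Lab" "z \<in> Lab" using v by (auto simp: valid_def)
  have p: "path b (A @ [v, u] @ B @ [w, z] @ C) (A @ [v, u] @ B @ [z, w] @ C) ?Tp"
    using step.swap [of w z b "A @ [v, u] @ B" C] v assms(3)
    by (intro path_step) (auto simp: valid_def)
  have q: "path b (A @ [u, v] @ B @ [z, w] @ C) (A @ [v, u] @ B @ [z, w] @ C) ?Tq"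
    using step.swap [of u v b A "B @ [z, w] @ C"] v assms(2)
    by (intro path_step) (auto simp: valid_def)
  have Ruv: "R u v \<in> carrier_mat (dim v * dim u) (dim u * dim v)"
    using Lab by (intro R_carrier)
  have Q: "?Q \<in> carrier_mat (dimL (B @ [z, w] @ C)) (dimL (B @ [w, z] @ C))"
    using at_pos_carrier [OF R_carrier [OF Lab(3,4)], of "dimL B" "dimL C"] by (simp add: mult.assoc)
  have e1: "at_pos (dimL (A @ [x, y] @ B)) (R w z) (dimL C)
      = at_pos (dimL A) (kron (1\<^sub>m (dim x * dim y)) ?Q) (Suc 0)" for x y
    using at_pos_at_pos [of "dimL A" "dim x * dim y" ?Q 1 1]
      at_pos_at_pos [of "dimL A * (dim x * dim y)" "dimL B" "R w z" "dimL C" 1]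
    by (simp add: at_pos_no_right mult.assoc)
  have e2: "at_pos (dimL A) (R u v) n = at_pos (dimL A) (kron (R u v) (1\<^sub>m n)) (Suc 0)" for n
    by (simp add: at_pos_def)
  have "?Tp * at_pos (dimL A) (R u v) (dimL (B @ [w, z] @ C))
     = at_pos (dimL A) (kron (1\<^sub>m (dim v * dim u)) ?Q * kron (R u v) (1\<^sub>m (dimL (B @ [w, z] @ C)))) (Suc 0)"
    unfolding e1 e2 [of "dimL (B @ [w, z] @ C)"]
    by (rule at_pos_mult [OF kron_carrier [OF one_carrier_mat Q] kron_carrier [OF Ruv one_carrier_mat]])
  also have "\<dots> = at_pos (dimL A) (kron (R u v) (1\<^sub>m (dimL (B @ [z, w] @ C))) * kron (1\<^sub>m (dim u * dim v)) ?Q) (Suc 0)"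
    using kron_commute [OF Ruv Q] by simp
  also have "\<dots> = ?Tq * at_pos (dimL (A @ [u, v] @ B)) (R w z) (dimL C)"
    unfolding e1 e2 [of "dimL (B @ [z, w] @ C)"]
    by (rule at_pos_mult [OF kron_carrier [OF Ruv one_carrier_mat] kron_carrier [OF one_carrier_mat Q], symmetric])
  finally show ?thesis
    unfolding joinable_def using p q Inv_far [OF I] by blast
qed

lemma joinable_far_neg:
  assumes v: "valid ([u] @ B @ [w, z] @ C)" and "0 < u" "w < z" b
    and I: "Inv ([- u] @ B @ [w, z] @ C) \<subseteq> Inv L'" "Inv ([u] @ B @ [z, w] @ C) \<subseteq> Inv L'"
  shows "joinable b L' ([- u] @ B @ [w, z] @ C) (kron (K u) (1\<^sub>m (dimL (B @ [w, z] @ C))))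
           ([u] @ B @ [z, w] @ C) (at_pos (dimL ([u] @ B)) (R w z) (dimL C))"
proof -
  let ?Q = "at_pos (dimL B) (R w z) (dimL C)"
  let ?Tp = "at_pos (dimL ([- u] @ B)) (R w z) (dimL C)"
  let ?Tq = "kron (K u) (1\<^sub>m (dimL (B @ [z, w] @ C)))"
  have Lab: "u \<in> Lab" "w \<in> Lab" "z \<in> Lab" using v by (auto simp: valid_def)
  have p: "path b ([- u] @ B @ [w, z] @ C) ([- u] @ B @ [z, w] @ C) ?Tp"
    using step.swap [of w z b "[- u] @ B" C] v assms(3) uminus_Lab
    by (intro path_step) (auto simp: valid_def)
  have q: "path b ([u] @ B @ [z, w] @ C) ([- u] @ B @ [z, w] @ C) ?Tq"
    using step.neg [of b u "B @ [z, w] @ C"] v assms(2,4)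
    by (intro path_step) (auto simp: valid_def)
  have Q: "?Q \<in> carrier_mat (dimL (B @ [z, w] @ C)) (dimL (B @ [w, z] @ C))"
    using at_pos_carrier [OF R_carrier [OF Lab(2,3)], of "dimL B" "dimL C"] by (simp add: mult.assoc)
  have e1: "at_pos (dimL ([x] @ B)) (R w z) (dimL C) = kron (1\<^sub>m (dim x)) ?Q" for x
    using at_pos_at_pos [of "dim x" "dimL B" "R w z" "dimL C" 1]
    by (simp add: at_pos_no_right mult.assoc)
  have "?Tp * kron (K u) (1\<^sub>m (dimL (B @ [w, z] @ C)))
     = ?Tq * at_pos (dimL ([u] @ B)) (R w z) (dimL C)"
    unfolding e1 using kron_commute [OF K_carrier Q, of u] Lab assms(2) by simp
  then show ?thesis
    unfolding joinable_def using p q Inv_far_neg [OF I] by blast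
qed

text \<open>Overlapping exchanges: the Yang-Baxter equation.\<close>

lemma joinable_braid:
  assumes v: "valid (A @ [u, v, w] @ B)" and lt: "u < v" "v < w"
    and v': "valid L'" and I: "Inv (A @ [v, u, w] @ B) \<subseteq> Inv L'" "Inv (A @ [u, w, v] @ B) \<subseteq> Inv L'"
  shows "joinable b L' (A @ [v, u, w] @ B) (at_pos (dimL A) (R u v) (dimL ([w] @ B)))
           (A @ [u, w, v] @ B) (at_pos (dimL (A @ [u])) (R v w) (dimL B))"
proof -
  have Lab: "u \<in> Lab" "v \<in> Lab" "w \<in> Lab" and d: "distinct [\<bar>u\<bar>, \<bar>v\<bar>, \<bar>w\<bar>]"
    using v by (auto simp: valid_def)
  have val: "valid [v, u, w]" "valid [v, w, u]" "valid [u, w, v]" "valid [w, u, v]"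
    using Lab d by (auto simp: valid_def)
  let ?Tp = "kron (R v w) (1\<^sub>m (dim u)) * kron (1\<^sub>m (dim v)) (R u w)"
  let ?Tq = "kron (1\<^sub>m (dim w)) (R u v) * kron (R u w) (1\<^sub>m (dim v))"
  have 1: "path False [v, u, w] [v, w, u] (kron (1\<^sub>m (dim v)) (R u w))"
    using step.swap [of u w False "[v]" "[]"] lt val by (intro path_step) (auto simp: at_pos_no_right)
  have 2: "path False [v, w, u] [w, v, u] (kron (R v w) (1\<^sub>m (dim u)))"
    using step.swap [of v w False "[]" "[u]"] lt val by (intro path_step) (auto simp: at_pos_no_left)
  have 3: "path False [u, w, v] [w, u, v] (kron (R u w) (1\<^sub>m (dim v)))"
    using step.swap [of u w False "[]" "[v]"] lt val by (intro path_step) (auto simp: at_pos_no_left)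
  have 4: "path False [w, u, v] [w, v, u] (kron (1\<^sub>m (dim w)) (R u v))"
    using step.swap [of u v False "[w]" "[]"] lt val by (intro path_step) (auto simp: at_pos_no_right)
  have p: "path False [v, u, w] [w, v, u] ?Tp" using path_trans [OF 1 2] val by simp
  have q: "path False [u, w, v] [w, v, u] ?Tq" using path_trans [OF 3 4] val by simp
  note c = path_carrier [OF p val(1)] path_carrier [OF q val(3)]
  have Ruv: "kron (R u v) (1\<^sub>m (dim w)) \<in> carrier_mat (dimL [v, u, w]) (dimL [u, v, w])"
    using kron_carrier [OF R_carrier [OF Lab(1,2)] one_carrier_mat] by (simp add: mult.assoc)
  have Rvw: "kron (1\<^sub>m (dim u)) (R v w) \<in> carrier_mat (dimL [u, w, v]) (dimL [u, v, w])"
    using kron_carrier [OF one_carrier_mat R_carrier [OF Lab(2,3)]] by (simp add: mult.assoc)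
  \<comment> \<open>Both steps happen inside the three letters, where the Yang-Baxter equation applies.\<close>
  have e1: "at_pos (dimL A) (R u v) (dimL ([w] @ B)) = at_pos (dimL A) (kron (R u v) (1\<^sub>m (dim w))) (dimL B)"
    using at_pos_at_pos [of "dimL A" 1 "R u v" "dim w" "dimL B"] by (simp add: at_pos_no_left)
  have e2: "at_pos (dimL (A @ [u])) (R v w) (dimL B) = at_pos (dimL A) (kron (1\<^sub>m (dim u)) (R v w)) (dimL B)"
    using at_pos_at_pos [of "dimL A" "dim u" "R v w" 1 "dimL B"] by (simp add: at_pos_no_right)
  have "at_pos (dimL A) ?Tp (dimL B) * at_pos (dimL A) (R u v) (dimL ([w] @ B))
      = at_pos (dimL A) (?Tp * kron (R u v) (1\<^sub>m (dim w))) (dimL B)"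
    unfolding e1 by (rule at_pos_mult [OF c(1) Ruv])
  also have "?Tp * kron (R u v) (1\<^sub>m (dim w)) = ?Tq * kron (1\<^sub>m (dim u)) (R v w)"
    using yang_baxter [OF Lab lt d] .
  also have "at_pos (dimL A) (?Tq * kron (1\<^sub>m (dim u)) (R v w)) (dimL B)
      = at_pos (dimL A) ?Tq (dimL B) * at_pos (dimL (A @ [u])) (R v w) (dimL B)"
    unfolding e2 by (rule at_pos_mult [OF c(2) Rvw, symmetric])
  finally show ?thesis
    unfolding joinable_def
    using path_swap_imp [OF path_context [OF p val(1), of A B], of b]
      path_swap_imp [OF path_context [OF q val(3), of A B], of b]
      Inv_braid [OF valid_distinct_dbl [OF v'] lt I] by blast
qed

text \<open>A change of sign and an exchange at the front: the reflection equation.\<close>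

lemma joinable_reflect:
  assumes v: "valid ([u, v] @ B)" and lt: "0 < u" "u < v" and b
    and v': "valid L'" and I: "Inv ([- u, v] @ B) \<subseteq> Inv L'" "Inv ([v, u] @ B) \<subseteq> Inv L'"
  shows "joinable b L' ([- u, v] @ B) (kron (K u) (1\<^sub>m (dimL ([v] @ B))))
           ([v, u] @ B) (at_pos (dimL []) (R u v) (dimL B))"
proof -
  have Lab: "u \<in> Lab" "v \<in> Lab" "- u \<in> Lab" "- v \<in> Lab" and d: "\<bar>u\<bar> \<noteq> \<bar>v\<bar>"
    using v uminus_Lab by (auto simp: valid_def)
  have val: "valid [- u, v]" "valid [v, - u]" "valid [- v, - u]" "valid [v, u]" "valid [- v, u]"
      "valid [u, - v]"
    using Lab d by (auto simp: valid_def)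
  let ?Tp = "R (- v) (- u) * (kron (K v) (1\<^sub>m (dim (- u))) * R (- u) v)"
  let ?Tq = "kron (K u) (1\<^sub>m (dim (- v))) * (R (- v) u * kron (K v) (1\<^sub>m (dim u)))"
  have 1: "path True [- u, v] [v, - u] (R (- u) v)"
    using step.swap [of "- u" v True "[]" "[]"] lt val by (intro path_step) (auto simp: at_pos_no_right)
  have 2: "path True [v, - u] [- v, - u] (kron (K v) (1\<^sub>m (dim (- u))))"
    using step.neg [of True v "[- u]"] lt val by (intro path_step) auto
  have 3: "path True [- v, - u] [- u, - v] (R (- v) (- u))"
    using step.swap [of "- v" "- u" True "[]" "[]"] lt val by (intro path_step) (auto simp: at_pos_no_right)
  have 4: "path True [v, u] [- v, u] (kron (K v) (1\<^sub>m (dim u)))"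
    using step.neg [of True v "[u]"] lt val by (intro path_step) auto
  have 5: "path True [- v, u] [u, - v] (R (- v) u)"
    using step.swap [of "- v" u True "[]" "[]"] lt val by (intro path_step) (auto simp: at_pos_no_right)
  have 6: "path True [u, - v] [- u, - v] (kron (K u) (1\<^sub>m (dim (- v))))"
    using step.neg [of True u "[- v]"] lt val by (intro path_step) auto
  have p: "path True [- u, v] [- u, - v] ?Tp" using path_trans [OF path_trans [OF 1 2] 3] val by simp
  have q: "path True [v, u] [- u, - v] ?Tq" using path_trans [OF path_trans [OF 4 5] 6] val by simp
  note c = path_carrier [OF p val(1)] path_carrier [OF q val(4)]
  have Ku: "kron (K u) (1\<^sub>m (dim v)) \<in> carrier_mat (dimL [- u, v]) (dimL [u, v])"
    using kron_carrier [OF K_carrier [OF Lab(1)] one_carrier_mat] lt by simp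
  have Ruv: "R u v \<in> carrier_mat (dimL [v, u]) (dimL [u, v])"
    using R_carrier [OF Lab(1,2)] by simp
  have eq: "?Tp * kron (K u) (1\<^sub>m (dim v)) = ?Tq * R u v"
    using reflection [OF Lab(1,2) lt] Ku Ruv path_carrier [OF 1] path_carrier [OF 2] path_carrier [OF 3]
      path_carrier [OF 4] path_carrier [OF 5] path_carrier [OF 6] val
    by (simp add: assoc_mult_mat)
  have e: "kron (K u) (1\<^sub>m (dimL ([v] @ B))) = kron (kron (K u) (1\<^sub>m (dim v))) (1\<^sub>m (dimL B))"
    by (simp add: kron_assoc kron_one)
  have at: "at_pos (dimL []) (R u v) (dimL B) = kron (R u v) (1\<^sub>m (dimL B))"
    by (simp add: at_pos_no_left)
  have k: "kron (X * Y) (1\<^sub>m n) = kron X (1\<^sub>m n) * kron Y (1\<^sub>m n)"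
    if "X \<in> carrier_mat m k" "Y \<in> carrier_mat k l" for X Y :: "'a mat" and m k l n
    using at_pos_mult [OF that, of "Suc 0" n] by (simp add: at_pos_no_left)
  have "kron ?Tp (1\<^sub>m (dimL B)) * kron (K u) (1\<^sub>m (dimL ([v] @ B)))
      = kron ?Tq (1\<^sub>m (dimL B)) * at_pos (dimL []) (R u v) (dimL B)"
    unfolding e at k [OF c(1) Ku, symmetric] k [OF c(2) Ruv, symmetric] eq ..
  then show ?thesis
    unfolding joinable_def
    using path_append_right [OF p val(1), of B] path_append_right [OF q val(4), of B] \<open>b\<close>
      Inv_reflect [OF valid_distinct_dbl [OF v'] lt I] by (metis (full_types))
qed

lemma joinable_swaps:
  assumes v: "valid (A @ [u, v] @ B)" and lt: "u < v" "u' < v'"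
    and eq: "A @ [u, v] @ B = A' @ [u', v'] @ B'" and le: "length A \<le> length A'"
    and L': "valid L'" "Inv (A @ [v, u] @ B) \<subseteq> Inv L'" "Inv (A' @ [v', u'] @ B') \<subseteq> Inv L'"
  shows "joinable b L' (A @ [v, u] @ B) (at_pos (dimL A) (R u v) (dimL B))
           (A' @ [v', u'] @ B') (at_pos (dimL A') (R u' v') (dimL B'))"
proof -
  obtain D where D: "A' = A @ D" "[u, v] @ B = D @ [u', v'] @ B'"
    using eq le by (auto simp: append_eq_append_conv2 [of A])
  consider "D = []" | "D = [u]" | E where "D = [u, v] @ E"
    using D(2) by (cases D; cases "tl D") auto
  then show ?thesis
  proof cases
    case 1
    then show ?thesis using D L' by (auto intro: joinable_same)
  next
    case 2
    then have B: "B = [v'] @ B'" "u' = v" using D(2) by auto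
    show ?thesis
      using joinable_braid [of A u v v' B' L' b] v lt L' unfolding D 2 B by simp
  next
    case 3
    then have B: "B = E @ [u', v'] @ B'" using D(2) by auto
    show ?thesis
      using joinable_far [of A u v E u' v' B' L' b] v lt L' unfolding D 3 B by simp
  qed
qed

lemma joinable_neg_swap:
  assumes v: "valid ([x] @ B)" and lt: "0 < x" "u < v" and b
    and eq: "[x] @ B = A @ [u, v] @ C"
    and L': "valid L'" "Inv ([- x] @ B) \<subseteq> Inv L'" "Inv (A @ [v, u] @ C) \<subseteq> Inv L'"
  shows "joinable b L' ([- x] @ B) (kron (K x) (1\<^sub>m (dimL B)))
           (A @ [v, u] @ C) (at_pos (dimL A) (R u v) (dimL C))"
proof (cases A)
  case Nil
  then have "x = u" "B = [v] @ C" using eq by auto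
  then show ?thesis
    using joinable_reflect [of u v C b L'] assms unfolding Nil by simp
next
  case (Cons y E)
  then have "y = x" "B = E @ [u, v] @ C" using eq by auto
  then show ?thesis
    using joinable_far_neg [of x E u v C b L'] assms unfolding Cons by simp
qed

text \<open>Two simple reflections generate a parabolic subgroup of rank at most two, and the two steps meet in
  its longest element.\<close>

lemma joinable_steps:
  assumes p: "step b L Lp Sp" and q: "step b L Lq Sq" and v: "valid L" "valid L'"
    and I: "Inv Lp \<subseteq> Inv L'" "Inv Lq \<subseteq> Inv L'"
  shows "joinable b L' Lp Sp Lq Sq"
  using p
proof cases
  case P: (swap u v A B)
  from q show ?thesis
  proof cases
    case Q: (swap u' v' A' B')
    have "length A \<le> length A' \<or> length A' \<le> length A" by linarith
    then show ?thesis
      using joinable_swaps [of A u v B u' v' A' B' L' b] joinable_swaps [of A' u' v' B' u v A B L' b]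
        joinable_sym P Q v I by metis
  next
    case Q: (neg x B')
    then show ?thesis
      using joinable_neg_swap [of x B' u v b A B L'] joinable_sym P v I by metis
  qed
next
  case P: (neg x B)
  from q show ?thesis
  proof cases
    case Q: (swap u' v' A' B')
    then show ?thesis
      using joinable_neg_swap [of x B u' v' b A' B' L'] P v I by metis
  next
    case Q: (neg x B')
    then show ?thesis using P I by (auto intro: joinable_same)
  qed
qed

text \<open>The statement strengthens uniqueness so that induction applies: every path to \<open>L'\<close> may be rerouted
  through each word \<open>Lz\<close> that is reachable from \<open>L\<close> and below \<open>L'\<close> in the weak order. Induct on the number of
  inversions that \<open>L\<close> lacks; the first steps of the two given paths are joined, and the induction
  hypothesis is used twice, to reroute the first path through the join and then through \<open>Lz\<close>.\<close>

theorem path_factor: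
  assumes "path b L L' T" "path b L Lz Tz" "valid L" "Inv Lz \<subseteq> Inv L'"
  shows "\<exists>T'. path b Lz L' T' \<and> T = T' * Tz"
  using assms
proof (induction "card (Inv L' - Inv L)" arbitrary: L T Lz Tz rule: less_induct)
  case less
  have valL': "valid L'" using less.prems path_valid by blast
  show ?case
    using less.prems(2)
  proof cases
    case refl
    then show ?thesis using less.prems path_carrier by fastforce
  next
    case Z: (cons Lp Sp Tz')
    have valp: "valid Lp" using Z less.prems step_valid by blast
    have Ip: "Inv Lp \<subseteq> Inv L'" using path_Inv [OF Z(3) valp] less.prems by blast
    show ?thesis
      using less.prems(1)
    proof cases
      case refl
      then show ?thesis
        using step_Inv [OF Z(2)] Ip less.prems by blast
    next
      case Q: (cons Lq Sq T1)
      have valq: "valid Lq" using Q less.prems step_valid by blast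
      have Iq: "Inv Lq \<subseteq> Inv L'" using path_Inv [OF Q(3) valq] .
      have smaller: "card (Inv L' - Inv L1) < card (Inv L' - Inv L)" if "step b L L1 S" "Inv L1 \<subseteq> Inv L'" for L1 S
        using step_Inv [OF that(1) less.prems(3)] that(2) finite_Inv by (intro psubset_card_mono) auto
      obtain Lw Tp Tq where w: "path b Lp Lw Tp" "path b Lq Lw Tq" "Tp * Sp = Tq * Sq" "Inv Lw \<subseteq> Inv L'"
        using joinable_steps [OF Z(2) Q(2) less.prems(3) valL' Ip Iq] unfolding joinable_def by blast
      \<comment> \<open>Reroute the given path to \<open>L'\<close> through the join \<open>Lw\<close>; it then passes through \<open>Lp\<close> as well.\<close>
      obtain T2 where T2: "path b Lw L' T2" "T1 = T2 * Tq"
        using less.hyps [OF smaller [OF Q(2) Iq] Q(3) w(2) valq w(4)] by blast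
      have "path b Lp L' (T2 * Tp)" by (rule path_trans [OF w(1) T2(1) valp])
      then obtain T3 where T3: "path b Lz L' T3" "T2 * Tp = T3 * Tz'"
        using less.hyps [OF smaller [OF Z(2) Ip] _ Z(3) valp less.prems(4)] by blast
      have valw: "valid Lw" using w(1) valp path_valid by blast
      have valz: "valid Lz" using Z(3) valp path_valid by blast
      note c = path_carrier [OF T2(1) valw] path_carrier [OF w(1) valp] path_carrier [OF w(2) valq]
        step_carrier [OF Z(2) less.prems(3)] step_carrier [OF Q(2) less.prems(3)]
        path_carrier [OF T3(1) valz] path_carrier [OF Z(3) valp]
      have "T = T2 * Tq * Sq" using Q T2 by simp
      also have "\<dots> = T2 * (Tp * Sp)" using w(3) c by (metis assoc_mult_mat)
      also have "\<dots> = T2 * Tp * Sp" using c by (metis assoc_mult_mat)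
      also have "\<dots> = T3 * Tz" unfolding T3(2) Z(1) using c by (metis assoc_mult_mat)
      finally show ?thesis using T3(1) by blast
    qed
  qed
qed

text \<open>Matsumoto's theorem: all reduced words for the same element give the same operator.\<close>

corollary path_unique:
  assumes "path b L L' T" "path b L L' T'" "valid L"
  shows "T = T'"
proof -
  obtain T2 where "path b L' L' T2" "T = T2 * T'"
    using path_factor [OF assms] by blast
  moreover have "T2 = 1\<^sub>m (dimL L')"
    using path_loop [OF calculation(1)] path_valid assms by blast
  ultimately show ?thesis using path_carrier [OF assms(2,3)] by simp
qed

end

section \<open>Lengths and inversions of permutations\<close>

definition perm_inv :: "nat \<Rightarrow> (nat \<Rightarrow> nat) \<Rightarrow> (nat \<times> nat) set" where
  "perm_inv n w = {(p, q). 1 \<le> p \<and> p < q \<and> q \<le> n \<and> w q < w p}"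

lemma perm_length_perm_inv: "perm_length n w = card (perm_inv n w)"
  by (simp add: perm_length_def perm_inv_def)

lemma finite_perm_inv: "finite (perm_inv n w)"
  by (rule finite_subset [of _ "{1..n} \<times> {1..n}"]) (auto simp: perm_inv_def)

text \<open>The action on unordered pairs of positions, which are written as increasing pairs.\<close>

definition sort_image :: "(nat \<Rightarrow> nat) \<Rightarrow> nat \<times> nat \<Rightarrow> nat \<times> nat" where
  "sort_image w = (\<lambda>(p, q). (min (w p) (w q), max (w p) (w q)))"

lemma bij_sort_image:
  assumes w: "w permutes {1..n}"
  shows "bij_betw (sort_image w) {(p, q). 1 \<le> p \<and> p < q \<and> q \<le> n} {(p, q). 1 \<le> p \<and> p < q \<and> q \<le> n}"
    (is "bij_betw _ ?P ?P")
proof -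
  have fin: "finite ?P" by (rule finite_subset [of _ "{1..n} \<times> {1..n}"]) auto
  have inj: "w p = w q \<longleftrightarrow> p = q" for p q
    using permutes_inj [OF w] by (simp add: inj_eq)
  have range: "1 \<le> w p \<and> w p \<le> n" if "1 \<le> p" "p \<le> n" for p
    using permutes_in_image [OF w, of p] that by simp
  have "sort_image w (p, q) \<in> ?P" if "1 \<le> p" "p < q" "q \<le> n" for p q
    using range [of p] range [of q] inj [of p q] that by (auto simp: sort_image_def min_def max_def)
  then have "sort_image w ` ?P \<subseteq> ?P" by (simp add: image_subset_iff)
  moreover have "inj_on (sort_image w) ?P"
    by (auto simp: inj_on_def sort_image_def min_def max_def inj split: if_splits)
  ultimately show ?thesis
    using endo_inj_surj [OF fin] by (auto simp: bij_betw_def)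
qed

text \<open>The inversions of \<open>w \<circ> w'\<close> are the symmetric difference of those of \<open>w'\<close> and of the preimages under
  \<open>w'\<close> of those of \<open>w\<close>. So lengths add iff these two sets are disjoint, that is, iff every inversion of
  either factor survives in the product.\<close>

lemma perm_length_comp:
  assumes w': "w' permutes {1..n}" and w: "inj w"
  shows "perm_length n (w \<circ> w') = perm_length n w + perm_length n w' \<longleftrightarrow>
    (\<forall>(p, q) \<in> perm_inv n w'. w (w' q) < w (w' p))"
    and "perm_length n (w \<circ> w') = perm_length n w + perm_length n w' \<Longrightarrow>
      (p, q) \<in> perm_inv n w \<Longrightarrow> (inv_into UNIV w' p, inv_into UNIV w' q) \<in> perm_inv n (w \<circ> w')"
proof -
  let ?P = "{(p, q). 1 \<le> p \<and> p < q \<and> q \<le> n}"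
  \<comment> \<open>\<open>Q\<close> is the preimage of the inversions of \<open>w\<close>; its image is all of them as \<open>w'\<close> is bijective on pairs.\<close>
  define Q where "Q = {x \<in> ?P. sort_image w' x \<in> perm_inv n w}"
  let ?N = "perm_inv n w'"
  have injw: "w p = w q \<longleftrightarrow> p = q" for p q using w by (simp add: inj_eq)
  have injw': "w' p = w' q \<longleftrightarrow> p = q" for p q
    using permutes_inj [OF w'] by (simp add: inj_eq)
  have range: "1 \<le> w' p \<and> w' p \<le> n \<longleftrightarrow> 1 \<le> p \<and> p \<le> n" for p
    using permutes_in_image [OF w', of p] by simp
  have fin: "finite Q" "finite ?N"
    by (rule finite_subset [of _ "{1..n} \<times> {1..n}"]; auto simp: Q_def) (rule finite_perm_inv)
  have "sort_image w' ` Q = perm_inv n w"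
  proof -
    have image_preimage: "f ` {x \<in> X. f x \<in> Y} = Y"
      if "f ` X = X" "Y \<subseteq> X" for f :: "nat \<times> nat \<Rightarrow> nat \<times> nat" and X Y
    proof
      show "Y \<subseteq> f ` {x \<in> X. f x \<in> Y}"
      proof
        fix y assume y: "y \<in> Y"
        then have "y \<in> f ` X" using that by auto
        then show "y \<in> f ` {x \<in> X. f x \<in> Y}" using y by auto
      qed
    qed auto
    have "sort_image w' ` ?P = ?P" using bij_sort_image [OF w'] by (simp add: bij_betw_def)
    moreover have "perm_inv n w \<subseteq> ?P" by (auto simp: perm_inv_def)
    ultimately show ?thesis unfolding Q_def by (rule image_preimage)
  qed
  moreover have "inj_on (sort_image w') Q"
    using bij_sort_image [OF w'] by (auto simp: Q_def bij_betw_def intro: inj_on_subset)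
  ultimately have cQ: "card Q = card (perm_inv n w)" by (metis card_image)
  have memQ: "(p, q) \<in> Q \<longleftrightarrow> 1 \<le> p \<and> p < q \<and> q \<le> n \<and>
      (if w' p < w' q then w (w' q) < w (w' p) else w (w' p) < w (w' q))" for p q
    using range [of p] range [of q] injw' [of p q]
    by (auto simp: Q_def sort_image_def perm_inv_def min_def max_def)
  have memN: "(p, q) \<in> ?N \<longleftrightarrow> 1 \<le> p \<and> p < q \<and> q \<le> n \<and> w' q < w' p" for p q
    by (simp add: perm_inv_def)
  have sym: "perm_inv n (w \<circ> w') = (?N - Q) \<union> (Q - ?N)"
  proof (rule Set.set_eqI)
    fix x :: "nat \<times> nat"
    obtain p q where x: "x = (p, q)" by (cases x)
    have "w' p = w' q \<longleftrightarrow> p = q" "w (w' p) = w (w' q) \<longleftrightarrow> p = q" by (simp_all add: injw injw')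
    then show "x \<in> perm_inv n (w \<circ> w') \<longleftrightarrow> x \<in> (?N - Q) \<union> (Q - ?N)"
      unfolding x Un_iff Diff_iff memQ memN by (auto simp: perm_inv_def)
  qed
  have "card (perm_inv n (w \<circ> w')) = card (?N - Q) + card (Q - ?N)"
    unfolding sym using fin by (intro card_Un_disjoint) auto
  moreover have "card ?N = card (?N \<inter> Q) + card (?N - Q)"
    using fin(2) by (rule card_Int_Diff)
  moreover have "card Q = card (?N \<inter> Q) + card (Q - ?N)"
    using card_Int_Diff [OF fin(1), of ?N] by (simp add: Int_commute)
  ultimately have eq: "perm_length n (w \<circ> w') = perm_length n w + perm_length n w' \<longleftrightarrow> ?N \<inter> Q = {}"
    unfolding perm_length_perm_inv using cQ fin by (auto simp: card_eq_0_iff)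
  have disj: "?N \<inter> Q = {} \<longleftrightarrow> (\<forall>(p, q) \<in> ?N. w (w' q) < w (w' p))"
  proof -
    have "(p, q) \<notin> Q \<longleftrightarrow> w (w' q) < w (w' p)" if "(p, q) \<in> ?N" for p q
    proof -
      have "w (w' p) \<noteq> w (w' q)" using that by (simp add: injw injw' memN)
      then show ?thesis using that by (auto simp: memQ memN)
    qed
    then show ?thesis by (auto simp: disjoint_iff)
  qed
  show "perm_length n (w \<circ> w') = perm_length n w + perm_length n w' \<longleftrightarrow>
    (\<forall>(p, q) \<in> perm_inv n w'. w (w' q) < w (w' p))"
    using eq disj by simp
  assume add: "perm_length n (w \<circ> w') = perm_length n w + perm_length n w'" and pq: "(p, q) \<in> perm_inv n w"
  let ?p = "inv_into UNIV w' p" and ?q = "inv_into UNIV w' q"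
  have e: "w' ?p = p" "w' ?q = q" using permutes_inverses [OF w'] by auto
  have r: "1 \<le> ?p \<and> ?p \<le> n" "1 \<le> ?q \<and> ?q \<le> n"
    using range [of ?p] range [of ?q] pq unfolding e by (auto simp: perm_inv_def)
  have lt: "p < q" "w q < w p" using pq by (auto simp: perm_inv_def)
  have "?p \<noteq> ?q" using e lt by auto
  moreover have "\<not> ?q < ?p"
  proof
    assume "?q < ?p"
    then have "(?q, ?p) \<in> ?N" using r lt e by (simp add: memN)
    then have "w (w' ?p) < w (w' ?q)" using add eq disj by auto
    then show False using e lt by simp
  qed
  ultimately show "(?p, ?q) \<in> perm_inv n (w \<circ> w')"
    using r e lt by (simp add: perm_inv_def)
qed

lemma perm_inv_transpose:
  "(p, q) \<in> perm_inv n (Transposition.transpose i (i + 1)) \<Longrightarrow> p = i \<and> q = i + 1"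
  by (auto simp: perm_inv_def Transposition.transpose_def split: if_splits)

lemma R_perm_permutes: "R_perm M Rm a n w z T \<Longrightarrow> w permutes {1..n}"
proof (induction rule: R_perm.induct)
  case (1 x)
  show ?case by (rule permutes_id)
next
  case (2 i x)
  then show ?case by (intro permutes_swap_id) auto
next
  case (3 w x T w' T')
  then show ?case by (intro permutes_compose)
qed

section \<open>Words of coloured fundamental modules\<close>

text \<open>The case at hand: the letter \<open>u\<close> stands for the fundamental module of \<open>node u\<close> with spectral
  parameter \<open>par u\<close>, and K turns it into the one of the node \<open>star (node u)\<close> with inverse parameter.\<close>

locale coloured_fundamental =
  coloured_braid Lab "\<lambda>u. mdim (M (node u))" "\<lambda>u v. Rval Rm (node u) (node v) (par u) (par v)"
    "\<lambda>u. Kval Km (node u) (par u)"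
  for Lab :: "int set" and M :: "'i \<Rightarrow> 'i umodule" and Rm :: "'i \<Rightarrow> 'i \<Rightarrow> ratmat"
    and Km :: "'i \<Rightarrow> ratmat" and node :: "int \<Rightarrow> 'i" and par :: "int \<Rightarrow> Cq" +
  fixes star :: "'i \<Rightarrow> 'i"
  assumes node_uminus: "u \<in> Lab \<Longrightarrow> 0 < u \<Longrightarrow> node (- u) = star (node u)"
    and par_uminus: "u \<in> Lab \<Longrightarrow> 0 < u \<Longrightarrow> par (- u) = inverse (par u)"
begin

lemma path_snoc:
  "path b L L' T \<Longrightarrow> step b L' L'' S \<Longrightarrow> valid L \<Longrightarrow> path b L L'' (S * T)"
  using path_trans path_step path_valid by blast

lemma valid_append: "valid (X @ Y) \<Longrightarrow> valid X \<and> valid Y"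
  by (auto simp: valid_def)

lemma dimL_node: "(\<And>u. u \<in> set L \<Longrightarrow> node u = a) \<Longrightarrow> dimL L = mdim (M a) ^ length L"
  by (induction L) auto

text \<open>This and the next three lemmas provide reduced words of which only the ends matter.\<close>

lemma ex_path_move:
  "valid ([u] @ Y) \<Longrightarrow> (\<And>v. v \<in> set Y \<Longrightarrow> u < v) \<Longrightarrow> \<exists>T. path False ([u] @ Y) (Y @ [u]) T"
proof (induction Y)
  case Nil
  show ?case using path.refl [of False "[u]"] by auto
next
  case (Cons v Y)
  have s: "step False ([u] @ v # Y) ([v] @ [u] @ Y) (at_pos (dimL []) (Rval Rm (node u) (node v) (par u) (par v)) (dimL Y))"
    using step.swap [of u v False "[]" Y] Cons.prems by simp
  have v: "valid ([u] @ Y)" using Cons.prems by (auto simp: valid_def)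
  obtain T where "path False ([u] @ Y) (Y @ [u]) T"
    using Cons.IH [OF v] Cons.prems by auto
  from path_append_left [OF this v, of "[v]"]
  show ?case using path.cons [OF s] by auto
qed

lemma ex_path_exchange:
  "valid (X @ Y) \<Longrightarrow> (\<And>u v. u \<in> set X \<Longrightarrow> v \<in> set Y \<Longrightarrow> u < v) \<Longrightarrow> \<exists>T. path False (X @ Y) (Y @ X) T"
proof (induction X)
  case Nil
  show ?case using path.refl [of False Y] by auto
next
  case (Cons u X)
  have v: "valid (X @ Y)" "valid ([u] @ Y)" using Cons.prems by (auto simp: valid_def)
  obtain T where "path False (X @ Y) (Y @ X) T"
    using Cons.IH [OF v(1)] Cons.prems by auto
  from path_append_left [OF this v(1), of "[u]"]
  have 1: "path False ((u # X) @ Y) (([u] @ Y) @ X) (kron (1\<^sub>m (dimL [u])) T)" by simp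
  obtain T' where "path False ([u] @ Y) (Y @ [u]) T'"
    using ex_path_move [OF v(2)] Cons.prems by auto
  from path_append_right [OF this v(2), of X]
  have 2: "path False (([u] @ Y) @ X) (Y @ u # X) (kron T' (1\<^sub>m (dimL X)))" by simp
  show ?case using path_trans [OF 1 2] Cons.prems(1) by auto
qed

lemma ex_path_rev: "valid L \<Longrightarrow> sorted_wrt (<) L \<Longrightarrow> \<exists>T. path False L (rev L) T"
proof (induction L)
  case Nil
  show ?case using path.refl [of False "[]"] by auto
next
  case (Cons u L)
  have v: "valid L" "valid ([u] @ rev L)" using Cons.prems by (auto simp: valid_def simp flip: rev_map)
  obtain T where "path False L (rev L) T" using Cons v by auto
  from path_append_left [OF this v(1), of "[u]"]
  have 1: "path False (u # L) ([u] @ rev L) (kron (1\<^sub>m (dimL [u])) T)" by simp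
  obtain T' where 2: "path False ([u] @ rev L) (rev L @ [u]) T'"
    using ex_path_move [OF v(2)] Cons.prems by auto
  show ?case using path_trans [OF 1 2] Cons.prems(1) by auto
qed

lemma ex_path_negate:
  "valid X \<Longrightarrow> (\<And>u. u \<in> set X \<Longrightarrow> 0 < u) \<Longrightarrow> \<exists>T. path True X (map uminus (rev X)) T"
proof (induction X rule: rev_induct)
  case Nil
  show ?case using path.refl [of True "[]"] by auto
next
  case (snoc u X)
  let ?N = "map uminus (rev X)"
  have v: "valid X" using snoc.prems by (auto simp: valid_def)
  obtain T where "path True X ?N T" using snoc v by auto
  from path_append_right [OF this v, of "[u]"]
  have 1: "path True (X @ [u]) (?N @ [u]) (kron T (1\<^sub>m (dimL [u])))" by simp
  have v1: "valid (?N @ [u])" using path_valid [OF 1] snoc.prems by blast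
  have "- y < u" if "y \<in> set X" for y
    using snoc.prems(2) [of y] snoc.prems(2) [of u] that by simp
  then obtain T' where "path False (?N @ [u]) ([u] @ ?N) T'"
    using ex_path_exchange [OF v1] by auto
  from path_swap_imp [OF this]
  have 2: "path True (X @ [u]) ([u] @ ?N) (T' * kron T (1\<^sub>m (dimL [u])))"
    using path_trans [OF 1] snoc.prems by blast
  show ?case
    using path_snoc [OF 2 step.neg [of True u ?N]] snoc.prems by auto
qed

definition coloured_block :: "'i \<Rightarrow> (nat \<Rightarrow> Cq) \<Rightarrow> nat \<Rightarrow> int list \<Rightarrow> bool" where
  "coloured_block a p n L \<longleftrightarrow> (\<forall>u\<in>set L. node u = a) \<and> map par L = map p [1..<Suc n]"

lemma coloured_length: "coloured_block a p n L \<Longrightarrow> length L = n"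
  unfolding coloured_block_def by (metis diff_Suc_1 length_map length_upt)

lemma coloured_nth:
  assumes "coloured_block a p n L" "k < n"
  shows "node (L ! k) = a" "par (L ! k) = p (Suc k)"
proof -
  have l: "length L = n" by (rule coloured_length [OF assms(1)])
  show "node (L ! k) = a" using assms l by (auto simp: coloured_block_def)
  have "map par L ! k = map p [1..<Suc n] ! k" using assms by (simp add: coloured_block_def)
  then show "par (L ! k) = p (Suc k)" using assms(2) l by (simp del: upt_Suc)
qed

lemma dimL_coloured:
  assumes "coloured_block a p n L"
  shows "dimL L = mdim (M a) ^ n" "k \<le> n \<Longrightarrow> dimL (take k L) = mdim (M a) ^ k"
    "dimL (drop k L) = mdim (M a) ^ (n - k)"
proof -
  have l: "length L = n" by (rule coloured_length [OF assms])
  have node: "node u = a" if "u \<in> set L" for u using assms that by (simp add: coloured_block_def)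
  show "dimL L = mdim (M a) ^ n" using dimL_node [of L a] node l by simp
  show "k \<le> n \<Longrightarrow> dimL (take k L) = mdim (M a) ^ k"
  proof -
    assume "k \<le> n"
    moreover have "dimL (take k L) = mdim (M a) ^ length (take k L)"
      by (rule dimL_node) (blast intro: node dest: in_set_takeD)
    ultimately show ?thesis using l by simp
  qed
  show "dimL (drop k L) = mdim (M a) ^ (n - k)"
  proof -
    have "dimL (drop k L) = mdim (M a) ^ length (drop k L)"
      by (rule dimL_node) (blast intro: node dest: in_set_dropD)
    then show ?thesis using l by simp
  qed
qed

text \<open>Each factor moves \<open>u\<close> one letter further to the right through \<open>Y\<close>.\<close>

lemma path_fused_M:
  assumes Y: "coloured_block b (KR_param d b t y) t Y"
    and u: "node u = a" "par u = KR_param d a s x k" and k: "1 \<le> k" "k \<le> s"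
    and A: "dimL A = mdim (M a) ^ (k - 1)" and C: "dimL C = mdim (M a) ^ (s - k)"
    and v: "valid (A @ [u] @ Y @ C)" and lt: "\<And>w. w \<in> set Y \<Longrightarrow> u < w"
  shows "path False (A @ [u] @ Y @ C) (A @ Y @ [u] @ C) (fused_M d M Rm a s b t x y k)"
proof -
  note lY = coloured_length [OF Y]
  let ?f = "\<lambda>j T. fused_factor d M Rm a s b t x y k j * T"
  let ?I = "1\<^sub>m (KR_dim M a s * KR_dim M b t)"
  have "mdim (M a) ^ s = mdim (M a) ^ (k - 1) * (mdim (M a) * mdim (M a) ^ (s - k))"
  proof -
    have "s = (k - 1) + Suc (s - k)" using k by simp
    then show ?thesis by (metis power_add power_Suc)
  qed
  then have I: "?I = 1\<^sub>m (dimL (A @ [u] @ Y @ C))"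
    using dimL_coloured(1) [OF Y] A C u by (simp add: KR_dim_def ac_simps)
  have "j \<le> t \<Longrightarrow> path False (A @ [u] @ Y @ C) (A @ take j Y @ [u] @ drop j Y @ C)
      (fold ?f [1..<Suc j] ?I)" for j
  proof (induction j)
    case 0
    show ?case using path.refl [of False "A @ [u] @ Y @ C"] unfolding I by simp
  next
    case (Suc j)
    let ?w = "Y ! j"
    have jl: "j < length Y" using Suc.prems lY by simp
    have "?w \<in> set Y" using jl by simp
    then have uw: "u < ?w" by (rule lt)
    have IH: "path False (A @ [u] @ Y @ C) (A @ take j Y @ [u] @ drop j Y @ C) (fold ?f [1..<Suc j] ?I)"
      using Suc by simp
    have e1: "A @ take j Y @ [u] @ drop j Y @ C = (A @ take j Y) @ [u, ?w] @ drop (Suc j) Y @ C"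
      using Cons_nth_drop_Suc [OF jl] by simp
    have e2: "A @ take (Suc j) Y @ [u] @ drop (Suc j) Y @ C = (A @ take j Y) @ [?w, u] @ drop (Suc j) Y @ C"
      using take_Suc_conv_app_nth [OF jl] by simp
    have s: "step False ((A @ take j Y) @ [u, ?w] @ drop (Suc j) Y @ C)
        ((A @ take j Y) @ [?w, u] @ drop (Suc j) Y @ C) (fused_factor d M Rm a s b t x y k (Suc j))"
      using step.swap [OF uw, of False "A @ take j Y" "drop (Suc j) Y @ C"]
        dimL_coloured(2,3) [OF Y] A C u coloured_nth [OF Y, of j] Suc.prems
      by (simp add: fused_factor_def)
    have "fold ?f [1..<Suc (Suc j)] ?I = ?f (Suc j) (fold ?f [1..<Suc j] ?I)" by simp
    then show ?case
      using path_snoc [OF IH [unfolded e1] s v] by (simp only: e2)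
  qed
  from this [of t] show ?thesis using lY by (simp add: fused_M_def)
qed

text \<open>The rightmost letter of \<open>X\<close> moves through \<open>Y\<close> first, the leftmost one last.\<close>

lemma path_fused_R:
  assumes X: "coloured_block a (KR_param d a s x) s X" and Y: "coloured_block b (KR_param d b t y) t Y"
    and v: "valid (X @ Y)" and lt: "\<And>u w. u \<in> set X \<Longrightarrow> w \<in> set Y \<Longrightarrow> u < w"
  shows "path False (X @ Y) (Y @ X) (fused_R d M Rm a s b t x y)"
proof -
  note lX = coloured_length [OF X]
  let ?f = "\<lambda>k T. fused_M d M Rm a s b t x y k * T"
  let ?I = "1\<^sub>m (KR_dim M a s * KR_dim M b t)"
  have I: "?I = 1\<^sub>m (dimL (X @ Y))"
    using dimL_coloured(1) [OF X] dimL_coloured(1) [OF Y] by (simp add: KR_dim_def)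
  have "path False (X @ Y) (take 0 X @ Y @ drop 0 X) (foldr ?f [Suc 0..<Suc s] ?I)"
  proof (rule inc_induct [of 0 s "\<lambda>k. path False (X @ Y) (take k X @ Y @ drop k X) (foldr ?f [Suc k..<Suc s] ?I)"])
    show "path False (X @ Y) (take s X @ Y @ drop s X) (foldr ?f [Suc s..<Suc s] ?I)"
      using path.refl [of False "X @ Y"] lX unfolding I by simp
  next
    fix k assume k: "k < s"
      and IH: "path False (X @ Y) (take (Suc k) X @ Y @ drop (Suc k) X) (foldr ?f [Suc (Suc k)..<Suc s] ?I)"
    let ?u = "X ! k"
    have kl: "k < length X" using k lX by simp
    have e1: "take (Suc k) X @ Y @ drop (Suc k) X = take k X @ [?u] @ Y @ drop (Suc k) X"
      using take_Suc_conv_app_nth [OF kl] by simp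
    have e2: "take k X @ Y @ [?u] @ drop (Suc k) X = take k X @ Y @ drop k X"
      using Cons_nth_drop_Suc [OF kl] by simp
    have "path False (take k X @ [?u] @ Y @ drop (Suc k) X) (take k X @ Y @ [?u] @ drop (Suc k) X)
        (fused_M d M Rm a s b t x y (Suc k))"
    proof (rule path_fused_M [OF Y])
      show "valid (take k X @ [?u] @ Y @ drop (Suc k) X)"
        using path_valid [OF IH v] unfolding e1 .
      show "?u < w" if "w \<in> set Y" for w using lt [OF _ that] kl by simp
    qed (use k coloured_nth [OF X k] dimL_coloured(2,3) [OF X] in simp_all)
    note p = path_trans [OF IH [unfolded e1] this v]
    have "foldr ?f [Suc k..<Suc s] ?I = ?f (Suc k) (foldr ?f [Suc (Suc k)..<Suc s] ?I)"
      using k by (simp add: upt_conv_Cons del: upt_Suc)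
    then show "path False (X @ Y) (take k X @ Y @ drop k X) (foldr ?f [Suc k..<Suc s] ?I)"
      using p by (simp only: e2)
  qed simp
  then show ?thesis by (simp add: fused_R_def)
qed

text \<open>The letter met by the \<open>j+1\<close>-st one at position \<open>i+1\<close> is the one that started at position \<open>j-i\<close>.\<close>

lemma K_param_inverse:
  assumes "i < j"
  shows "K_param d a s x (Suc j) (Suc i) = inverse (KR_param d a s x (j - i))"
proof -
  have e: "int s - 2 * int (Suc j) + 2 * int (Suc i) + 1 = - (- int s + 2 * int (j - i) - 1)"
    using assms by (simp add: of_nat_diff)
  show ?thesis
    unfolding K_param_def KR_param_def e power_int_minus inverse_mult_distrib ..
qed

text \<open>At stage \<open>j\<close> the \<open>j\<close>-th letter moves to the front through the letters whose sign has already been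
  changed, and then changes its own sign. All exchanges are of a negative with a positive letter, so
  they are increasing whatever the order of \<open>X\<close>.\<close>

lemma path_KR_K:
  assumes X: "coloured_block a (KR_param d a s x) s X" and v: "valid X" and pos: "\<And>u. u \<in> set X \<Longrightarrow> 0 < u"
  shows "path True X (map uminus (rev X)) (KR_K star d M Rm Km a s x)"
proof -
  note lX = coloured_length [OF X]
  let ?ds = "mdim (M (star a))" and ?da = "mdim (M a)"
  let ?f = "\<lambda>j T. K_stage star d M Rm Km a s x j * T"
  let ?N = "\<lambda>j. map uminus (rev (take j X))"
  have inLab: "u \<in> Lab" if "u \<in> set X" for u using v that by (auto simp: valid_def)
  have nodeX: "node u = a" if "u \<in> set X" for u using X that by (simp add: coloured_block_def)
  have nodeN: "node u = star a" if "u \<in> set (?N j)" for u j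
    using that inLab pos nodeX node_uminus by (auto dest: in_set_takeD)
  have "j \<le> s \<Longrightarrow> path True X (?N j @ drop j X) (fold ?f [1..<Suc j] (1\<^sub>m (KR_dim M a s)))" for j
  proof (induction j)
    case 0
    show ?case using path.refl [of True X] dimL_coloured(1) [OF X] by (simp add: KR_dim_def)
  next
    case (Suc j)
    let ?u = "X ! j" and ?C = "drop (Suc j) X"
    let ?g = "\<lambda>i T. K_factor star d M Rm a s x (Suc j) i * T"
    let ?I = "1\<^sub>m (?ds ^ j * ?da ^ (s - j))"
    have jl: "j < length X" "j < s" using Suc.prems lX by simp_all
    have u: "node ?u = a" "par ?u = KR_param d a s x (Suc j)" "?u \<in> set X"
      using coloured_nth [OF X jl(2)] jl by simp_all
    have IH: "path True X (?N j @ [?u] @ ?C) (fold ?f [1..<Suc j] (1\<^sub>m (KR_dim M a s)))"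
      using Suc Cons_nth_drop_Suc [OF jl(1)] by simp
    have vN: "valid (?N j @ [?u] @ ?C)" by (rule path_valid [OF IH v])
    have lN: "length (?N j) = j" using jl by simp
    have dN: "dimL (take i (?N j)) = ?ds ^ min i j" "dimL (drop i (?N j)) = ?ds ^ (j - i)" for i
    proof -
      have "dimL (take i (?N j)) = ?ds ^ length (take i (?N j))"
        by (rule dimL_node) (blast intro: nodeN dest: in_set_takeD)
      then show "dimL (take i (?N j)) = ?ds ^ min i j" by (simp only: length_take lN min.commute)
      have "dimL (drop i (?N j)) = ?ds ^ length (drop i (?N j))"
        by (rule dimL_node) (blast intro: nodeN dest: in_set_dropD)
      then show "dimL (drop i (?N j)) = ?ds ^ (j - i)" by (simp only: length_drop lN)
    qed
    have dC: "dimL ?C = ?da ^ (s - Suc j)" by (rule dimL_coloured(3) [OF X])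
    have I: "?I = 1\<^sub>m (dimL (?N j @ [?u] @ ?C))"
      using dN(1) [of j] dC u lN jl by (simp add: Suc_diff_Suc flip: power_Suc)
    have "path False (?N j @ [?u] @ ?C) (take 0 (?N j) @ [?u] @ drop 0 (?N j) @ ?C) (foldr ?g [Suc 0..<Suc j] ?I)"
    proof (rule inc_induct [of 0 j "\<lambda>i. path False (?N j @ [?u] @ ?C)
          (take i (?N j) @ [?u] @ drop i (?N j) @ ?C) (foldr ?g [Suc i..<Suc j] ?I)"])
      show "path False (?N j @ [?u] @ ?C) (take j (?N j) @ [?u] @ drop j (?N j) @ ?C) (foldr ?g [Suc j..<Suc j] ?I)"
        using path.refl [of False "?N j @ [?u] @ ?C"] lN unfolding I by simp
    next
      fix i assume i: "i < j" and ih: "path False (?N j @ [?u] @ ?C)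
          (take (Suc i) (?N j) @ [?u] @ drop (Suc i) (?N j) @ ?C) (foldr ?g [Suc (Suc i)..<Suc j] ?I)"
      let ?w = "?N j ! i"
      have il: "i < length (?N j)" using i lN by simp
      have w: "?w = - (X ! (j - Suc i))"
        using i jl by (simp add: rev_nth min_def)
      have k: "j - Suc i < s" using jl by simp
      have Xk: "X ! (j - Suc i) \<in> set X" using k lX by simp
      have wcol: "node ?w = star a" "par ?w = K_param d a s x (Suc j) (Suc i)"
        unfolding w using node_uminus [OF inLab [OF Xk] pos [OF Xk]] par_uminus [OF inLab [OF Xk] pos [OF Xk]]
          coloured_nth [OF X k] i by (simp_all add: K_param_inverse Suc_diff_Suc)
      have wu: "?w < ?u" using pos [OF Xk] pos [OF u(3)] unfolding w by simp
      have e1: "take (Suc i) (?N j) @ [?u] @ drop (Suc i) (?N j) @ ?C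
          = take i (?N j) @ [?w, ?u] @ drop (Suc i) (?N j) @ ?C"
        using take_Suc_conv_app_nth [OF il] by simp
      have e2: "take i (?N j) @ [?u] @ drop i (?N j) @ ?C
          = take i (?N j) @ [?u, ?w] @ drop (Suc i) (?N j) @ ?C"
        using Cons_nth_drop_Suc [OF il] by simp
      have st: "step False (take i (?N j) @ [?w, ?u] @ drop (Suc i) (?N j) @ ?C)
          (take i (?N j) @ [?u, ?w] @ drop (Suc i) (?N j) @ ?C) (K_factor star d M Rm a s x (Suc j) (Suc i))"
        using step.swap [OF wu, of False "take i (?N j)" "drop (Suc i) (?N j) @ ?C"] dN dC wcol u i
        by (simp add: K_factor_def min_def)
      have "foldr ?g [Suc i..<Suc j] ?I = ?g (Suc i) (foldr ?g [Suc (Suc i)..<Suc j] ?I)"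
        using i by (simp add: upt_conv_Cons del: upt_Suc)
      then show "path False (?N j @ [?u] @ ?C)
          (take i (?N j) @ [?u] @ drop i (?N j) @ ?C) (foldr ?g [Suc i..<Suc j] ?I)"
        using path_snoc [OF ih [unfolded e1] st vN] by (simp only: e2)
    qed simp
    then have "path False (?N j @ [?u] @ ?C) ([?u] @ ?N j @ ?C) (foldr ?g [Suc 0..<Suc j] ?I)"
      by simp
    then have p: "path True (?N j @ [?u] @ ?C) ([?u] @ ?N j @ ?C) (foldr ?g [Suc 0..<Suc j] ?I)"
      by (rule path_swap_imp)
    have n: "step True ([?u] @ ?N j @ ?C) ([- ?u] @ ?N j @ ?C)
        (kron (Kval Km a (KR_param d a s x (Suc j))) (1\<^sub>m (?ds ^ j * ?da ^ (s - Suc j))))"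
      using step.neg [of True ?u "?N j @ ?C"] pos [OF u(3)] u dN(1) [of j] dC lN by simp
    have e: "?N (Suc j) @ ?C = [- ?u] @ ?N j @ ?C"
      using take_Suc_conv_app_nth [OF jl(1)] by simp
    have "s - Suc j + 1 = s - j" using jl by simp
    then have "K_stage star d M Rm Km a s x (Suc j)
        = kron (Kval Km a (KR_param d a s x (Suc j))) (1\<^sub>m (?ds ^ j * ?da ^ (s - Suc j))) * foldr ?g [Suc 0..<Suc j] ?I"
      by (simp add: K_stage_def del: upt_Suc)
    then have "path True (?N j @ [?u] @ ?C) (?N (Suc j) @ ?C) (K_stage star d M Rm Km a s x (Suc j))"
      using path_snoc [OF p n vN] by (simp only: e)
    note q = path_trans [OF IH this v]
    have "fold ?f [1..<Suc (Suc j)] (1\<^sub>m (KR_dim M a s)) = ?f (Suc j) (fold ?f [1..<Suc j] (1\<^sub>m (KR_dim M a s)))"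
      by simp
    then show ?case using q by (simp only:)
  qed
  from this [of s] show ?thesis using lX by (simp add: KR_K_def)
qed

end

section \<open>The operator whose image is a Kirillov-Reshetikhin module\<close>

lemma upt_split_pair:
  assumes "1 \<le> i" "i < n"
  shows "[1..<Suc n] = [1..<i] @ [i, i + 1] @ [i + 2..<Suc n]"
proof -
  have "[1..<Suc n] = [1..<i] @ [i..<Suc n]"
    using assms by (metis le_add_diff_inverse less_SucI less_imp_le upt_add_eq_append)
  moreover have "[i..<Suc n] = i # Suc i # [Suc (Suc i)..<Suc n]"
    using assms by (simp add: upt_conv_Cons del: upt_Suc)
  ultimately show ?thesis by simp
qed

context coloured_fundamental
begin

lemma dimL_map:
  "(\<And>i. i \<in> set xs \<Longrightarrow> node (lab i) = a) \<Longrightarrow> dimL (map lab xs) = mdim (M a) ^ length xs"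
  by (induction xs) auto

text \<open>A factorization with additive lengths never exchanges two letters twice, so it is a reduced word.
  The letters are assumed to increase only along inversions of \<open>w\<close>: in this form the claim passes to both
  factors of a product, the second one acting on the word permuted by the first.\<close>

lemma R_perm_path:
  assumes "R_perm M Rm a n w z T"
    and "\<And>i. i \<in> {1..n} \<Longrightarrow> node (lab i) = a"
    and "\<And>i j. i \<in> {1..n} \<Longrightarrow> j \<in> {1..n} \<Longrightarrow> par (lab i) / par (lab j) = z i / z j"
    and "valid (map lab [1..<Suc n])"
    and "\<And>p q. (p, q) \<in> perm_inv n w \<Longrightarrow> lab (w q) < lab (w p)"
  shows "path False (map lab [1..<Suc n]) (map (lab \<circ> w) [1..<Suc n]) T"
  using assms
proof (induction arbitrary: lab rule: R_perm.induct)
  case (1 x)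
  have "dimL (map lab [1..<Suc n]) = mdim (M a) ^ length [1..<Suc n]"
    using 1(1) by (intro dimL_map) auto
  then show ?case using path.refl [of False "map lab [1..<Suc n]"] by (simp del: upt_Suc)
next
  case (2 i x)
  let ?s = "Transposition.transpose i (i + 1)"
  let ?A = "map lab [1..<i]" and ?B = "map lab [i + 2..<Suc n]"
  have lists: "map lab [1..<Suc n] = ?A @ [lab i, lab (i + 1)] @ ?B"
    "map (lab \<circ> ?s) [1..<Suc n] = ?A @ [lab (i + 1), lab i] @ ?B"
    unfolding upt_split_pair [OF 2(1,2)] by (simp_all del: upt_Suc add: Transposition.transpose_def)
  have "(i, i + 1) \<in> perm_inv n ?s" using 2(1,2) by (simp add: perm_inv_def)
  from 2(6) [OF this] have lt: "lab i < lab (i + 1)" by simp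
  have "dimL ?A = mdim (M a) ^ length [1..<i]"
    by (rule dimL_map) (use 2(1-3) in auto)
  moreover have "dimL ?B = mdim (M a) ^ length [i + 2..<Suc n]"
    by (rule dimL_map) (use 2(1-3) in auto)
  ultimately have "dimL ?A = mdim (M a) ^ (i - 1)" "dimL ?B = mdim (M a) ^ (n - i - 1)"
    by (simp_all del: upt_Suc)
  moreover have "Rval Rm (node (lab i)) (node (lab (i + 1))) (par (lab i)) (par (lab (i + 1))) = Rval Rm a a (x i) (x (i + 1))"
    using 2 by (simp add: Rval_def)
  ultimately have "step False (map lab [1..<Suc n]) (map (lab \<circ> ?s) [1..<Suc n])
      (at_pos (mdim (M a) ^ (i - 1)) (Rval Rm a a (x i) (x (i + 1))) (mdim (M a) ^ (n - i - 1)))"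
    using step.swap [OF lt, of False ?A ?B] unfolding lists by simp
  then show ?case using 2(5) by (rule path_step)
next
  case (3 w x T w' T')
  have w: "w permutes {1..n}" and w': "w' permutes {1..n}"
    by (rule R_perm_permutes [OF 3(1)], rule R_perm_permutes [OF 3(2)])
  note len = perm_length_comp [OF w' permutes_inj [OF w]]
  have 1: "path False (map lab [1..<Suc n]) (map (lab \<circ> w) [1..<Suc n]) T"
  proof (rule "3.IH"(1))
    fix p q assume "(p, q) \<in> perm_inv n w"
    from 3(9) [OF len(2) [OF 3(3) this]] show "lab (w q) < lab (w p)"
      using permutes_inverses(1) [OF w'] by simp
  qed (use 3 in auto)
  have im: "w i \<in> {1..n}" if "i \<in> {1..n}" for i
    using permutes_in_image [OF w, of i] that by simp
  have 2: "path False (map (lab \<circ> w) [1..<Suc n]) (map (lab \<circ> w \<circ> w') [1..<Suc n]) T'"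
  proof (rule "3.IH"(2))
    fix i j assume "i \<in> {1..n}" "j \<in> {1..n}"
    then show "node ((lab \<circ> w) i) = a" "par ((lab \<circ> w) i) / par ((lab \<circ> w) j) = (x \<circ> w) i / (x \<circ> w) j"
      using 3(6,7) im by auto
  next
    show "valid (map (lab \<circ> w) [1..<Suc n])" using path_valid [OF 1 3(8)] .
  next
    fix p q assume pq: "(p, q) \<in> perm_inv n w'"
    then have "w (w' q) < w (w' p)" using len(1) 3(3) by auto
    then have "(p, q) \<in> perm_inv n (w \<circ> w')" using pq by (simp add: perm_inv_def)
    from 3(9) [OF this] show "(lab \<circ> w) (w' q) < (lab \<circ> w) (w' p)" by simp
  qed
  show ?case using path_trans [OF 1 2 3(8)] by (simp only: o_assoc)
qed

text \<open>Conversely, each exchange extends the permutation that has led from the sorted word to the current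
  one by a simple transposition that increases the length.\<close>

lemma path_R_perm:
  assumes "path False L L' T" "L = map (lab \<circ> w) [1..<Suc n]" "R_perm M Rm a n w z T0"
    and node: "\<And>i. i \<in> {1..n} \<Longrightarrow> node (lab i) = a"
    and par: "\<And>i j. i \<in> {1..n} \<Longrightarrow> j \<in> {1..n} \<Longrightarrow> par (lab i) / par (lab j) = z i / z j"
    and val: "valid (map lab [1..<Suc n])"
    and mono: "strict_mono_on {1..n} lab"
  shows "\<exists>w'. L' = map (lab \<circ> w') [1..<Suc n] \<and> R_perm M Rm a n w' z (T * T0)"
  using assms(1-3)
proof (induction arbitrary: w T0 rule: path.induct)
  case (refl L)
  have w: "w permutes {1..n}" using refl(2) by (rule R_perm_permutes)
  have "path False (map lab [1..<Suc n]) L T0"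
    unfolding refl(1)
  proof (rule R_perm_path [OF refl(2)])
    fix p q assume "(p, q) \<in> perm_inv n w"
    then show "lab (w q) < lab (w p)"
      using permutes_in_image [OF w, of p] permutes_in_image [OF w, of q]
      by (auto simp: perm_inv_def intro!: strict_mono_onD [OF mono])
  qed (use node par val in auto)
  from path_carrier [OF this val] show ?case using refl by auto
next
  case (cons L L1 S L' T)
  have w: "w permutes {1..n}" using cons.prems(2) by (rule R_perm_permutes)
  have p0: "path False (map lab [1..<Suc n]) L T0"
    unfolding cons.prems(1)
  proof (rule R_perm_path [OF cons.prems(2)])
    fix p q assume "(p, q) \<in> perm_inv n w"
    then show "lab (w q) < lab (w p)"
      using permutes_in_image [OF w, of p] permutes_in_image [OF w, of q]
      by (auto simp: perm_inv_def intro!: strict_mono_onD [OF mono])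
  qed (use node par val in auto)
  have vL: "valid L" using path_valid [OF p0 val] .
  from cons.hyps(1) show ?case
  proof cases
    case (swap u v A B)
    define i where "i = Suc (length A)"
    have len: "length A + 2 + length B = n"
      using arg_cong [OF swap(1), of length] cons.prems(1) by (simp del: upt_Suc)
    then have i: "1 \<le> i" "i < n" by (simp_all add: i_def)
    let ?s = "Transposition.transpose i (i + 1)"
    have "A @ [u, v] @ B = map (lab \<circ> w) [1..<i] @ [lab (w i), lab (w (i + 1))] @ map (lab \<circ> w) [i + 2..<Suc n]"
      using swap(1) cons.prems(1) unfolding upt_split_pair [OF i] by (simp del: upt_Suc add: comp_def)
    moreover have "length (map (lab \<circ> w) [1..<i]) = length A" by (simp add: i_def del: upt_Suc)
    ultimately have AB: "A = map (lab \<circ> w) [1..<i]" "u = lab (w i)" "v = lab (w (i + 1))"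
        "B = map (lab \<circ> w) [i + 2..<Suc n]"
      by (auto simp del: upt_Suc)
    have im: "w j \<in> {1..n}" if "j \<in> {1..n}" for j
      using permutes_in_image [OF w, of j] that by simp
    have wi: "w i \<in> {1..n}" "w (i + 1) \<in> {1..n}" using im [of i] im [of "i + 1"] i by auto
    have lt: "w i < w (i + 1)"
    proof (rule ccontr)
      assume "\<not> w i < w (i + 1)"
      then have "w (i + 1) \<le> w i" by simp
      then have "lab (w (i + 1)) \<le> lab (w i)"
        using strict_mono_onD [OF mono wi(2,1)] by (cases "w (i + 1) = w i") auto
      then show False using swap(4) AB by simp
    qed
    have L1: "L1 = map (lab \<circ> (w \<circ> ?s)) [1..<Suc n]"
      unfolding upt_split_pair [OF i] swap(2) AB
      by (simp del: upt_Suc add: Transposition.transpose_def)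
    have "dimL A = mdim (M a) ^ length [1..<i]"
      unfolding AB by (rule dimL_map) (use node im i in auto)
    moreover have "dimL B = mdim (M a) ^ length [i + 2..<Suc n]"
      unfolding AB by (rule dimL_map) (use node im i in auto)
    ultimately have "dimL A = mdim (M a) ^ (i - 1)" "dimL B = mdim (M a) ^ (n - i - 1)"
      by (simp_all del: upt_Suc)
    moreover have "Rval Rm (node u) (node v) (par u) (par v) = Rval Rm a a ((z \<circ> w) i) ((z \<circ> w) (i + 1))"
      unfolding AB using node par wi by (simp add: Rval_def)
    ultimately have S: "S = at_pos (mdim (M a) ^ (i - 1)) (Rval Rm a a ((z \<circ> w) i) ((z \<circ> w) (i + 1))) (mdim (M a) ^ (n - i - 1))"
      unfolding swap(3) by simp
    have s: "?s permutes {1..n}" using i by (intro permutes_swap_id) auto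
    have "perm_length n (w \<circ> ?s) = perm_length n w + perm_length n ?s"
      unfolding perm_length_comp(1) [OF s permutes_inj [OF w]]
    proof clarify
      fix p q assume "(p, q) \<in> perm_inv n ?s"
      then have "p = i" "q = i + 1" using perm_inv_transpose by blast+
      then show "w (?s q) < w (?s p)" using lt by simp
    qed
    then have "R_perm M Rm a n (w \<circ> ?s) z (S * T0)"
      using R_perm.intros(3) [OF cons.prems(2) R_perm.intros(2) [OF i, of M Rm a "z \<circ> w"]] unfolding S by blast
    from cons.IH [OF L1 this] obtain w' where
      "L' = map (lab \<circ> w') [1..<Suc n]" "R_perm M Rm a n w' z (T * (S * T0))" by blast
    moreover have "T * S * T0 = T * (S * T0)"
      using path_carrier [OF cons.hyps(2) step_valid [OF cons.hyps(1) vL]]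
        step_carrier [OF cons.hyps(1) vL] path_carrier [OF p0 val]
      by (rule assoc_mult_mat)
    ultimately show ?thesis by auto
  qed simp
qed

text \<open>Reversal of a sorted word is a reduced word of the longest permutation, so this permutation has some
  operator; by \<open>path_unique\<close> it has only one.\<close>

lemma path_KR_R:
  assumes node: "\<And>i. i \<in> {1..n} \<Longrightarrow> node (lab i) = a"
    and par: "\<And>i j. i \<in> {1..n} \<Longrightarrow> j \<in> {1..n} \<Longrightarrow>
      par (lab i) / par (lab j) = KR_source_param d a n i / KR_source_param d a n j"
    and val: "valid (map lab [1..<Suc n])"
    and mono: "strict_mono_on {1..n} lab"
  shows "path False (map lab [1..<Suc n]) (rev (map lab [1..<Suc n])) (KR_R d M Rm a n)"
proof -
  let ?L = "map lab [1..<Suc n]" and ?z = "KR_source_param d a n"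
  have nth: "?L ! k = lab (Suc k)" if "k < n" for k using that by (simp del: upt_Suc)
  have inj: "lab i = lab j \<longleftrightarrow> i = j" if "i \<in> {1..n}" "j \<in> {1..n}" for i j
    using strict_mono_on_imp_inj_on [OF mono] that by (auto dest: inj_onD)
  have "sorted_wrt (<) ?L"
    unfolding sorted_wrt_iff_nth_less using strict_mono_onD [OF mono] nth by (auto simp del: upt_Suc)
  then obtain T where T: "path False ?L (rev ?L) T" using ex_path_rev [OF val] by blast
  have "?L = map (lab \<circ> id) [1..<Suc n]" by simp
  from path_R_perm [OF T this R_perm.intros(1) node par val mono]
  obtain w T1 where w: "rev ?L = map (lab \<circ> w) [1..<Suc n]" "R_perm M Rm a n w ?z T1" by blast
  have wp: "w permutes {1..n}" using w(2) by (rule R_perm_permutes)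
  have "w i = longest_perm n i" for i
  proof (cases "i \<in> {1..n}")
    case True
    have len: "length ?L = n" by simp
    have "rev ?L ! (i - 1) = ?L ! (n - Suc (i - 1))"
      using True rev_nth [of "i - 1" ?L] unfolding len by auto
    also have "\<dots> = lab (n + 1 - i)"
      using True nth [of "n - i"] by (simp add: Suc_diff_le del: upt_Suc)
    finally have "rev ?L ! (i - 1) = lab (n + 1 - i)" .
    moreover have "map (lab \<circ> w) [1..<Suc n] ! (i - 1) = lab (w i)"
      using True by (cases i) (simp_all del: upt_Suc)
    ultimately have "lab (w i) = lab (n + 1 - i)" using w(1) by simp
    moreover have "w i \<in> {1..n}" "n + 1 - i \<in> {1..n}"
      using permutes_in_image [OF wp, of i] True by auto
    ultimately have "w i = n + 1 - i" using inj by blast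
    then show ?thesis using True by (simp add: longest_perm_def)
  next
    case False
    then show ?thesis using permutes_not_in [OF wp] by (auto simp: longest_perm_def)
  qed
  then have wl: "w = longest_perm n" by (rule ext)
  have path: "path False ?L (rev ?L) T'" if "R_perm M Rm a n (longest_perm n) ?z T'" for T'
    unfolding w(1) wl
  proof (rule R_perm_path [OF that node par val])
    fix p q assume "(p, q) \<in> perm_inv n (longest_perm n)"
    then show "lab (longest_perm n q) < lab (longest_perm n p)"
      by (auto simp: perm_inv_def longest_perm_def intro!: strict_mono_onD [OF mono])
  qed
  have "KR_R d M Rm a n = T1"
    unfolding KR_R_def
  proof (rule the_equality)
    show "R_perm M Rm a n (longest_perm n) ?z T1" using w(2) unfolding wl .
    show "T' = T1" if "R_perm M Rm a n (longest_perm n) ?z T'" for T'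
      using path_unique [OF path [OF that] path val] w(2) unfolding wl by blast
  qed
  then show ?thesis using path w(2) unfolding wl by simp
qed

end

section \<open>The duality of nodes preserves the symmetrizer\<close>

text \<open>The coordinates, in the simple coroots, of the inverse of \<open>w\<close> applied to the simple coroot of \<open>k\<close>.\<close>

fun coroot_row :: "('i::finite \<Rightarrow> 'i \<Rightarrow> int) \<Rightarrow> 'i list \<Rightarrow> 'i \<Rightarrow> 'i \<Rightarrow> int" where
  "coroot_row A [] k j = (if j = k then 1 else 0)"
| "coroot_row A (i # w) k j = coroot_row A w k j - A k i * coroot_row A w i j"

lemma weyl_weight_Cons:
  "weyl_weight A lam (i # w) k = weyl_weight A lam w k - A k i * weyl_weight A lam w i"
proof -
  let ?b = "weyl_shift A lam w" and ?m = "coroot_pairing A lam (weyl_shift A lam w) i"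
  have "(\<Sum>j\<in>UNIV. A k j * (?b(i := ?b i - ?m)) j) = (\<Sum>j\<in>UNIV. A k j * ?b j - (if j = i then A k i * ?m else 0))"
    by (intro sum.cong) (auto simp: algebra_simps)
  then show ?thesis
    by (simp add: weyl_weight_def Let_def coroot_pairing_def sum_subtractf)
qed

lemma weyl_weight_coroot_row:
  "weyl_weight A lam w k = (\<Sum>j\<in>UNIV. coroot_row A w k j * lam j)"
proof (induction w arbitrary: k)
  case Nil
  have "(\<Sum>j\<in>UNIV. (if j = k then 1 else 0) * lam j) = lam k"
    by (simp add: if_distrib [of "\<lambda>x. x * _"] cong: if_cong)
  then show ?case by (simp add: weyl_weight_def coroot_pairing_def)
next
  case (Cons i w)
  show ?case
    unfolding weyl_weight_Cons Cons
    by (simp add: left_diff_distrib sum_subtractf sum_distrib_left mult.assoc)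
qed

text \<open>Reflections in the nodes of \<open>J\<close> preserve the span of the simple coroots of \<open>J\<close>.\<close>

lemma coroot_row_support:
  "set w \<subseteq> J \<Longrightarrow> k \<in> J \<Longrightarrow> j \<notin> J \<Longrightarrow> coroot_row A w k j = 0"
  by (induction w arbitrary: k) auto

text \<open>The invariant symmetric form on coroots, normalised so that the simple coroot of \<open>k\<close> has square
  length \<open>2 / d k\<close>.\<close>

definition coroot_form ::
    "('i::finite \<Rightarrow> 'i \<Rightarrow> int) \<Rightarrow> ('i \<Rightarrow> nat) \<Rightarrow> ('i \<Rightarrow> int) \<Rightarrow> ('i \<Rightarrow> int) \<Rightarrow> real" where
  "coroot_form A d g h = (\<Sum>k\<in>UNIV. \<Sum>l\<in>UNIV. g k * h l * (A k l / d l))"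

lemma coroot_form_diff:
  "coroot_form A d (\<lambda>j. g j - c * g' j) h = coroot_form A d g h - c * coroot_form A d g' h"
  "coroot_form A d h (\<lambda>j. g j - c * g' j) = coroot_form A d h g - c * coroot_form A d h g'"
  by (simp_all add: coroot_form_def sum_subtractf sum_distrib_left algebra_simps diff_divide_distrib)

lemma coroot_form_basis:
  "coroot_form A d (\<lambda>j. if j = k then 1 else 0) (\<lambda>j. if j = l then 1 else 0) = A k l / d l"
proof -
  have "(\<Sum>b\<in>UNIV. real_of_int (if a = k then 1 else 0) * real_of_int (if b = l then 1 else 0) * (A a b / d b))
      = (\<Sum>b\<in>UNIV. if b = l then (if a = k then A k l / d l else 0) else 0)" for a
    by (intro sum.cong) auto
  then show ?thesis by (simp add: coroot_form_def)
qed

lemma coroot_form_invariant: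
  assumes diag: "\<And>i. A i i = 2" and sym: "symmetrizer A d"
  shows "coroot_form A d (coroot_row A w k) (coroot_row A w l) = A k l / d l"
proof (induction w arbitrary: k l)
  case Nil
  show ?case using coroot_form_basis [of A d k l] by (simp add: fun_eq_iff [symmetric])
next
  case (Cons i w)
  have swap: "A i l / d l = A l i / d i" for l
  proof -
    have "int (d i) * A i l = int (d l) * A l i" "d i > 0" "d l > 0" using sym by (auto simp: symmetrizer_def)
    then have "real (d i) * A i l = real (d l) * A l i" by (metis of_int_mult of_int_of_nat_eq)
    then show ?thesis using \<open>d i > 0\<close> \<open>d l > 0\<close> by (simp add: field_simps)
  qed
  have row: "coroot_row A (i # w) k = (\<lambda>j. coroot_row A w k j - A k i * coroot_row A w i j)" for k
    by (simp add: fun_eq_iff)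
  have "coroot_form A d (coroot_row A (i # w) k) (coroot_row A (i # w) l)
     = A k l / d l - A k i * (A i l / d l) - A l i * (A k i / d i - A k i * (A i i / d i))"
    unfolding row coroot_form_diff Cons by (simp add: algebra_simps)
  also have "\<dots> = A k l / d l"
    unfolding swap diag by (simp add: algebra_simps)
  finally show ?case .
qed

text \<open>Dually to \<open>-w \<varpi>\<^sub>a = \<varpi>\<^bsub>dual a\<^esub>\<close>, the inverse of \<open>-w\<close> maps the simple coroot of \<open>i\<close> to the sum of those
  of the nodes \<open>a\<close> with \<open>dual a = i\<close>. This sum cannot be empty as the form is invariant, so \<open>dual\<close> is
  onto and therefore a permutation of the finite set of nodes, the sum has exactly one term, and
  comparing square lengths gives \<open>2 / d (dual r) = 2 / d r\<close>.\<close>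

lemma dual_symmetrizer:
  fixes A :: "'i::finite \<Rightarrow> 'i \<Rightarrow> int"
  assumes diag: "\<And>i. A i i = 2" and sym: "symmetrizer A d" and w: "set w \<subseteq> - {i0}"
    and dual: "\<And>a. a \<noteq> i0 \<Longrightarrow> dual a \<noteq> i0 \<and>
      (\<forall>i. - weyl_weight A (level_zero_weight A i0 a) w i = level_zero_weight A i0 (dual a) i)"
    and r: "r \<noteq> i0"
  shows "d (dual r) = d r"
proof -
  have row: "coroot_row A w i a = (if i = dual a then - 1 else 0)" if "i \<noteq> i0" "a \<noteq> i0" for i a
  proof -
    have "coroot_row A w i i0 = 0"
      using coroot_row_support [OF w, of i i0] that by simp
    then have "weyl_weight A (level_zero_weight A i0 a) w i
        = (\<Sum>j\<in>UNIV. if j = a then coroot_row A w i a else 0)"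
      unfolding weyl_weight_coroot_row using that(2)
      by (intro sum.cong) (auto simp: level_zero_weight_def)
    moreover have "- weyl_weight A (level_zero_weight A i0 a) w i = level_zero_weight A i0 (dual a) i"
      using dual [OF that(2)] by blast
    ultimately show ?thesis using that(1) by (cases "i = dual a") (simp_all add: level_zero_weight_def)
  qed
  have form: "coroot_form A d (coroot_row A w i) (coroot_row A w i) = 2 / d i" for i
    using coroot_form_invariant [OF diag sym] diag by simp
  have "i \<in> dual ` (- {i0})" if "i \<noteq> i0" for i
  proof (rule ccontr)
    assume "i \<notin> dual ` (- {i0})"
    then have "coroot_row A w i j = 0" for j
      using row [OF that, of j] coroot_row_support [OF w, of i j] that by (cases "j = i0") auto
    then have "coroot_form A d (coroot_row A w i) (coroot_row A w i) = 0" by (simp add: coroot_form_def)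
    moreover have "0 < d i" using sym by (simp add: symmetrizer_def)
    ultimately show False using form [of i] by simp
  qed
  then have "dual ` (- {i0}) = - {i0}" using dual by blast
  then have inj: "inj_on dual (- {i0})" by (intro eq_card_imp_inj_on) auto
  \<comment> \<open>A difference of the shape expected by \<open>coroot_form_diff\<close>: the row is minus a simple coroot.\<close>
  have "coroot_row A w (dual r) j = (if j = r then 0 else 0) - 1 * (if j = r then 1 else 0)" for j
    using row [of "dual r" j] coroot_row_support [OF w, of "dual r" j] dual [OF r] r inj_onD [OF inj, of r j]
    by (cases "j = i0") auto
  then have "coroot_row A w (dual r) = (\<lambda>j. 0 - 1 * (if j = r then 1 else 0))" by (auto simp: fun_eq_iff)
  then have "coroot_form A d (coroot_row A w (dual r)) (coroot_row A w (dual r)) = A r r / d r"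
    by (simp only: coroot_form_diff coroot_form_basis) (simp add: coroot_form_def)
  then have "2 / d (dual r) = 2 / d r" using form diag by simp
  then show ?thesis using sym by (simp add: symmetrizer_def)
qed

section \<open>Fusing the two blocks\<close>

lemma qpar_nonzero: "qpar d i \<noteq> 0"
proof -
  have "qvar \<noteq> 0" by (simp add: qvar_def Zero_fract_def eq_fract)
  then show ?thesis by (simp add: qpar_def)
qed

lemma KR_source_nonzero: "KR_source_param d a n i \<noteq> 0"
  by (simp add: KR_source_param_def qpar_nonzero)

lemma inverse_KR_source:
  assumes "k \<le> n"
  shows "inverse (KR_source_param d a n (n + 1 - k)) = KR_source_param d a n k"
proof -
  have "int n - 2 * int (n + 1 - k) + 1 = - (int n - 2 * int k + 1)"
    using assms by (simp add: of_nat_diff)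
  then show ?thesis unfolding KR_source_param_def by (simp only: power_int_minus inverse_inverse_eq)
qed

lemma KR_param_source:
  assumes "k \<le> n"
  shows "KR_param d a n x k = KR_source_param d a n (n + 1 - k) * x"
proof -
  have "- int n + 2 * int k - 1 = int n - 2 * int (n + 1 - k) + 1"
    using assms by (simp add: of_nat_diff)
  then show ?thesis unfolding KR_source_param_def KR_param_def by (simp only:)
qed

lemma KR_param_inverse:
  assumes "k \<le> n" "d b = d a"
  shows "KR_param d b n (inverse x) k = inverse (KR_source_param d a n k * x)"
proof -
  have "KR_param d b n (inverse x) k = KR_source_param d a n (n + 1 - k) * inverse x"
    using KR_param_source [OF assms(1), of d b "inverse x"] assms(2)
    by (simp add: KR_source_param_def qpar_def)
  then show ?thesis
    using inverse_KR_source [OF assms(1), of d a] by (metis inverse_inverse_eq inverse_mult_distrib)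
qed

lemma KR_defined_Rdef:
  assumes "KR_defined d Rm a n" "z \<noteq> 0" "1 \<le> k" "k < j" "j \<le> n"
  shows "Rdef Rm a a (KR_param d a n z j) (KR_param d a n z k)"
proof -
  have "1 \<le> n + 1 - j \<and> n + 1 - j < n + 1 - k \<and> n + 1 - k \<le> n" using assms by auto
  then have "Rdef Rm a a (KR_source_param d a n (n + 1 - j)) (KR_source_param d a n (n + 1 - k))"
    using assms(1) unfolding KR_defined_def by blast
  moreover have "KR_param d a n z j / KR_param d a n z k
      = KR_source_param d a n (n + 1 - j) / KR_source_param d a n (n + 1 - k)"
    using assms by (simp add: KR_param_source del: One_nat_def)
  ultimately show ?thesis unfolding Rdef_def by simp
qed

text \<open>The fused K-matrix asks for values of R at \<open>1 / (x\<^sub>i x\<^sub>j)\<close> for \<open>i < j\<close> only; as this is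
  symmetric in \<open>i\<close> and \<open>j\<close>, it covers both orders.\<close>

lemma KR_K_defined_Rdef:
  assumes K: "KR_K_defined star d Rm Km a n z" and d: "d (star a) = d a" and z: "z \<noteq> 0"
    and i: "1 \<le> i" "i \<le> n" and k: "1 \<le> k" "k \<le> n" and ne: "i + k \<noteq> n + 1"
  shows "Rdef Rm (star a) a (KR_param d (star a) n (inverse z) i) (KR_param d a n z k)"
proof -
  have def: "Rdef Rm (star a) a (inverse (KR_param d a n z p)) (KR_param d a n z q)"
    if "1 \<le> p" "p < q" "q \<le> n" for p q
  proof -
    have "int n - 2 * int q + 2 * int (q - p) + 1 = - (- int n + 2 * int p - 1)"
      using that by (simp add: of_nat_diff)
    then have "K_param d a n z q (q - p) = inverse (KR_param d a n z p)"
      unfolding K_param_def KR_param_def by (simp only: power_int_minus inverse_mult_distrib)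
    moreover have "Rdef Rm (star a) a (K_param d a n z q (q - p)) (KR_param d a n z q)"
      using K that unfolding KR_K_defined_def by auto
    ultimately show ?thesis by simp
  qed
  let ?p = "n + 1 - i"
  have p: "KR_param d (star a) n (inverse z) i = inverse (KR_param d a n z ?p)"
    using KR_param_inverse [of i n d "star a" a z, OF i(2) d] KR_param_source [of ?p n d a z] i by simp
  consider "?p < k" | "k < ?p" using ne i by linarith
  then show ?thesis
  proof cases
    case 1
    then show ?thesis unfolding p using def [of ?p k] i k by simp
  next
    case 2
    then have "Rdef Rm (star a) a (inverse (KR_param d a n z k)) (KR_param d a n z ?p)"
      using def [of k ?p] i k by simp
    then show ?thesis unfolding p Rdef_def by (simp add: field_simps)
  qed
qed

lemma quantum_R_matrices_carrier:
  "quantum_R_matrices i0 J M Rm \<Longrightarrow> a \<in> J \<Longrightarrow> b \<in> J \<Longrightarrow>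
    Rval Rm a b p q \<in> carrier_mat (mdim (M b) * mdim (M a)) (mdim (M a) * mdim (M b))"
  unfolding quantum_R_matrices_def Rval_def mat_eval_def by simp

lemma quantum_R_matrices_yang_baxter:
  "quantum_R_matrices i0 J M Rm \<Longrightarrow> a \<in> J \<Longrightarrow> b \<in> J \<Longrightarrow> c \<in> J \<Longrightarrow>
    p \<noteq> 0 \<Longrightarrow> q \<noteq> 0 \<Longrightarrow> z \<noteq> 0 \<Longrightarrow> Rdef Rm a b p q \<Longrightarrow> Rdef Rm a c p z \<Longrightarrow> Rdef Rm b c q z \<Longrightarrow>
    kron (Rval Rm b c q z) (1\<^sub>m (mdim (M a))) * kron (1\<^sub>m (mdim (M b))) (Rval Rm a c p z)
      * kron (Rval Rm a b p q) (1\<^sub>m (mdim (M c)))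
    = kron (1\<^sub>m (mdim (M c))) (Rval Rm a b p q) * kron (Rval Rm a c p z) (1\<^sub>m (mdim (M b)))
      * kron (1\<^sub>m (mdim (M a))) (Rval Rm b c q z)"
  unfolding quantum_R_matrices_def by blast

lemma quantum_K_matrices_carrier:
  "quantum_K_matrices star J M Rm Km \<Longrightarrow> a \<in> J \<Longrightarrow>
    Kval Km a p \<in> carrier_mat (mdim (M (star a))) (mdim (M a))"
  unfolding quantum_K_matrices_def Kval_def mat_eval_def by simp

lemma quantum_K_matrices_reflection:
  "quantum_K_matrices star J M Rm Km \<Longrightarrow> a \<in> J \<Longrightarrow> b \<in> J \<Longrightarrow> p \<noteq> 0 \<Longrightarrow> q \<noteq> 0 \<Longrightarrow>
    Kdef Km a p \<Longrightarrow> Kdef Km b q \<Longrightarrow> Rdef Rm a b p q \<Longrightarrow> Rdef Rm (star b) a (inverse q) p \<Longrightarrow>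
    Rdef Rm (star a) b (inverse p) q \<Longrightarrow> Rdef Rm (star b) (star a) (inverse q) (inverse p) \<Longrightarrow>
    Rval Rm (star b) (star a) (inverse q) (inverse p) * kron (Kval Km b q) (1\<^sub>m (mdim (M (star a))))
      * Rval Rm (star a) b (inverse p) q * kron (Kval Km a p) (1\<^sub>m (mdim (M b)))
    = kron (Kval Km a p) (1\<^sub>m (mdim (M (star b)))) * Rval Rm (star b) a (inverse q) p
      * kron (Kval Km b q) (1\<^sub>m (mdim (M a))) * Rval Rm a b p q"
  unfolding quantum_K_matrices_def by blast

text \<open>Two blocks of tensor factors, the first with spectral variable \<open>x\<close> and the second with \<open>y\<close>. Either
  block may be empty.\<close>

locale KR_pair =
  fixes i0 :: 'i and d :: "'i \<Rightarrow> nat" and M :: "'i \<Rightarrow> 'i umodule" and Rm :: "'i \<Rightarrow> 'i \<Rightarrow> ratmat"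
    and Km :: "'i \<Rightarrow> ratmat" and star :: "'i \<Rightarrow> 'i" and r r' :: 'i and s t :: nat and x y :: Cq
  assumes R_matrices: "quantum_R_matrices i0 {r, r', star r, star r'} M Rm"
    and K_matrices: "quantum_K_matrices star {r, r'} M Rm Km"
    and d_star: "d (star r) = d r" "d (star r') = d r'"
    and nonzero: "x \<noteq> 0" "y \<noteq> 0"
    and KR_def: "KR_defined d Rm r s" "KR_defined d Rm (star r) s"
      "KR_defined d Rm r' t" "KR_defined d Rm (star r') t"
    and K_def: "KR_K_defined star d Rm Km r s x" "KR_K_defined star d Rm Km r' t y"
    and R_def: "fused_R_defined d Rm r s r' t x y" "fused_R_defined d Rm (star r') t r s (inverse y) x"
      "fused_R_defined d Rm (star r) s r' t (inverse x) y"
      "fused_R_defined d Rm (star r') t (star r) s (inverse y) (inverse x)"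
begin

text \<open>The letters \<open>1, \<dots>, s\<close> form the first block and \<open>s+1, \<dots>, s+t\<close> the second. They are numbered in the
  order of the source of \<open>R\<^sub>s\<close>, so the reversed block, on which the Kirillov-Reshetikhin module lives, has
  its parameters in the order of \<open>KR_param\<close>.\<close>

definition Lab :: "int set" where
  "Lab = {u. u \<noteq> 0 \<and> \<bar>u\<bar> \<le> int (s + t)}"

definition pos_node :: "int \<Rightarrow> 'i" where
  "pos_node u = (if u \<le> int s then r else r')"

definition pos_par :: "int \<Rightarrow> Cq" where
  "pos_par u = (if u \<le> int s then KR_source_param d r s (nat u) * x
                else KR_source_param d r' t (nat u - s) * y)"

definition node :: "int \<Rightarrow> 'i" where
  "node u = (if 0 < u then pos_node u else star (pos_node (- u)))"

definition par :: "int \<Rightarrow> Cq" where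
  "par u = (if 0 < u then pos_par u else inverse (pos_par (- u)))"

lemma par_nonzero: "par u \<noteq> 0"
  using nonzero by (simp add: par_def pos_par_def KR_source_nonzero)

lemma node_in: "node u \<in> {r, r', star r, star r'}"
  by (auto simp: node_def pos_node_def)

lemma X_pos: "i \<in> {1..s} \<Longrightarrow> node (int i) = r" "i \<in> {1..s} \<Longrightarrow> par (int i) = KR_source_param d r s i * x"
  by (auto simp: node_def pos_node_def par_def pos_par_def)

lemma X_neg: "i \<in> {1..s} \<Longrightarrow> node (- int i) = star r"
    "i \<in> {1..s} \<Longrightarrow> par (- int i) = KR_param d (star r) s (inverse x) i"
  using KR_param_inverse [of i s d "star r" r x] d_star
  by (auto simp: node_def pos_node_def par_def pos_par_def)

lemma Y_pos: "j \<in> {1..t} \<Longrightarrow> node (int (s + j)) = r'"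
    "j \<in> {1..t} \<Longrightarrow> par (int (s + j)) = KR_source_param d r' t j * y"
  by (auto simp: node_def pos_node_def par_def pos_par_def nat_add_distrib)

lemma Y_neg: "j \<in> {1..t} \<Longrightarrow> node (- int (s + j)) = star r'"
    "j \<in> {1..t} \<Longrightarrow> par (- int (s + j)) = KR_param d (star r') t (inverse y) j"
  using KR_param_inverse [of j t d "star r'" r' y] d_star
  by (auto simp: node_def pos_node_def par_def pos_par_def nat_add_distrib)

lemma source_param: "i \<in> {1..n} \<Longrightarrow> KR_source_param d a n i * z = KR_param d a n z (n + 1 - i)"
  by (subst KR_param_source) auto

lemma Lab_cases:
  assumes "u \<in> Lab"
  obtains (Xp) i where "i \<in> {1..s}" "u = int i" "node u = r" "par u = KR_param d r s x (s + 1 - i)"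
  | (Xn) i where "i \<in> {1..s}" "u = - int i" "node u = star r" "par u = KR_param d (star r) s (inverse x) i"
  | (Yp) j where "j \<in> {1..t}" "u = int (s + j)" "node u = r'" "par u = KR_param d r' t y (t + 1 - j)"
  | (Yn) j where "j \<in> {1..t}" "u = - int (s + j)" "node u = star r'" "par u = KR_param d (star r') t (inverse y) j"
proof -
  define m where "m = nat \<bar>u\<bar>"
  have m: "1 \<le> m" "m \<le> s + t" "u = int m \<or> u = - int m" using assms by (auto simp: Lab_def m_def)
  show ?thesis
  proof (cases "m \<le> s")
    case True
    then have i: "m \<in> {1..s}" using m by simp
    from m(3) show ?thesis
    proof
      assume "u = int m"
      then show ?thesis using i X_pos [OF i] source_param [OF i] that(1) by simp
    next
      assume "u = - int m"
      then show ?thesis using i X_neg [OF i] that(2) by simp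
    qed
  next
    case False
    define j where "j = m - s"
    have j: "j \<in> {1..t}" "m = s + j" using False m by (auto simp: j_def)
    from m(3) show ?thesis
    proof
      assume "u = int m"
      then show ?thesis using j Y_pos [OF j(1)] source_param [OF j(1)] that(3) by simp
    next
      assume "u = - int m"
      then show ?thesis using j Y_neg [OF j(1)] that(4) by simp
    qed
  qed
qed

lemma fused_Rdef:
  "fused_R_defined d Rm a m b n z z' \<Longrightarrow> k \<in> {1..m} \<Longrightarrow> j \<in> {1..n} \<Longrightarrow>
    Rdef Rm a b (KR_param d a m z k) (KR_param d b n z' j)"
  by (auto simp: fused_R_defined_def)

text \<open>Whatever pair of letters is exchanged, the definedness of one of the maps in the theorem covers the
  value of R that is needed: that of \<open>R\<^sub>s\<close> for two letters of the same block and sign, that of the fused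
  K-matrix for the same block and opposite signs, and that of one of the four fused R-matrices for
  different blocks.\<close>

lemma Rdef_labels:
  assumes "u \<in> Lab" "v \<in> Lab" "u < v" "\<bar>u\<bar> \<noteq> \<bar>v\<bar>"
  shows "Rdef Rm (node u) (node v) (par u) (par v)"
proof -
  have rev: "n + 1 - i \<in> {1..n}" if "i \<in> {1..n}" for i n :: nat using that by auto
  have inv: "inverse x \<noteq> 0" "inverse y \<noteq> 0" using nonzero by auto
  show ?thesis
    using assms(1)
  proof (cases rule: Lab_cases)
    case U: (Xp i)
    show ?thesis
      using assms(2)
    proof (cases rule: Lab_cases)
      case (Xp j)
      then show ?thesis
        using KR_defined_Rdef [OF KR_def(1) nonzero(1), of "s + 1 - j" "s + 1 - i"] U assms(3) by auto
    next
      case (Yp j)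
      then show ?thesis using fused_Rdef [OF R_def(1) rev [OF U(1)] rev [OF Yp(1)]] U by simp
    qed (use U assms(3) in auto)
  next
    case U: (Xn i)
    show ?thesis
      using assms(2)
    proof (cases rule: Lab_cases)
      case (Xp j)
      then show ?thesis
        using KR_K_defined_Rdef [OF K_def(1) d_star(1) nonzero(1), of i "s + 1 - j"] U assms(4) by auto
    next
      case (Xn j)
      then show ?thesis
        using KR_defined_Rdef [OF KR_def(2) inv(1), of j i] U assms(3) by auto
    next
      case (Yp j)
      then show ?thesis using fused_Rdef [OF R_def(3) U(1) rev [OF Yp(1)]] U by simp
    qed (use U assms(3) in auto)
  next
    case U: (Yp i)
    show ?thesis
      using assms(2)
    proof (cases rule: Lab_cases)
      case (Yp j)
      then show ?thesis
        using KR_defined_Rdef [OF KR_def(3) nonzero(2), of "t + 1 - j" "t + 1 - i"] U assms(3) by auto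
    qed (use U assms(3) in auto)
  next
    case U: (Yn i)
    show ?thesis
      using assms(2)
    proof (cases rule: Lab_cases)
      case (Xp j)
      then show ?thesis using fused_Rdef [OF R_def(2) U(1) rev [OF Xp(1)]] U by simp
    next
      case (Xn j)
      then show ?thesis using fused_Rdef [OF R_def(4) U(1) Xn(1)] U by simp
    next
      case (Yp j)
      then show ?thesis
        using KR_K_defined_Rdef [OF K_def(2) d_star(2) nonzero(2), of i "t + 1 - j"] U assms(4) by auto
    next
      case (Yn j)
      then show ?thesis
        using KR_defined_Rdef [OF KR_def(4) inv(2), of j i] U assms(3) by auto
    qed
  qed
qed

lemma Kdef_labels:
  assumes "u \<in> Lab" "0 < u"
  shows "node u \<in> {r, r'}" "Kdef Km (node u) (par u)"
proof -
  have "node u \<in> {r, r'} \<and> Kdef Km (node u) (par u)"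
    using assms(1)
  proof (cases rule: Lab_cases)
    case (Xp i)
    then have "s + 1 - i \<in> {1..s}" by auto
    then show ?thesis using K_def(1) Xp unfolding KR_K_defined_def by simp
  next
    case (Yp j)
    then have "t + 1 - j \<in> {1..t}" by auto
    then show ?thesis using K_def(2) Yp unfolding KR_K_defined_def by simp
  qed (use assms(2) in auto)
  then show "node u \<in> {r, r'}" "Kdef Km (node u) (par u)" by auto
qed

sublocale coloured_fundamental Lab M Rm Km node par star
proof
  show "0 \<notin> Lab" by (simp add: Lab_def)
  show "- u \<in> Lab" if "u \<in> Lab" for u using that by (simp add: Lab_def)
  show "Rval Rm (node u) (node v) (par u) (par v)
      \<in> carrier_mat (mdim (M (node v)) * mdim (M (node u))) (mdim (M (node u)) * mdim (M (node v)))" for u v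
    using quantum_R_matrices_carrier [OF R_matrices node_in node_in] .
  show star: "node (- u) = star (node u)" "par (- u) = inverse (par u)" if "u \<in> Lab" "0 < u" for u
    using that by (auto simp: node_def par_def)
  show "Kval Km (node u) (par u) \<in> carrier_mat (mdim (M (node (- u)))) (mdim (M (node u)))"
    if "u \<in> Lab" "0 < u" for u
    using quantum_K_matrices_carrier [OF K_matrices Kdef_labels(1) [OF that]] star [OF that] by simp
  show "kron (Rval Rm (node v) (node w) (par v) (par w)) (1\<^sub>m (mdim (M (node u))))
      * kron (1\<^sub>m (mdim (M (node v)))) (Rval Rm (node u) (node w) (par u) (par w))
      * kron (Rval Rm (node u) (node v) (par u) (par v)) (1\<^sub>m (mdim (M (node w))))
    = kron (1\<^sub>m (mdim (M (node w)))) (Rval Rm (node u) (node v) (par u) (par v))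
      * kron (Rval Rm (node u) (node w) (par u) (par w)) (1\<^sub>m (mdim (M (node v))))
      * kron (1\<^sub>m (mdim (M (node u)))) (Rval Rm (node v) (node w) (par v) (par w))"
    if "u \<in> Lab" "v \<in> Lab" "w \<in> Lab" "u < v" "v < w" "distinct [\<bar>u\<bar>, \<bar>v\<bar>, \<bar>w\<bar>]" for u v w
  proof -
    have "Rdef Rm (node u) (node v) (par u) (par v)" "Rdef Rm (node u) (node w) (par u) (par w)"
        "Rdef Rm (node v) (node w) (par v) (par w)"
      using that by (auto intro!: Rdef_labels)
    then show ?thesis
      by (rule quantum_R_matrices_yang_baxter [OF R_matrices node_in node_in node_in
            par_nonzero par_nonzero par_nonzero])
  qed
  show "Rval Rm (node (- v)) (node (- u)) (par (- v)) (par (- u))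
      * kron (Kval Km (node v) (par v)) (1\<^sub>m (mdim (M (node (- u)))))
      * Rval Rm (node (- u)) (node v) (par (- u)) (par v)
      * kron (Kval Km (node u) (par u)) (1\<^sub>m (mdim (M (node v))))
    = kron (Kval Km (node u) (par u)) (1\<^sub>m (mdim (M (node (- v)))))
      * Rval Rm (node (- v)) (node u) (par (- v)) (par u)
      * kron (Kval Km (node v) (par v)) (1\<^sub>m (mdim (M (node u))))
      * Rval Rm (node u) (node v) (par u) (par v)"
    if "u \<in> Lab" "v \<in> Lab" "0 < u" "u < v" for u v
  proof -
    have v: "0 < v" using that by simp
    have neg: "- u \<in> Lab" "- v \<in> Lab" using that by (auto simp: Lab_def)
    have "Rdef Rm (node u) (node v) (par u) (par v)" "Rdef Rm (node (- v)) (node u) (par (- v)) (par u)"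
        "Rdef Rm (node (- u)) (node v) (par (- u)) (par v)"
        "Rdef Rm (node (- v)) (node (- u)) (par (- v)) (par (- u))"
      using that neg by (auto intro!: Rdef_labels)
    then show ?thesis
      using quantum_K_matrices_reflection [OF K_matrices Kdef_labels(1) [OF that(1,3)] Kdef_labels(1) [OF that(2) v]
        par_nonzero par_nonzero Kdef_labels(2) [OF that(1,3)] Kdef_labels(2) [OF that(2) v]]
      unfolding star [OF that(1,3)] star [OF that(2) v] by blast
  qed
qed

end

lemma rev_map_upt: "rev (map f [1..<Suc n]) = map (\<lambda>i. f (n + 1 - i)) [1..<Suc n]"
proof (rule nth_equalityI)
  fix k assume "k < length (rev (map f [1..<Suc n]))"
  then have k: "k < n" by (simp del: upt_Suc)
  have len: "length (map f [1..<Suc n]) = n" by simp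
  have "rev (map f [1..<Suc n]) ! k = map f [1..<Suc n] ! (n - Suc k)"
    using k rev_nth [of k "map f [1..<Suc n]"] unfolding len by simp
  also have "\<dots> = f (n + 1 - Suc k)" using k by (simp add: Suc_diff_Suc del: upt_Suc)
  also have "\<dots> = map (\<lambda>i. f (n + 1 - i)) [1..<Suc n] ! k" using k by (simp del: upt_Suc)
  finally show "rev (map f [1..<Suc n]) ! k = map (\<lambda>i. f (n + 1 - i)) [1..<Suc n] ! k" .
qed simp

context KR_pair
begin

definition XS :: "int list" where "XS = map int [1..<Suc s]"
definition YS :: "int list" where "YS = map (\<lambda>j. int (s + j)) [1..<Suc t]"
definition NX :: "int list" where "NX = map (\<lambda>i. - int i) [1..<Suc s]"
definition NY :: "int list" where "NY = map (\<lambda>j. - int (s + j)) [1..<Suc t]"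

lemma map_uminus_rev: "map uminus (rev (rev XS)) = NX" "map uminus (rev XS) = rev NX"
    "map uminus (rev (rev YS)) = NY" "map uminus (rev YS) = rev NY"
  by (simp_all add: XS_def YS_def NX_def NY_def rev_map comp_def del: upt_Suc)

lemma set_lists: "u \<in> set XS \<longleftrightarrow> 1 \<le> u \<and> u \<le> int s" "u \<in> set YS \<longleftrightarrow> int s + 1 \<le> u \<and> u \<le> int (s + t)"
    "u \<in> set NX \<longleftrightarrow> 1 \<le> - u \<and> - u \<le> int s" "u \<in> set NY \<longleftrightarrow> int s + 1 \<le> - u \<and> - u \<le> int (s + t)"
proof -
  show X: "u \<in> set XS \<longleftrightarrow> 1 \<le> u \<and> u \<le> int s" for u
  proof
    assume "1 \<le> u \<and> u \<le> int s"
    then have "u = int (nat u)" "nat u \<in> {1..s}" by auto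
    then show "u \<in> set XS" by (auto simp: XS_def simp del: upt_Suc intro!: image_eqI [of _ _ "nat u"])
  qed (auto simp: XS_def simp del: upt_Suc)
  show Y: "u \<in> set YS \<longleftrightarrow> int s + 1 \<le> u \<and> u \<le> int (s + t)" for u
  proof
    assume "int s + 1 \<le> u \<and> u \<le> int (s + t)"
    then have "u = int (s + nat (u - int s))" "nat (u - int s) \<in> {1..t}" by auto
    then show "u \<in> set YS" by (auto simp: YS_def simp del: upt_Suc intro!: image_eqI [of _ _ "nat (u - int s)"])
  qed (auto simp: YS_def simp del: upt_Suc)
  have "set NX = uminus ` set XS" "set NY = uminus ` set YS"
    by (auto simp: XS_def YS_def NX_def NY_def image_image simp del: upt_Suc)
  moreover have "u \<in> uminus ` A \<longleftrightarrow> - u \<in> A" for A by force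
  ultimately show "u \<in> set NX \<longleftrightarrow> 1 \<le> - u \<and> - u \<le> int s" "u \<in> set NY \<longleftrightarrow> int s + 1 \<le> - u \<and> - u \<le> int (s + t)"
    using X Y by auto
qed

lemma valid_XY: "valid (XS @ YS)"
proof -
  have "map abs XS = XS" "map abs YS = YS" by (simp_all add: XS_def YS_def del: upt_Suc)
  moreover have "distinct XS" "distinct YS"
    by (simp_all add: XS_def YS_def distinct_map inj_on_def del: upt_Suc)
  moreover have "set (XS @ YS) \<subseteq> Lab" by (auto simp: set_lists Lab_def)
  ultimately show ?thesis by (auto simp: valid_def set_lists)
qed

lemma valid_NXY: "valid (rev NX @ rev NY)" "valid (rev NX @ YS)"
proof -
  have "map abs NX = XS" "map abs NY = YS" "map abs YS = YS"
    by (simp_all add: XS_def YS_def NX_def NY_def comp_def del: upt_Suc)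
  moreover have "distinct XS" "distinct YS"
    by (simp_all add: XS_def YS_def distinct_map inj_on_def del: upt_Suc)
  moreover have "set (rev NX @ rev NY) \<subseteq> Lab" "set (rev NX @ YS) \<subseteq> Lab"
    by (auto simp: set_lists Lab_def)
  ultimately show "valid (rev NX @ rev NY)" "valid (rev NX @ YS)"
    by (auto simp: valid_def set_lists simp flip: rev_map)
qed

lemma coloured_lists:
  "coloured_block r (KR_param d r s x) s (rev XS)" "coloured_block r' (KR_param d r' t y) t (rev YS)"
  "coloured_block (star r) (KR_param d (star r) s (inverse x)) s NX"
  "coloured_block (star r') (KR_param d (star r') t (inverse y)) t NY"
proof -
  have colour: "coloured_block a p n (map lab [1..<Suc n])"
    if "\<And>i. i \<in> {1..n} \<Longrightarrow> node (lab i) = a" "\<And>i. i \<in> {1..n} \<Longrightarrow> par (lab i) = p i" for a p n lab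
    using that by (simp add: coloured_block_def del: upt_Suc)
  have flip: "n + 1 - i \<in> {1..n}" "KR_source_param d a n (n + 1 - i) * z = KR_param d a n z i"
    if "i \<in> {1..n}" for n i a z
    using that KR_param_source [of i n d a z] by auto
  show "coloured_block r (KR_param d r s x) s (rev XS)"
    unfolding XS_def rev_map_upt by (rule colour; simp only: X_pos flip)
  show "coloured_block r' (KR_param d r' t y) t (rev YS)"
    unfolding YS_def rev_map_upt by (rule colour; simp only: Y_pos flip)
  show "coloured_block (star r) (KR_param d (star r) s (inverse x)) s NX"
    unfolding NX_def by (rule colour; simp only: X_neg)
  show "coloured_block (star r') (KR_param d (star r') t (inverse y)) t NY"
    unfolding NY_def by (rule colour; simp only: Y_neg)
qed

lemma dimL_rev: "dimL (rev L) = dimL L"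
  by (induction L) auto

lemma dimL_lists:
  "dimL XS = KR_dim M r s" "dimL YS = KR_dim M r' t"
  "dimL NX = KR_dim M (star r) s" "dimL NY = KR_dim M (star r') t"
  using dimL_coloured(1) [OF coloured_lists(1)] dimL_coloured(1) [OF coloured_lists(2)]
    dimL_coloured(1) [OF coloured_lists(3)] dimL_coloured(1) [OF coloured_lists(4)]
  by (simp_all add: KR_dim_def dimL_rev)

lemma path_KR_R_lists:
  "path False XS (rev XS) (KR_R d M Rm r s)" "path False YS (rev YS) (KR_R d M Rm r' t)"
  "path False (rev NX) NX (KR_R d M Rm (star r) s)" "path False (rev NY) NY (KR_R d M Rm (star r') t)"
proof -
  have inv: "inverse x \<noteq> 0" "inverse y \<noteq> 0" using nonzero by auto
  have flip: "n + 1 - i \<in> {1..n}" "KR_param d a n z (n + 1 - i) = KR_source_param d a n i * z"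
    if "i \<in> {1..n}" for n i a z
    using that source_param [OF that, of a z] by auto
  have v: "valid XS" "valid YS" "valid (rev NX)" "valid (rev NY)"
    using valid_append [OF valid_XY] valid_append [OF valid_NXY(1)] by auto
  have XS: "XS = map int [1..<Suc s]" and YS: "YS = map (\<lambda>j. int (s + j)) [1..<Suc t]"
    by (rule XS_def, rule YS_def)
  have NX: "rev NX = map (\<lambda>i. - int (s + 1 - i)) [1..<Suc s]"
    and NY: "rev NY = map (\<lambda>j. - int (s + (t + 1 - j))) [1..<Suc t]"
    unfolding NX_def NY_def by (rule rev_map_upt)+
  show "path False XS (rev XS) (KR_R d M Rm r s)"
    unfolding XS
    by (rule path_KR_R) (use nonzero v(1) XS in \<open>simp_all only: X_pos mult_divide_mult_cancel_right\<close>,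
        auto intro: strict_mono_onI)
  show "path False YS (rev YS) (KR_R d M Rm r' t)"
    unfolding YS
    by (rule path_KR_R) (use nonzero v(2) YS in \<open>simp_all only: Y_pos mult_divide_mult_cancel_right\<close>,
        auto intro: strict_mono_onI)
  have "path False (rev NX) (rev (rev NX)) (KR_R d M Rm (star r) s)"
    unfolding NX
    by (rule path_KR_R) (use inv v(3) NX in \<open>simp_all only: X_neg flip mult_divide_mult_cancel_right\<close>,
        auto intro: strict_mono_onI)
  then show "path False (rev NX) NX (KR_R d M Rm (star r) s)" by simp
  have "path False (rev NY) (rev (rev NY)) (KR_R d M Rm (star r') t)"
    unfolding NY
    by (rule path_KR_R) (use inv v(4) NY in \<open>simp_all only: Y_neg flip mult_divide_mult_cancel_right\<close>,
        auto intro: strict_mono_onI)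
  then show "path False (rev NY) NY (KR_R d M Rm (star r') t)" by simp
qed

lemma KR_R_carrier:
  "KR_R d M Rm r s \<in> carrier_mat (KR_dim M r s) (KR_dim M r s)"
  "KR_R d M Rm r' t \<in> carrier_mat (KR_dim M r' t) (KR_dim M r' t)"
  "KR_R d M Rm (star r) s \<in> carrier_mat (KR_dim M (star r) s) (KR_dim M (star r) s)"
  "KR_R d M Rm (star r') t \<in> carrier_mat (KR_dim M (star r') t) (KR_dim M (star r') t)"
  using path_carrier [OF path_KR_R_lists(1)] path_carrier [OF path_KR_R_lists(2)]
    path_carrier [OF path_KR_R_lists(3)] path_carrier [OF path_KR_R_lists(4)]
    valid_append [OF valid_XY] valid_append [OF valid_NXY(1)]
  by (simp_all add: dimL_rev dimL_lists)

lemma path_KR_K_lists: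
  "path True (rev XS) NX (KR_K star d M Rm Km r s x)" "path True (rev YS) NY (KR_K star d M Rm Km r' t y)"
proof -
  have v: "valid (rev XS)" "valid (rev YS)"
    using path_valid [OF path_KR_R_lists(1)] path_valid [OF path_KR_R_lists(2)] valid_append [OF valid_XY] by auto
  show "path True (rev XS) NX (KR_K star d M Rm Km r s x)"
    using path_KR_K [OF coloured_lists(1) v(1)] unfolding map_uminus_rev by (auto simp: set_lists)
  show "path True (rev YS) NY (KR_K star d M Rm Km r' t y)"
    using path_KR_K [OF coloured_lists(2) v(2)] unfolding map_uminus_rev by (auto simp: set_lists)
qed

lemma KR_K_carrier:
  "KR_K star d M Rm Km r s x \<in> carrier_mat (KR_dim M (star r) s) (KR_dim M r s)"
  using path_carrier [OF path_KR_K_lists(1)] path_valid [OF path_KR_R_lists(1)] valid_append [OF valid_XY]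
  by (simp add: dimL_rev dimL_lists)

text \<open>Both sides are reduced words from \<open>1, \<dots>, s\<close> to \<open>-1, \<dots>, -s\<close>. On the right the signs are changed first,
  along with a reversal, and the reversal is then undone by the operator of the target module.\<close>

lemma KR_K_KR_R:
  "\<exists>P\<in>carrier_mat (KR_dim M (star r) s) (KR_dim M r s).
    KR_K star d M Rm Km r s x * KR_R d M Rm r s = KR_R d M Rm (star r) s * P"
proof -
  have v: "valid XS" using valid_append [OF valid_XY] by simp
  obtain P where P: "path True XS (rev NX) P"
    using ex_path_negate [OF v] unfolding map_uminus_rev by (auto simp: set_lists)
  have "path True XS NX (KR_K star d M Rm Km r s x * KR_R d M Rm r s)"
    by (rule path_trans [OF path_swap_imp [OF path_KR_R_lists(1)] path_KR_K_lists(1) v])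
  moreover have "path True XS NX (KR_R d M Rm (star r) s * P)"
    by (rule path_trans [OF P path_swap_imp [OF path_KR_R_lists(3)] v])
  ultimately have "KR_K star d M Rm Km r s x * KR_R d M Rm r s = KR_R d M Rm (star r) s * P"
    using v by (rule path_unique)
  moreover have "P \<in> carrier_mat (KR_dim M (star r) s) (KR_dim M r s)"
    using path_carrier [OF P v] by (simp add: dimL_rev dimL_lists)
  ultimately show ?thesis by blast
qed

lemma KR_K_maps_KR_module:
  assumes "v \<in> KR_module d M Rm r s"
  shows "KR_K star d M Rm Km r s x *\<^sub>v v \<in> KR_module d M Rm (star r) s"
proof -
  let ?K = "KR_K star d M Rm Km r s x" and ?R = "KR_R d M Rm r s" and ?R' = "KR_R d M Rm (star r) s"
  obtain P where P: "P \<in> carrier_mat (KR_dim M (star r) s) (KR_dim M r s)" "?K * ?R = ?R' * P"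
    using KR_K_KR_R by blast
  obtain z where z: "z \<in> carrier_vec (KR_dim M r s)" "v = ?R *\<^sub>v z"
    using assms KR_R_carrier(1) by (auto simp: KR_module_def image_space_def)
  have "?K *\<^sub>v v = (?K * ?R) *\<^sub>v z"
    using z KR_K_carrier KR_R_carrier(1) by (simp add: assoc_mult_mat_vec)
  also have "\<dots> = ?R' *\<^sub>v (P *\<^sub>v z)"
    unfolding P(2) by (rule assoc_mult_mat_vec [OF KR_R_carrier(3) P(1) z(1)])
  finally show ?thesis
    using KR_R_carrier(3) P(1) z(1) by (auto simp: KR_module_def image_space_def)
qed

abbreviation "KX \<equiv> KR_K star d M Rm Km r s x"
abbreviation "KY \<equiv> KR_K star d M Rm Km r' t y"
abbreviation "RXY \<equiv> kron (KR_R d M Rm r s) (KR_R d M Rm r' t)"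
abbreviation "RXY_star \<equiv> kron (KR_R d M Rm (star r) s) (KR_R d M Rm (star r') t)"
abbreviation "lhs \<equiv> fused_R d M Rm (star r') t (star r) s (inverse y) (inverse x)
    * kron KY (1\<^sub>m (KR_dim M (star r) s))
    * fused_R d M Rm (star r) s r' t (inverse x) y
    * kron KX (1\<^sub>m (KR_dim M r' t))"
abbreviation "rhs \<equiv> kron KX (1\<^sub>m (KR_dim M (star r') t))
    * fused_R d M Rm (star r') t r s (inverse y) x
    * kron KY (1\<^sub>m (KR_dim M r s))
    * fused_R d M Rm r s r' t x y"

lemma path_kron:
  assumes X: "path False X X' S" and Y: "path False Y Y' T" and v: "valid (X @ Y)"
  shows "path True (X @ Y) (X' @ Y') (kron S T)"
proof -
  have vX: "valid X" and vY: "valid Y" using valid_append [OF v] by auto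
  have 1: "path False (X @ Y) (X' @ Y) (kron S (1\<^sub>m (dimL Y)))"
    by (rule path_append_right [OF X vX])
  have 2: "path False (X' @ Y) (X' @ Y') (kron (1\<^sub>m (dimL X')) T)"
    by (rule path_append_left [OF Y vY])
  have "kron (1\<^sub>m (dimL X')) T * kron S (1\<^sub>m (dimL Y)) = kron (1\<^sub>m (dimL X') * S) (T * 1\<^sub>m (dimL Y))"
    using path_carrier [OF X vX] path_carrier [OF Y vY]
    by (intro kron_mult) auto
  then have "kron (1\<^sub>m (dimL X')) T * kron S (1\<^sub>m (dimL Y)) = kron S T"
    using path_carrier [OF X vX] path_carrier [OF Y vY] by simp
  then show ?thesis using path_swap_imp [OF path_trans [OF 1 2 v]] by simp
qed

text \<open>The letters of \<open>XS\<close> are smaller than those of \<open>YS\<close>, those of \<open>NY\<close> smaller than those of \<open>NX\<close>, and negative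
  letters are smaller than positive ones; so each of the fused R-matrices exchanges two blocks in the
  direction that creates inversions.\<close>

lemma path_lhs: "path True (rev XS @ rev YS) (NX @ NY) lhs"
  and path_rhs: "path True (rev XS @ rev YS) (NX @ NY) rhs"
  and valid_rev: "valid (rev XS @ rev YS)"
proof -
  have v: "valid (rev XS)" "valid (rev YS)"
    using path_valid [OF path_KR_R_lists(1)] path_valid [OF path_KR_R_lists(2)] valid_append [OF valid_XY] by auto
  show v0: "valid (rev XS @ rev YS)"
    using path_valid [OF path_kron [OF path_KR_R_lists(1,2) valid_XY] valid_XY] .
  have l1: "path True (rev XS @ rev YS) (NX @ rev YS) (kron KX (1\<^sub>m (KR_dim M r' t)))"
    using path_append_right [OF path_KR_K_lists(1) v(1), of "rev YS"] by (simp add: dimL_rev dimL_lists)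
  have v1: "valid (NX @ rev YS)" by (rule path_valid [OF l1 v0])
  have l2: "path True (NX @ rev YS) (rev YS @ NX) (fused_R d M Rm (star r) s r' t (inverse x) y)"
    by (rule path_swap_imp, rule path_fused_R [OF coloured_lists(3,2) v1]) (auto simp: set_lists)
  have l3: "path True (rev YS @ NX) (NY @ NX) (kron KY (1\<^sub>m (KR_dim M (star r) s)))"
    using path_append_right [OF path_KR_K_lists(2) v(2), of NX] by (simp add: dimL_lists)
  have v2: "valid (NY @ NX)" by (rule path_valid [OF l3 path_valid [OF l2 v1]])
  have l4: "path True (NY @ NX) (NX @ NY) (fused_R d M Rm (star r') t (star r) s (inverse y) (inverse x))"
    by (rule path_swap_imp, rule path_fused_R [OF coloured_lists(4,3) v2]) (auto simp: set_lists)
  have v3: "valid (rev YS @ NX)" by (rule path_valid [OF l2 v1])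
  show "path True (rev XS @ rev YS) (NX @ NY) lhs"
    by (rule path_trans [OF l1 path_trans [OF l2 path_trans [OF l3 l4 v3] v1] v0])
  have r1: "path True (rev XS @ rev YS) (rev YS @ rev XS) (fused_R d M Rm r s r' t x y)"
    by (rule path_swap_imp, rule path_fused_R [OF coloured_lists(1,2) v0]) (auto simp: set_lists)
  have w1: "valid (rev YS @ rev XS)" by (rule path_valid [OF r1 v0])
  have r2: "path True (rev YS @ rev XS) (NY @ rev XS) (kron KY (1\<^sub>m (KR_dim M r s)))"
    using path_append_right [OF path_KR_K_lists(2) v(2), of "rev XS"] by (simp add: dimL_rev dimL_lists)
  have w2: "valid (NY @ rev XS)" by (rule path_valid [OF r2 w1])
  have r3: "path True (NY @ rev XS) (rev XS @ NY) (fused_R d M Rm (star r') t r s (inverse y) x)"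
    by (rule path_swap_imp, rule path_fused_R [OF coloured_lists(4,1) w2]) (auto simp: set_lists)
  have r4: "path True (rev XS @ NY) (NX @ NY) (kron KX (1\<^sub>m (KR_dim M (star r') t)))"
    using path_append_right [OF path_KR_K_lists(1) v(1), of NY] by (simp add: dimL_lists)
  show "path True (rev XS @ rev YS) (NX @ NY) rhs"
    by (rule path_trans [OF r1 path_trans [OF r2 path_trans [OF r3 r4 w2] w1] v0])
qed

lemma ex_path_source:
  "\<exists>P. path True (XS @ YS) (rev NX @ rev NY) P"
proof -
  have v: "valid XS" "valid YS" using valid_append [OF valid_XY] by auto
  obtain P1 where "path True XS (rev NX) P1"
    using ex_path_negate [OF v(1)] unfolding map_uminus_rev by (auto simp: set_lists)
  from path_append_right [OF this v(1), of YS]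
  have 1: "path True (XS @ YS) (rev NX @ YS) (kron P1 (1\<^sub>m (dimL YS)))" .
  \<comment> \<open>Only a first letter can change its sign, so the second block has to come to the front for it.\<close>
  obtain P2 where P2: "path False (rev NX @ YS) (YS @ rev NX) P2"
    using ex_path_exchange [OF valid_NXY(2)] by (auto simp: set_lists)
  obtain P3 where "path True YS (rev NY) P3"
    using ex_path_negate [OF v(2)] unfolding map_uminus_rev by (auto simp: set_lists)
  from path_append_right [OF this v(2), of "rev NX"]
  have 3: "path True (YS @ rev NX) (rev NY @ rev NX) (kron P3 (1\<^sub>m (dimL (rev NX))))" .
  note p = path_trans [OF path_trans [OF 1 path_swap_imp [OF P2] valid_XY] 3 valid_XY]
  obtain P4 where P4: "path False (rev NY @ rev NX) (rev NX @ rev NY) P4"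
    using ex_path_exchange [OF path_valid [OF p valid_XY]] by (auto simp: set_lists)
  show ?thesis using path_trans [OF p path_swap_imp [OF P4] valid_XY] by blast
qed

text \<open>Preceded by \<open>RXY\<close>, both sides lead from the sorted word to the same word, and so does \<open>P\<close> followed by
  \<open>RXY_star\<close>. As \<open>RXY\<close> maps onto the tensor product of the two source modules, and the image of \<open>RXY_star\<close> is
  that of the target modules, this is the reflection equation together with its codomain.\<close>

lemma KR_reflection:
  assumes "v \<in> tensor_space (KR_dim M r s) (KR_dim M r' t) (KR_module d M Rm r s) (KR_module d M Rm r' t)"
  shows "lhs *\<^sub>v v = rhs *\<^sub>v v"
    and "rhs *\<^sub>v v \<in> tensor_space (KR_dim M (star r) s) (KR_dim M (star r') t)
        (KR_module d M Rm (star r) s) (KR_module d M Rm (star r') t)"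
proof -
  let ?m = "KR_dim M r s * KR_dim M r' t" and ?n = "KR_dim M (star r) s * KR_dim M (star r') t"
  have R: "path True (XS @ YS) (rev XS @ rev YS) RXY"
    by (rule path_kron [OF path_KR_R_lists(1,2) valid_XY])
  have R_star: "path True (rev NX @ rev NY) (NX @ NY) RXY_star"
    by (rule path_kron [OF path_KR_R_lists(3,4) valid_NXY(1)])
  obtain P where P: "path True (XS @ YS) (rev NX @ rev NY) P" using ex_path_source by blast
  have c: "RXY \<in> carrier_mat ?m ?m" "RXY_star \<in> carrier_mat ?n ?n"
    "lhs \<in> carrier_mat ?n ?m" "rhs \<in> carrier_mat ?n ?m" "P \<in> carrier_mat ?n ?m"
    using path_carrier [OF R valid_XY] path_carrier [OF R_star valid_NXY(1)]
      path_carrier [OF path_lhs valid_rev] path_carrier [OF path_rhs valid_rev] path_carrier [OF P valid_XY]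
    by (simp_all only: dimL_simps(3) dimL_rev dimL_lists)
  have l: "path True (XS @ YS) (NX @ NY) (lhs * RXY)"
    by (rule path_trans [OF R path_lhs valid_XY])
  have r: "path True (XS @ YS) (NX @ NY) (rhs * RXY)"
    by (rule path_trans [OF R path_rhs valid_XY])
  have p: "path True (XS @ YS) (NX @ NY) (RXY_star * P)"
    by (rule path_trans [OF P R_star valid_XY])
  have eq: "lhs * RXY = rhs * RXY" "rhs * RXY = RXY_star * P"
    by (rule path_unique [OF l r valid_XY], rule path_unique [OF r p valid_XY])
  obtain z where z: "z \<in> carrier_vec ?m" "v = RXY *\<^sub>v z"
    using assms c(1) unfolding KR_module_def tensor_space_image [OF KR_R_carrier(1,2)]
    by (auto simp: image_space_def simp del: dim_kron)
  have l': "lhs *\<^sub>v v = (lhs * RXY) *\<^sub>v z"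
    unfolding z(2) by (rule assoc_mult_mat_vec [OF c(3,1) z(1), symmetric])
  have r': "rhs *\<^sub>v v = (rhs * RXY) *\<^sub>v z"
    unfolding z(2) by (rule assoc_mult_mat_vec [OF c(4,1) z(1), symmetric])
  show "lhs *\<^sub>v v = rhs *\<^sub>v v" unfolding l' r' eq(1) ..
  have "rhs *\<^sub>v v = RXY_star *\<^sub>v (P *\<^sub>v z)"
    unfolding r' eq(2) by (rule assoc_mult_mat_vec [OF c(2,5) z(1)])
  moreover have "P *\<^sub>v z \<in> carrier_vec ?n" using c(5) z(1) by (rule mult_mat_vec_carrier)
  ultimately show "rhs *\<^sub>v v \<in> tensor_space (KR_dim M (star r) s) (KR_dim M (star r') t)
        (KR_module d M Rm (star r) s) (KR_module d M Rm (star r') t)"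
    unfolding KR_module_def tensor_space_image [OF KR_R_carrier(3,4)]
    unfolding image_space_def carrier_matD(2) [OF c(2)]
    by blast
qed

end

theorem proposition2:
  fixes A :: "'i::finite \<Rightarrow> 'i \<Rightarrow> int" and d :: "'i \<Rightarrow> nat" and i0 r r' :: 'i
    and w0 :: "'i list" and dual star :: "'i \<Rightarrow> 'i"
    and M :: "'i \<Rightarrow> 'i umodule" and Rm :: "'i \<Rightarrow> 'i \<Rightarrow> ratmat" and Km :: "'i \<Rightarrow> ratmat"
  assumes "affine_cartan A" and "symmetrizer A d" and "affine_node A i0"
    and "r \<noteq> i0" and "r' \<noteq> i0"
    and "longest_element A (- {i0}) w0"
    and "\<And>a. a \<noteq> i0 \<Longrightarrow> dual a \<noteq> i0 \<and>
           (\<forall>i. - weyl_weight A (level_zero_weight A i0 a) w0 i = level_zero_weight A i0 (dual a) i)"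
    and "star = id \<or> star = dual"
    and "\<And>a. a \<in> {r, r', star r, star r'} \<Longrightarrow> fundamental_module A d i0 a (M a)"
    and "quantum_R_matrices i0 {r, r', star r, star r'} M Rm"
    and "quantum_K_matrices star {r, r'} M Rm Km"
  shows
    "(\<forall>s x. s \<ge> 1 \<and> x \<noteq> 0 \<and>
        KR_defined d Rm r s \<and> KR_defined d Rm (star r) s \<and> KR_K_defined star d Rm Km r s x \<longrightarrow>
        (\<forall>v\<in>KR_module d M Rm r s.
           KR_K star d M Rm Km r s x *\<^sub>v v \<in> KR_module d M Rm (star r) s))
     \<and>
     (\<forall>s s' x y. s \<ge> 1 \<and> s' \<ge> 1 \<and> x \<noteq> 0 \<and> y \<noteq> 0 \<and>
        KR_defined d Rm r s \<and> KR_defined d Rm (star r) s \<and>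
        KR_defined d Rm r' s' \<and> KR_defined d Rm (star r') s' \<and>
        KR_K_defined star d Rm Km r s x \<and> KR_K_defined star d Rm Km r' s' y \<and>
        fused_R_defined d Rm r s r' s' x y \<and>
        fused_R_defined d Rm (star r') s' r s (inverse y) x \<and>
        fused_R_defined d Rm (star r) s r' s' (inverse x) y \<and>
        fused_R_defined d Rm (star r') s' (star r) s (inverse y) (inverse x) \<longrightarrow>
        (\<forall>v\<in>tensor_space (KR_dim M r s) (KR_dim M r' s')
              (KR_module d M Rm r s) (KR_module d M Rm r' s').
           (fused_R d M Rm (star r') s' (star r) s (inverse y) (inverse x)
            * kron (KR_K star d M Rm Km r' s' y) (1\<^sub>m (KR_dim M (star r) s))
            * fused_R d M Rm (star r) s r' s' (inverse x) y
            * kron (KR_K star d M Rm Km r s x) (1\<^sub>m (KR_dim M r' s'))) *\<^sub>v v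
         = (kron (KR_K star d M Rm Km r s x) (1\<^sub>m (KR_dim M (star r') s'))
            * fused_R d M Rm (star r') s' r s (inverse y) x
            * kron (KR_K star d M Rm Km r' s' y) (1\<^sub>m (KR_dim M r s))
            * fused_R d M Rm r s r' s' x y) *\<^sub>v v
         \<and> (kron (KR_K star d M Rm Km r s x) (1\<^sub>m (KR_dim M (star r') s'))
            * fused_R d M Rm (star r') s' r s (inverse y) x
            * kron (KR_K star d M Rm Km r' s' y) (1\<^sub>m (KR_dim M r s))
            * fused_R d M Rm r s r' s' x y) *\<^sub>v v
           \<in> tensor_space (KR_dim M (star r) s) (KR_dim M (star r') s')
               (KR_module d M Rm (star r) s) (KR_module d M Rm (star r') s')))"
proof -
  have diag: "A i i = 2" for i using assms(1) by (simp add: affine_cartan_def)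
  have w0: "set w0 \<subseteq> - {i0}" using assms(6) by (simp add: longest_element_def)
  have d_star: "d (star a) = d a" if "a \<noteq> i0" for a
    using assms(8) dual_symmetrizer [OF diag assms(2) w0 assms(7) that] by auto
  show ?thesis
  proof (intro conjI allI impI ballI, goal_cases)
    case (1 s x v)
    (* The second block is empty here, so that its parameter may be any nonzero number. *)
    interpret KR_pair i0 d M Rm Km star r r' s 0 x 1
      by unfold_locales
        (use 1 assms(4,5,10,11) d_star in \<open>auto simp: KR_defined_def KR_K_defined_def fused_R_defined_def\<close>)
    show ?case by (rule KR_K_maps_KR_module [OF 1(2)])
  next
    case (2 s s' x y v)
    interpret KR_pair i0 d M Rm Km star r r' s s' x y
      by unfold_locales (use 2 assms(4,5,10,11) d_star in auto)
    show ?case by (rule KR_reflection(1) [OF 2(2)])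
  next
    case (3 s s' x y v)
    interpret KR_pair i0 d M Rm Km star r r' s s' x y
      by unfold_locales (use 3 assms(4,5,10,11) d_star in auto)
    show ?case by (rule KR_reflection(2) [OF 3(2)])
  qed
qed

end
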